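(* Let $R$ and $T$ be Artin algebras, and assume that there exists a biseparable $(T,R)$-bimodule $M$. Then $R$ is of finite representation type if and only if $T$ is of finite representation type.
   Context: Rings are associative with unit. An Artin algebra is an algebra over a commutative Artin ring $k$ that is finitely generated as a $k$-module. It is of finite representation type if there are only finitely many isomorphism classes of finitely generated indecomposable left modules. For a $(T,R)$-bimodule $M$, put $M^*=\mathrm{Hom}_R(M,R)$ (right $R$-linear maps) and ${}^*M={}_T\mathrm{Hom}(M,T)$ (left $T$-linear maps, written on the right of their argument); both are $(R,T)$-bimodules via $(rft)(m)=rf(tm)$ and $(m)(rgt)=((mr)g)t$. $M$ is separable if the evaluation map $M\otimes_R {}^*M\to T$, $m\otimes f\mapsto (m)f$, is a split epimorphism of $T$-bimodules. $M$ is biseparable if $M$ is a separable $(T,R)$-bimodule, $M^*$ is a separable $(R,T)$-bimodule, and ${}_TM$, $M_R$ are finitely generated projective. *)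

theory Defs
  imports "HOL-Algebra.Algebra"
begin

section \<open>Left modules over a not necessarily commutative ring\<close>

text \<open>The locale \<^locale>\<open>module\<close> of HOL-Algebra requires a commutative ring of scalars, so only
  its record (whose fields \<^const>\<open>monoid.mult\<close> and \<^const>\<open>one\<close> are irrelevant for modules) and its
  locale \<^locale>\<open>submodule\<close> are reused here.\<close>

locale left_module = R?: ring R + M?: abelian_group M
  for R :: "('a, 'c) ring_scheme" (structure) and M :: "('a, 'm, 'd) module_scheme" (structure) +
  assumes smult_closed [simp, intro]:
      "\<lbrakk>a \<in> carrier R; x \<in> carrier M\<rbrakk> \<Longrightarrow> a \<odot>\<^bsub>M\<^esub> x \<in> carrier M"
    and smult_l_distr:
      "\<lbrakk>a \<in> carrier R; b \<in> carrier R; x \<in> carrier M\<rbrakk> \<Longrightarrow>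
        (a \<oplus> b) \<odot>\<^bsub>M\<^esub> x = a \<odot>\<^bsub>M\<^esub> x \<oplus>\<^bsub>M\<^esub> b \<odot>\<^bsub>M\<^esub> x"
    and smult_r_distr:
      "\<lbrakk>a \<in> carrier R; x \<in> carrier M; y \<in> carrier M\<rbrakk> \<Longrightarrow>
        a \<odot>\<^bsub>M\<^esub> (x \<oplus>\<^bsub>M\<^esub> y) = a \<odot>\<^bsub>M\<^esub> x \<oplus>\<^bsub>M\<^esub> a \<odot>\<^bsub>M\<^esub> y"
    and smult_assoc1:
      "\<lbrakk>a \<in> carrier R; b \<in> carrier R; x \<in> carrier M\<rbrakk> \<Longrightarrow>
        (a \<otimes> b) \<odot>\<^bsub>M\<^esub> x = a \<odot>\<^bsub>M\<^esub> (b \<odot>\<^bsub>M\<^esub> x)"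
    and smult_one [simp]: "x \<in> carrier M \<Longrightarrow> \<one> \<odot>\<^bsub>M\<^esub> x = x"

definition lmod_hom ::
  "('a, 'c) ring_scheme \<Rightarrow> ('a, 'm, 'd) module_scheme \<Rightarrow> ('a, 'n, 'e) module_scheme \<Rightarrow> ('m \<Rightarrow> 'n) set"
  where "lmod_hom R M N =
    {h \<in> carrier M \<rightarrow> carrier N.
       (\<forall>x\<in>carrier M. \<forall>y\<in>carrier M. h (x \<oplus>\<^bsub>M\<^esub> y) = h x \<oplus>\<^bsub>N\<^esub> h y) \<and>
       (\<forall>a\<in>carrier R. \<forall>x\<in>carrier M. h (a \<odot>\<^bsub>M\<^esub> x) = a \<odot>\<^bsub>N\<^esub> h x)}"

definition lmod_iso ::
  "('a, 'c) ring_scheme \<Rightarrow> ('a, 'm, 'd) module_scheme \<Rightarrow> ('a, 'n, 'e) module_scheme \<Rightarrow> bool"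
  where "lmod_iso R M N \<longleftrightarrow> (\<exists>h\<in>lmod_hom R M N. bij_betw h (carrier M) (carrier N))"

definition fin_gen_module :: "('a, 'c) ring_scheme \<Rightarrow> ('a, 'm, 'd) module_scheme \<Rightarrow> bool"
  where "fin_gen_module R M \<longleftrightarrow>
    (\<exists>A. finite A \<and> A \<subseteq> carrier M \<and>
      (\<forall>x\<in>carrier M. \<exists>c\<in>A \<rightarrow> carrier R. x = (\<Oplus>\<^bsub>M\<^esub>a\<in>A. c a \<odot>\<^bsub>M\<^esub> a)))"

definition indecomposable_module :: "('a, 'c) ring_scheme \<Rightarrow> ('a, 'm, 'd) module_scheme \<Rightarrow> bool"
  where "indecomposable_module R M \<longleftrightarrow>
    carrier M \<noteq> {\<zero>\<^bsub>M\<^esub>} \<and>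
    (\<forall>A B. submodule A R M \<and> submodule B R M \<and>
       A <+>\<^bsub>M\<^esub> B = carrier M \<and> A \<inter> B = {\<zero>\<^bsub>M\<^esub>} \<longrightarrow> A = {\<zero>\<^bsub>M\<^esub>} \<or> B = {\<zero>\<^bsub>M\<^esub>})"

text \<open>Projectivity is the lifting property against epimorphisms \<open>A \<rightarrow> B\<close>. HOL cannot quantify over
  the carrier types of \<open>A\<close> and \<open>B\<close>; the types chosen accommodate the canonical epimorphism from the
  free module on the set \<open>P\<close> onto \<open>P\<close>, and the lifting property for all carrier types follows
  (lemma \<open>projective_module_lift\<close> below).\<close>

definition projective_module :: "('a, 'c) ring_scheme \<Rightarrow> ('a, 'm, 'd) module_scheme \<Rightarrow> bool"
  where "projective_module R P \<longleftrightarrow> left_module R P \<and>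
    (\<forall>(A :: ('a, 'm \<Rightarrow> 'a) module) (B :: ('a, 'm) module) g f.
       left_module R A \<and> left_module R B \<and>
       g \<in> lmod_hom R A B \<and> g ` carrier A = carrier B \<and> f \<in> lmod_hom R P B \<longrightarrow>
       (\<exists>h\<in>lmod_hom R P A. \<forall>x\<in>carrier P. g (h x) = f x))"


section \<open>Finite representation type\<close>

text \<open>Every finitely generated module over a ring with elements of type \<open>'a\<close> is isomorphic to one
  with carrier of type \<open>(nat \<Rightarrow> 'a) set\<close>, being a quotient of a module of \<open>n\<close>-tuples
  (lemma \<open>fin_gen_module_universe\<close> below). Isomorphism classes are therefore formed within that
  type.\<close>

definition fg_indec_modules :: "('a, 'c) ring_scheme \<Rightarrow> ('a, (nat \<Rightarrow> 'a) set) module set"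
  where "fg_indec_modules R =
    {M. left_module R M \<and> fin_gen_module R M \<and> indecomposable_module R M}"

definition finite_representation_type :: "('a, 'c) ring_scheme \<Rightarrow> bool"
  where "finite_representation_type R \<longleftrightarrow>
    finite (fg_indec_modules R //
      {(M, N). M \<in> fg_indec_modules R \<and> N \<in> fg_indec_modules R \<and> lmod_iso R M N})"


section \<open>Artin algebras\<close>

locale artinian_cring = cring +
  assumes descending_chain_condition:
    "\<lbrakk>\<And>n. ideal (I n) R; \<And>n. I (Suc n) \<subseteq> I n\<rbrakk> \<Longrightarrow> \<exists>n. \<forall>m\<ge>n. I m = I (n::nat)"

definition restrict_scalars ::
  "('k \<Rightarrow> 'a) \<Rightarrow> ('a, 'c) ring_scheme \<Rightarrow> ('k, 'a) module"
  where "restrict_scalars \<phi> R =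
    \<lparr>carrier = carrier R, monoid.mult = monoid.mult R, one = one R, ring.zero = ring.zero R,
     add = add R,
     smult = (\<lambda>c x. \<phi> c \<otimes>\<^bsub>R\<^esub> x)\<rparr>"

text \<open>\<open>\<phi>\<close> is the structure map of \<open>R\<close> as a \<open>k\<close>-algebra. Being an algebra here does not include
  commutativity of \<open>R\<close>, unlike in the locale \<^locale>\<open>algebra\<close>.\<close>

locale artin_algebra = k?: artinian_cring k + R?: ring R
  for k :: "('k, 'b) ring_scheme" (structure) and R :: "('a, 'c) ring_scheme" (structure) and \<phi> +
  assumes structure_map: "\<phi> \<in> ring_hom k R"
    and central: "\<lbrakk>c \<in> carrier k; x \<in> carrier R\<rbrakk> \<Longrightarrow> \<phi> c \<otimes>\<^bsub>R\<^esub> x = x \<otimes>\<^bsub>R\<^esub> \<phi> c"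
    and finitely_generated: "fin_gen_module k (restrict_scalars \<phi> R)"


section \<open>Bimodules\<close>

record ('t, 'r, 'm) bimodule = "('t, 'm) module" +
  rsmult :: "'m \<Rightarrow> 'r \<Rightarrow> 'm" (infixl \<open>\<odot>\<^sub>r\<index>\<close> 70)

text \<open>Right \<open>R\<close>-modules are left modules over the opposite ring of \<open>R\<close>.\<close>

definition op_ring :: "('a, 'c) ring_scheme \<Rightarrow> ('a, 'c) ring_scheme"
  where "op_ring R = R\<lparr>monoid.mult := (\<lambda>x y. y \<otimes>\<^bsub>R\<^esub> x)\<rparr>"

definition right_part :: "('t, 'r, 'm, 'd) bimodule_scheme \<Rightarrow> ('r, 'm) module"
  where "right_part M =
    \<lparr>carrier = carrier M, monoid.mult = monoid.mult M, one = one M, ring.zero = ring.zero M,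
     add = add M,
     smult = (\<lambda>r x. x \<odot>\<^sub>r\<^bsub>M\<^esub> r)\<rparr>"

locale bimodule = left_module T M + right_ring: ring R +
  right: left_module "op_ring R" "right_part M"
  for T :: "('t, 'b) ring_scheme" (structure) and R :: "('r, 'c) ring_scheme" (structure)
    and M :: "('t, 'r, 'm, 'd) bimodule_scheme" (structure) +
  assumes smult_rsmult: "\<lbrakk>t \<in> carrier T; x \<in> carrier M; r \<in> carrier R\<rbrakk> \<Longrightarrow>
    (t \<odot>\<^bsub>M\<^esub> x) \<odot>\<^sub>r\<^bsub>M\<^esub> r = t \<odot>\<^bsub>M\<^esub> (x \<odot>\<^sub>r\<^bsub>M\<^esub> r)"

definition bimod_hom ::
  "('t, 'b) ring_scheme \<Rightarrow> ('r, 'c) ring_scheme \<Rightarrow> ('t, 'r, 'm, 'd) bimodule_scheme \<Rightarrow>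
    ('t, 'r, 'n, 'e) bimodule_scheme \<Rightarrow> ('m \<Rightarrow> 'n) set"
  where "bimod_hom T R M N =
    {h \<in> carrier M \<rightarrow> carrier N.
       (\<forall>x\<in>carrier M. \<forall>y\<in>carrier M. h (x \<oplus>\<^bsub>M\<^esub> y) = h x \<oplus>\<^bsub>N\<^esub> h y) \<and>
       (\<forall>t\<in>carrier T. \<forall>x\<in>carrier M. h (t \<odot>\<^bsub>M\<^esub> x) = t \<odot>\<^bsub>N\<^esub> h x) \<and>
       (\<forall>r\<in>carrier R. \<forall>x\<in>carrier M. h (x \<odot>\<^sub>r\<^bsub>M\<^esub> r) = h x \<odot>\<^sub>r\<^bsub>N\<^esub> r)}"

definition regular_bimodule :: "('t, 'b) ring_scheme \<Rightarrow> ('t, 't, 't) bimodule"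
  where "regular_bimodule T =
    \<lparr>carrier = carrier T, monoid.mult = monoid.mult T, one = one T, ring.zero = ring.zero T,
     add = add T,
     smult = monoid.mult T, rsmult = monoid.mult T\<rparr>"

text \<open>The duals \<open>M\<^sup>* = Hom\<^sub>R(M, R)\<close> and \<open>\<^sup>*M = \<^sub>THom(M, T)\<close> of a \<open>(T, R)\<close>-bimodule. Homomorphisms are
  taken extensional, i.e. \<^const>\<open>undefined\<close> outside \<open>M\<close>, so that they are determined by their values
  on \<open>M\<close>.\<close>

definition right_dual ::
  "('t, 'b) ring_scheme \<Rightarrow> ('r, 'c) ring_scheme \<Rightarrow> ('t, 'r, 'm, 'd) bimodule_scheme \<Rightarrow>
    ('r, 't, 'm \<Rightarrow> 'r) bimodule"
  where "right_dual T R M =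
    \<lparr>carrier = {f \<in> carrier M \<rightarrow>\<^sub>E carrier R.
       (\<forall>x\<in>carrier M. \<forall>y\<in>carrier M. f (x \<oplus>\<^bsub>M\<^esub> y) = f x \<oplus>\<^bsub>R\<^esub> f y) \<and>
       (\<forall>x\<in>carrier M. \<forall>r\<in>carrier R. f (x \<odot>\<^sub>r\<^bsub>M\<^esub> r) = f x \<otimes>\<^bsub>R\<^esub> r)},
     monoid.mult = undefined, one = undefined,
     ring.zero = (\<lambda>x\<in>carrier M. \<zero>\<^bsub>R\<^esub>),
     add = (\<lambda>f g. \<lambda>x\<in>carrier M. f x \<oplus>\<^bsub>R\<^esub> g x),
     smult = (\<lambda>r f. \<lambda>x\<in>carrier M. r \<otimes>\<^bsub>R\<^esub> f x),
     rsmult = (\<lambda>f t. \<lambda>x\<in>carrier M. f (t \<odot>\<^bsub>M\<^esub> x))\<rparr>"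

definition left_dual ::
  "('t, 'b) ring_scheme \<Rightarrow> ('r, 'c) ring_scheme \<Rightarrow> ('t, 'r, 'm, 'd) bimodule_scheme \<Rightarrow>
    ('r, 't, 'm \<Rightarrow> 't) bimodule"
  where "left_dual T R M =
    \<lparr>carrier = {f \<in> carrier M \<rightarrow>\<^sub>E carrier T.
       (\<forall>x\<in>carrier M. \<forall>y\<in>carrier M. f (x \<oplus>\<^bsub>M\<^esub> y) = f x \<oplus>\<^bsub>T\<^esub> f y) \<and>
       (\<forall>t\<in>carrier T. \<forall>x\<in>carrier M. f (t \<odot>\<^bsub>M\<^esub> x) = t \<otimes>\<^bsub>T\<^esub> f x)},
     monoid.mult = undefined, one = undefined,
     ring.zero = (\<lambda>x\<in>carrier M. \<zero>\<^bsub>T\<^esub>),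
     add = (\<lambda>f g. \<lambda>x\<in>carrier M. f x \<oplus>\<^bsub>T\<^esub> g x),
     smult = (\<lambda>r f. \<lambda>x\<in>carrier M. f (x \<odot>\<^sub>r\<^bsub>M\<^esub> r)),
     rsmult = (\<lambda>f t. \<lambda>x\<in>carrier M. f x \<otimes>\<^bsub>T\<^esub> t)\<rparr>"


section \<open>Tensor products\<close>

text \<open>\<open>M \<otimes>\<^sub>R N\<close> for a \<open>(T, R)\<close>-bimodule \<open>M\<close> and an \<open>(R, S)\<close>-bimodule \<open>N\<close> is the quotient of the
  free abelian group on \<open>M \<times> N\<close> by the usual relations; its elements are cosets.\<close>

abbreviation tensor_free ::
  "('t, 'r, 'm, 'd) bimodule_scheme \<Rightarrow> ('r, 's, 'n, 'e) bimodule_scheme \<Rightarrow> ('m \<times> 'n \<Rightarrow>\<^sub>0 int) monoid"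
  where "tensor_free M N \<equiv> free_Abelian_group (carrier M \<times> carrier N)"

definition tensor_relations ::
  "('r, 'c) ring_scheme \<Rightarrow> ('t, 'r, 'm, 'd) bimodule_scheme \<Rightarrow> ('r, 's, 'n, 'e) bimodule_scheme \<Rightarrow>
    ('m \<times> 'n \<Rightarrow>\<^sub>0 int) set"
  where "tensor_relations R M N = generate (tensor_free M N)
    ({frag_of (x \<oplus>\<^bsub>M\<^esub> x', y) - frag_of (x, y) - frag_of (x', y) | x x' y.
        x \<in> carrier M \<and> x' \<in> carrier M \<and> y \<in> carrier N} \<union>
     {frag_of (x, y \<oplus>\<^bsub>N\<^esub> y') - frag_of (x, y) - frag_of (x, y') | x y y'.
        x \<in> carrier M \<and> y \<in> carrier N \<and> y' \<in> carrier N} \<union>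
     {frag_of (x \<odot>\<^sub>r\<^bsub>M\<^esub> r, y) - frag_of (x, r \<odot>\<^bsub>N\<^esub> y) | x r y.
        x \<in> carrier M \<and> r \<in> carrier R \<and> y \<in> carrier N})"

text \<open>The scalar actions are \<open>t (x \<otimes> y) = (t x) \<otimes> y\<close> and \<open>(x \<otimes> y) s = x \<otimes> (y s)\<close>, extended
  additively to the free group and then to cosets.\<close>

definition tensor_product ::
  "('r, 'c) ring_scheme \<Rightarrow> ('t, 'r, 'm, 'd) bimodule_scheme \<Rightarrow> ('r, 's, 'n, 'e) bimodule_scheme \<Rightarrow>
    ('t, 's, ('m \<times> 'n \<Rightarrow>\<^sub>0 int) set) bimodule"
  where "tensor_product R M N =
    (let F = tensor_free M N; K = tensor_relations R M N in
     \<lparr>carrier = carrier (F Mod K), monoid.mult = undefined, one = undefined,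
      ring.zero = \<one>\<^bsub>F Mod K\<^esub>, add = monoid.mult (F Mod K),
      smult = (\<lambda>t Z. K <#>\<^bsub>F\<^esub> (frag_extend (\<lambda>(x, y). frag_of (t \<odot>\<^bsub>M\<^esub> x, y)) ` Z)),
      rsmult = (\<lambda>Z s. K <#>\<^bsub>F\<^esub> (frag_extend (\<lambda>(x, y). frag_of (x, y \<odot>\<^sub>r\<^bsub>N\<^esub> s)) ` Z))\<rparr>)"

text \<open>The map \<open>M \<otimes>\<^sub>R \<^sup>*M \<rightarrow> T\<close>, \<open>x \<otimes> f \<mapsto> f x\<close>: its value on a coset is the common value of the
  additive extension of \<open>(x, f) \<mapsto> f x\<close> on the elements of the coset.\<close>

definition evaluation ::
  "('t, 'b) ring_scheme \<Rightarrow> ('m \<times> ('m \<Rightarrow> 't) \<Rightarrow>\<^sub>0 int) set \<Rightarrow> 't"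
  where "evaluation T Z = the_elem
    ((\<lambda>c. \<Oplus>\<^bsub>T\<^esub>p\<in>Poly_Mapping.keys c. [Poly_Mapping.lookup c p] \<cdot>\<^bsub>T\<^esub> (snd p (fst p))) ` Z)"


section \<open>Separable and biseparable bimodules\<close>

definition separable_bimodule ::
  "('t, 'b) ring_scheme \<Rightarrow> ('r, 'c) ring_scheme \<Rightarrow> ('t, 'r, 'm, 'd) bimodule_scheme \<Rightarrow> bool"
  where "separable_bimodule T R M \<longleftrightarrow> bimodule T R M \<and>
    (\<exists>s\<in>bimod_hom T T (regular_bimodule T) (tensor_product R M (left_dual T R M)).
       \<forall>t\<in>carrier T. evaluation T (s t) = t)"

definition biseparable_bimodule ::
  "('t, 'b) ring_scheme \<Rightarrow> ('r, 'c) ring_scheme \<Rightarrow> ('t, 'r, 'm, 'd) bimodule_scheme \<Rightarrow> bool"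
  where "biseparable_bimodule T R M \<longleftrightarrow>
    separable_bimodule T R M \<and>
    separable_bimodule R T (right_dual T R M) \<and>
    fin_gen_module T M \<and> projective_module T M \<and>
    fin_gen_module (op_ring R) (right_part M) \<and> projective_module (op_ring R) (right_part M)"


section \<open>Independence of the choice of carrier types\<close>

lemma left_module_transport:
  fixes M :: "('a, 'm, 'd) module_scheme" and e :: "'m \<Rightarrow> 'n"
  assumes "left_module R M" and inj: "inj_on e (carrier M)"
  shows "\<exists>N :: ('a, 'n) module. left_module R N \<and> lmod_iso R M N"
proof -
  interpret left_module R M by fact
  define d where "d = inv_into (carrier M) e"
  have de [simp]: "d (e x) = x" if "x \<in> carrier M" for x
    unfolding d_def using inj that by simp
  define N :: "('a, 'n) module" where "N =
    \<lparr>carrier = e ` carrier M, monoid.mult = undefined, one = undefined, ring.zero = e \<zero>\<^bsub>M\<^esub>,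
     add = (\<lambda>x y. e (d x \<oplus>\<^bsub>M\<^esub> d y)), smult = (\<lambda>a x. e (a \<odot>\<^bsub>M\<^esub> d x))\<rparr>"
  have N: "carrier N = e ` carrier M" "\<zero>\<^bsub>N\<^esub> = e \<zero>\<^bsub>M\<^esub>"
    "x \<oplus>\<^bsub>N\<^esub> y = e (d x \<oplus>\<^bsub>M\<^esub> d y)" "a \<odot>\<^bsub>N\<^esub> x = e (a \<odot>\<^bsub>M\<^esub> d x)" for a x y
    by (simp_all add: N_def)
  have "abelian_group N"
  proof (rule abelian_groupI)
    show "\<exists>y\<in>carrier N. y \<oplus>\<^bsub>N\<^esub> x = \<zero>\<^bsub>N\<^esub>" if x: "x \<in> carrier N" for x
    proof -
      from x obtain u where "u \<in> carrier M" "x = e u" by (auto simp: N)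
      then show ?thesis
        by (intro bexI[of _ "e (\<ominus>\<^bsub>M\<^esub> u)"]) (auto simp: N M.l_neg)
    qed
  qed (auto simp: N M.a_ac)
  then have "left_module R N"
    by (intro left_module.intro left_module_axioms.intro R.ring_axioms)
      (auto simp: N smult_l_distr smult_r_distr smult_assoc1)
  moreover have "lmod_iso R M N"
    unfolding lmod_iso_def
    by (rule bexI[of _ e]) (auto simp: lmod_hom_def N bij_betw_def inj)
  ultimately show ?thesis by blast
qed

lemma fin_gen_module_universe:
  fixes M :: "('a, 'm, 'd) module_scheme"
  assumes "left_module R M" and "fin_gen_module R M"
  shows "\<exists>N :: ('a, (nat \<Rightarrow> 'a) set) module. left_module R N \<and> lmod_iso R M N"
proof -
  interpret left_module R M by fact
  obtain A where A: "finite A" "A \<subseteq> carrier M"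
    and gen: "\<forall>x\<in>carrier M. \<exists>c\<in>A \<rightarrow> carrier R. x = (\<Oplus>\<^bsub>M\<^esub>a\<in>A. c a \<odot>\<^bsub>M\<^esub> a)"
    using assms(2) unfolding fin_gen_module_def by blast
  obtain j :: "'m \<Rightarrow> nat" where j: "inj_on j A"
    using finite_imp_inj_to_nat_seg[OF A(1)] by blast
  define e where "e x = {c. x = (\<Oplus>\<^bsub>M\<^esub>a\<in>A. c (j a) \<odot>\<^bsub>M\<^esub> a)}" for x
  have "e x \<noteq> {}" if x: "x \<in> carrier M" for x
  proof -
    obtain c where c: "c \<in> A \<rightarrow> carrier R" "x = (\<Oplus>\<^bsub>M\<^esub>a\<in>A. c a \<odot>\<^bsub>M\<^esub> a)"
      using gen x by blast
    have "(\<Oplus>\<^bsub>M\<^esub>a\<in>A. c a \<odot>\<^bsub>M\<^esub> a) = (\<Oplus>\<^bsub>M\<^esub>a\<in>A. c (inv_into A j (j a)) \<odot>\<^bsub>M\<^esub> a)"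
      by (rule M.finsum_cong') (use c(1) A j in \<open>auto intro!: smult_closed\<close>)
    then have "(\<lambda>i. c (inv_into A j i)) \<in> e x" by (simp add: e_def c)
    then show ?thesis by blast
  qed
  then have "inj_on e (carrier M)"
    by (intro inj_onI) (auto simp: e_def)
  then show ?thesis by (rule left_module_transport[OF assms(1)])
qed

text \<open>The free module on \<open>I\<close>, and the additive extension of a map from \<open>I\<close>.\<close>

definition free_lmod :: "('a, 'c) ring_scheme \<Rightarrow> 'i set \<Rightarrow> ('a, 'i \<Rightarrow> 'a) module"
  where "free_lmod R I =
    \<lparr>carrier = {c. range c \<subseteq> carrier R \<and> finite {i. c i \<noteq> \<zero>\<^bsub>R\<^esub>} \<and> {i. c i \<noteq> \<zero>\<^bsub>R\<^esub>} \<subseteq> I},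
     monoid.mult = undefined, one = undefined, ring.zero = (\<lambda>_. \<zero>\<^bsub>R\<^esub>),
     add = (\<lambda>c d i. c i \<oplus>\<^bsub>R\<^esub> d i), smult = (\<lambda>a c i. a \<otimes>\<^bsub>R\<^esub> c i)\<rparr>"

definition lin_ext :: "('a, 'c) ring_scheme \<Rightarrow> ('a, 'm, 'd) module_scheme \<Rightarrow>
    ('i \<Rightarrow> 'm) \<Rightarrow> ('i \<Rightarrow> 'a) \<Rightarrow> 'm"
  where "lin_ext R M \<phi> c = (\<Oplus>\<^bsub>M\<^esub>i\<in>{i. c i \<noteq> \<zero>\<^bsub>R\<^esub>}. c i \<odot>\<^bsub>M\<^esub> \<phi> i)"

lemma free_lmod:
  assumes "ring R" shows "left_module R (free_lmod R I)"
proof -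
  interpret ring R by fact
  let ?s = "\<lambda>c. {i. c i \<noteq> \<zero>\<^bsub>R\<^esub>}"
  have "abelian_group (free_lmod R I)"
  proof (rule abelian_groupI)
    fix c d assume cd: "c \<in> carrier (free_lmod R I)" "d \<in> carrier (free_lmod R I)"
    then have r: "c i \<in> carrier R" "d i \<in> carrier R" for i by (auto simp: free_lmod_def)
    have "?s (\<lambda>i. c i \<oplus>\<^bsub>R\<^esub> d i) \<subseteq> ?s c \<union> ?s d" by auto
    then show "c \<oplus>\<^bsub>free_lmod R I\<^esub> d \<in> carrier (free_lmod R I)"
      using cd r by (auto simp: free_lmod_def intro: finite_subset[of _ "?s c \<union> ?s d"])
    show "c \<oplus>\<^bsub>free_lmod R I\<^esub> d = d \<oplus>\<^bsub>free_lmod R I\<^esub> c"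
      using r by (simp add: free_lmod_def a_comm)
    have "\<ominus>\<^bsub>R\<^esub> c i = \<zero>\<^bsub>R\<^esub> \<longleftrightarrow> c i = \<zero>\<^bsub>R\<^esub>" for i
      using r by (metis minus_minus minus_zero)
    then show "\<exists>d\<in>carrier (free_lmod R I). d \<oplus>\<^bsub>free_lmod R I\<^esub> c = \<zero>\<^bsub>free_lmod R I\<^esub>"
      using cd r by (intro bexI[of _ "\<lambda>i. \<ominus>\<^bsub>R\<^esub> c i"]) (auto simp: free_lmod_def l_neg)
  next
    fix c d u assume "c \<in> carrier (free_lmod R I)" "d \<in> carrier (free_lmod R I)"
      "u \<in> carrier (free_lmod R I)"
    then have "c i \<in> carrier R" "d i \<in> carrier R" "u i \<in> carrier R" for i
      by (auto simp: free_lmod_def)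
    then show "c \<oplus>\<^bsub>free_lmod R I\<^esub> d \<oplus>\<^bsub>free_lmod R I\<^esub> u = c \<oplus>\<^bsub>free_lmod R I\<^esub> (d \<oplus>\<^bsub>free_lmod R I\<^esub> u)"
      by (simp add: free_lmod_def a_assoc)
  qed (auto simp: free_lmod_def image_subset_iff)
  moreover have "a \<odot>\<^bsub>free_lmod R I\<^esub> c \<in> carrier (free_lmod R I)"
    if "a \<in> carrier R" "c \<in> carrier (free_lmod R I)" for a c
  proof -
    have "?s (\<lambda>i. a \<otimes>\<^bsub>R\<^esub> c i) \<subseteq> ?s c" using that by auto
    then show ?thesis
      using that by (auto simp: free_lmod_def image_subset_iff intro: finite_subset[of _ "?s c"])
  qed
  ultimately show ?thesis
    by (intro left_module.intro left_module_axioms.intro ring_axioms)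
      (auto simp: free_lmod_def image_subset_iff l_distr r_distr m_assoc)
qed

context left_module
begin

lemma smult_zeros [simp]:
  "x \<in> carrier M \<Longrightarrow> \<zero> \<odot>\<^bsub>M\<^esub> x = \<zero>\<^bsub>M\<^esub>"
  "a \<in> carrier R \<Longrightarrow> a \<odot>\<^bsub>M\<^esub> \<zero>\<^bsub>M\<^esub> = \<zero>\<^bsub>M\<^esub>"
proof -
  assume x: "x \<in> carrier M"
  then have "\<zero> \<odot>\<^bsub>M\<^esub> x = \<zero> \<odot>\<^bsub>M\<^esub> x \<oplus>\<^bsub>M\<^esub> \<zero> \<odot>\<^bsub>M\<^esub> x"
    using smult_l_distr[of \<zero> \<zero> x] by simp
  with x show "\<zero> \<odot>\<^bsub>M\<^esub> x = \<zero>\<^bsub>M\<^esub>"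
    by (metis M.add.r_cancel_one' R.zero_closed smult_closed)
next
  assume a: "a \<in> carrier R"
  then have "a \<odot>\<^bsub>M\<^esub> \<zero>\<^bsub>M\<^esub> = a \<odot>\<^bsub>M\<^esub> \<zero>\<^bsub>M\<^esub> \<oplus>\<^bsub>M\<^esub> a \<odot>\<^bsub>M\<^esub> \<zero>\<^bsub>M\<^esub>"
    using smult_r_distr[of a "\<zero>\<^bsub>M\<^esub>" "\<zero>\<^bsub>M\<^esub>"] by simp
  with a show "a \<odot>\<^bsub>M\<^esub> \<zero>\<^bsub>M\<^esub> = \<zero>\<^bsub>M\<^esub>"
    by (metis M.add.r_cancel_one' M.zero_closed smult_closed)
qed

lemma smult_finsum:
  assumes "a \<in> carrier R" "finite S" "f \<in> S \<rightarrow> carrier M"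
  shows "a \<odot>\<^bsub>M\<^esub> (\<Oplus>\<^bsub>M\<^esub>i\<in>S. f i) = (\<Oplus>\<^bsub>M\<^esub>i\<in>S. a \<odot>\<^bsub>M\<^esub> f i)"
  using assms(2,3) by (induction S) (use assms(1) in \<open>auto simp: smult_r_distr Pi_def\<close>)

lemma lin_ext_superset:
  assumes "finite S" "{i. c i \<noteq> \<zero>} \<subseteq> S" "\<And>i. c i \<in> carrier R" "\<phi> \<in> S \<rightarrow> carrier M"
  shows "lin_ext R M \<phi> c = (\<Oplus>\<^bsub>M\<^esub>i\<in>S. c i \<odot>\<^bsub>M\<^esub> \<phi> i)"
  unfolding lin_ext_def
  by (rule M.add.finprod_mono_neutral_cong_left) (use assms in \<open>auto simp: Pi_def\<close>)

lemma lin_ext_hom: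
  assumes \<phi>: "\<phi> \<in> I \<rightarrow> carrier M"
  shows "lin_ext R M \<phi> \<in> lmod_hom R (free_lmod R I) M"
proof -
  let ?F = "free_lmod R I"
  let ?s = "\<lambda>c. {i. c i \<noteq> \<zero>}"
  have F: "c i \<in> carrier R" "finite (?s c)" "?s c \<subseteq> I" if "c \<in> carrier ?F" for c i
    using that by (auto simp: free_lmod_def)
  have 1: "lin_ext R M \<phi> c \<in> carrier M" if "c \<in> carrier ?F" for c
    unfolding lin_ext_def by (rule M.finsum_closed) (use F[OF that] \<phi> in auto)
  have 2: "lin_ext R M \<phi> (c \<oplus>\<^bsub>?F\<^esub> d) = lin_ext R M \<phi> c \<oplus>\<^bsub>M\<^esub> lin_ext R M \<phi> d"
    if c: "c \<in> carrier ?F" and d: "d \<in> carrier ?F" for c d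
  proof -
    let ?S = "?s c \<union> ?s d"
    have S: "finite ?S" "\<phi> \<in> ?S \<rightarrow> carrier M" using F[OF c] F[OF d] \<phi> by auto
    have cd: "c i \<oplus> d i \<in> carrier R" for i using F[OF c] F[OF d] by simp
    have "lin_ext R M \<phi> (c \<oplus>\<^bsub>?F\<^esub> d) = (\<Oplus>\<^bsub>M\<^esub>i\<in>?S. (c i \<oplus> d i) \<odot>\<^bsub>M\<^esub> \<phi> i)"
      unfolding free_lmod_def ring.simps module.simps
      by (rule lin_ext_superset) (use S cd F[OF c] F[OF d] in auto)
    also have "\<dots> = (\<Oplus>\<^bsub>M\<^esub>i\<in>?S. c i \<odot>\<^bsub>M\<^esub> \<phi> i \<oplus>\<^bsub>M\<^esub> d i \<odot>\<^bsub>M\<^esub> \<phi> i)"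
      by (rule M.finsum_cong')
        (use F[OF c] F[OF d] \<phi> in \<open>auto simp: smult_l_distr Pi_def subset_iff\<close>)
    also have "\<dots> = (\<Oplus>\<^bsub>M\<^esub>i\<in>?S. c i \<odot>\<^bsub>M\<^esub> \<phi> i) \<oplus>\<^bsub>M\<^esub> (\<Oplus>\<^bsub>M\<^esub>i\<in>?S. d i \<odot>\<^bsub>M\<^esub> \<phi> i)"
      by (rule M.finsum_addf) (use F[OF c] F[OF d] \<phi> in \<open>auto simp: Pi_def subset_iff\<close>)
    also have "\<dots> = lin_ext R M \<phi> c \<oplus>\<^bsub>M\<^esub> lin_ext R M \<phi> d"
      using lin_ext_superset[of ?S c \<phi>] lin_ext_superset[of ?S d \<phi>] S F[OF c] F[OF d] by auto
    finally show ?thesis .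
  qed
  have 3: "lin_ext R M \<phi> (a \<odot>\<^bsub>?F\<^esub> c) = a \<odot>\<^bsub>M\<^esub> lin_ext R M \<phi> c"
    if a: "a \<in> carrier R" and c: "c \<in> carrier ?F" for a c
  proof -
    have S: "\<phi> \<in> ?s c \<rightarrow> carrier M" "?s (\<lambda>i. a \<otimes> c i) \<subseteq> ?s c" using F[OF c] \<phi> a by auto
    have "lin_ext R M \<phi> (a \<odot>\<^bsub>?F\<^esub> c) = (\<Oplus>\<^bsub>M\<^esub>i\<in>?s c. (a \<otimes> c i) \<odot>\<^bsub>M\<^esub> \<phi> i)"
      unfolding free_lmod_def ring.simps module.simps
      by (rule lin_ext_superset) (use S F[OF c] a in auto)
    also have "\<dots> = (\<Oplus>\<^bsub>M\<^esub>i\<in>?s c. a \<odot>\<^bsub>M\<^esub> (c i \<odot>\<^bsub>M\<^esub> \<phi> i))"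
      by (rule M.finsum_cong')
        (use F[OF c] S a in \<open>auto simp: smult_assoc1 Pi_def subset_iff\<close>)
    also have "\<dots> = a \<odot>\<^bsub>M\<^esub> lin_ext R M \<phi> c"
      unfolding lin_ext_def
      by (rule smult_finsum[symmetric]) (use F[OF c] S a in \<open>auto simp: Pi_def\<close>)
    finally show ?thesis .
  qed
  show ?thesis using 1 2 3 by (auto simp: lmod_hom_def)
qed

lemma lin_ext_compose:
  assumes "left_module R N" and g: "g \<in> lmod_hom R M N" and \<phi>: "\<phi> \<in> I \<rightarrow> carrier M"
    and c: "c \<in> carrier (free_lmod R I)"
  shows "g (lin_ext R M \<phi> c) = lin_ext R N (\<lambda>i. g (\<phi> i)) c"
proof -
  interpret N: left_module R N by fact
  have gc: "x \<in> carrier M \<Longrightarrow> g x \<in> carrier N"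
    "\<lbrakk>x \<in> carrier M; y \<in> carrier M\<rbrakk> \<Longrightarrow> g (x \<oplus>\<^bsub>M\<^esub> y) = g x \<oplus>\<^bsub>N\<^esub> g y"
    "\<lbrakk>a \<in> carrier R; x \<in> carrier M\<rbrakk> \<Longrightarrow> g (a \<odot>\<^bsub>M\<^esub> x) = a \<odot>\<^bsub>N\<^esub> g x" for x y a
    using g by (auto simp: lmod_hom_def)
  have "g (\<zero> \<odot>\<^bsub>M\<^esub> \<zero>\<^bsub>M\<^esub>) = \<zero> \<odot>\<^bsub>N\<^esub> g \<zero>\<^bsub>M\<^esub>" 
    using gc by blast
  then have g0: "g \<zero>\<^bsub>M\<^esub> = \<zero>\<^bsub>N\<^esub>"
    using gc(1)[of "\<zero>\<^bsub>M\<^esub>"] by simp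
  have cr: "c i \<in> carrier R" for i using c by (auto simp: free_lmod_def)
  have "g (\<Oplus>\<^bsub>M\<^esub>i\<in>S. c i \<odot>\<^bsub>M\<^esub> \<phi> i) = (\<Oplus>\<^bsub>N\<^esub>i\<in>S. c i \<odot>\<^bsub>N\<^esub> g (\<phi> i))"
    if "finite S" "S \<subseteq> I" for S
    using that
  proof (induction S)
    case (insert i S)
    have \<phi>c: "\<phi> k \<in> carrier M" if "k \<in> insert i S" for k
      using insert.prems \<phi> that by auto
    have 1: "(\<lambda>i. c i \<odot>\<^bsub>M\<^esub> \<phi> i) \<in> S \<rightarrow> carrier M" and 2: "c i \<odot>\<^bsub>M\<^esub> \<phi> i \<in> carrier M"
      and 3: "(\<lambda>i. c i \<odot>\<^bsub>N\<^esub> g (\<phi> i)) \<in> S \<rightarrow> carrier N" and 4: "c i \<odot>\<^bsub>N\<^esub> g (\<phi> i) \<in> carrier N"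
      using \<phi>c cr gc(1) by (auto intro!: smult_closed N.smult_closed)
    have IH: "g (\<Oplus>\<^bsub>M\<^esub>i\<in>S. c i \<odot>\<^bsub>M\<^esub> \<phi> i) = (\<Oplus>\<^bsub>N\<^esub>i\<in>S. c i \<odot>\<^bsub>N\<^esub> g (\<phi> i))"
      using insert by simp
    show ?case
      unfolding M.finsum_insert[OF insert.hyps 1 2] N.finsum_insert[OF insert.hyps 3 4]
      using gc(2)[OF 2 M.finsum_closed[OF 1]] gc(3)[OF cr \<phi>c[of i]] IH by simp
  qed (simp add: g0)
  then show ?thesis
    using c unfolding lin_ext_def by (simp add: free_lmod_def)
qed

lemma lin_ext_single:
  assumes "x \<in> carrier M"
  shows "(\<lambda>i. if i = x then \<one> else \<zero>) \<in> carrier (free_lmod R (carrier M))"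
    and "lin_ext R M (\<lambda>x. x) (\<lambda>i. if i = x then \<one> else \<zero>) = x"
proof -
  show "(\<lambda>i. if i = x then \<one> else \<zero>) \<in> carrier (free_lmod R (carrier M))"
    using assms by (auto simp: free_lmod_def intro: finite_subset[of _ "{x}"])
  show "lin_ext R M (\<lambda>x. x) (\<lambda>i. if i = x then \<one> else \<zero>) = x"
    using assms by (subst lin_ext_superset[of "{x}"]) auto
qed

end

lemma projective_module_lift:
  fixes P :: "('a, 'm, 'd) module_scheme"
    and A :: "('a, 'n, 'e) module_scheme" and B :: "('a, 'p, 'f) module_scheme"
  assumes P: "projective_module R P" and A: "left_module R A" and B: "left_module R B"
    and g: "g \<in> lmod_hom R A B" "g ` carrier A = carrier B" and f: "f \<in> lmod_hom R P B"
  shows "\<exists>h\<in>lmod_hom R P A. \<forall>x\<in>carrier P. g (h x) = f x"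
proof -
  interpret P: left_module R P using P by (simp add: projective_module_def)
  interpret A: left_module R A by (rule A)
  interpret B: left_module R B by (rule B)
  let ?F = "free_lmod R (carrier P)" and ?\<epsilon> = "lin_ext R P (\<lambda>x. x)"
  define P' :: "('a, 'm) module" where "P' =
    \<lparr>carrier = carrier P, monoid.mult = undefined, one = undefined, ring.zero = ring.zero P,
     add = add P, smult = smult P\<rparr>"
  have P': "carrier P' = carrier P" "add P' = add P" "\<zero>\<^bsub>P'\<^esub> = \<zero>\<^bsub>P\<^esub>" "smult P' = smult P"
    by (simp_all add: P'_def)
  have "abelian_group P'"
  proof (rule abelian_groupI)
    show "\<exists>y\<in>carrier P'. y \<oplus>\<^bsub>P'\<^esub> x = \<zero>\<^bsub>P'\<^esub>" if "x \<in> carrier P'" for x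
      using that by (intro bexI[of _ "\<ominus>\<^bsub>P\<^esub> x"]) (auto simp: P' P.M.l_neg)
  qed (auto simp: P' P.M.a_ac)
  then have mod: "left_module R P'"
    by (intro left_module.intro left_module_axioms.intro P.ring_axioms)
      (auto simp: P' P.smult_l_distr P.smult_r_distr P.smult_assoc1)
  have \<epsilon>: "?\<epsilon> \<in> lmod_hom R ?F P" by (rule P.lin_ext_hom) simp
  have "carrier P \<subseteq> ?\<epsilon> ` carrier ?F"
  proof
    fix x assume x: "x \<in> carrier P"
    show "x \<in> ?\<epsilon> ` carrier ?F"
      using P.lin_ext_single[OF x]
      by (rule rev_image_eqI[of "\<lambda>i. if i = x then \<one>\<^bsub>R\<^esub> else \<zero>\<^bsub>R\<^esub>", OF _ sym])
  qed
  then have \<epsilon>_surj: "?\<epsilon> ` carrier ?F = carrier P'" "?\<epsilon> \<in> lmod_hom R ?F P'"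
    using \<epsilon> by (auto simp: lmod_hom_def P')
  have id: "(\<lambda>x. x) \<in> lmod_hom R P P'" by (auto simp: lmod_hom_def P')
  obtain s where s: "s \<in> lmod_hom R P ?F" "\<And>x. x \<in> carrier P \<Longrightarrow> ?\<epsilon> (s x) = x"
    using P[unfolded projective_module_def, THEN conjunct2, rule_format, of ?F P' ?\<epsilon> "\<lambda>x. x"]
      free_lmod[OF P.ring_axioms] mod \<epsilon>_surj id by blast
  define \<phi> where "\<phi> x = (SOME y. y \<in> carrier A \<and> g y = f x)" for x
  have \<phi>: "\<phi> x \<in> carrier A \<and> g (\<phi> x) = f x" if x: "x \<in> carrier P" for x
  proof -
    have "f x \<in> g ` carrier A" using g(2) f x by (auto simp: lmod_hom_def)
    then obtain y where "y \<in> carrier A \<and> g y = f x" by auto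
    then show ?thesis unfolding \<phi>_def by (rule someI)
  qed
  let ?h = "\<lambda>x. lin_ext R A \<phi> (s x)"
  have \<phi>': "\<phi> \<in> carrier P \<rightarrow> carrier A" using \<phi> by blast
  have "?h \<in> lmod_hom R P A"
    using s(1) A.lin_ext_hom[OF \<phi>'] by (auto simp: lmod_hom_def Pi_def)
  moreover have "g (?h x) = f x" if x: "x \<in> carrier P" for x
  proof -
    have sx: "s x \<in> carrier ?F" using s(1) x by (auto simp: lmod_hom_def)
    then have supp: "s x i \<in> carrier R" "s x i \<noteq> \<zero>\<^bsub>R\<^esub> \<Longrightarrow> i \<in> carrier P" for i
      by (auto simp: free_lmod_def)
    have fB: "f i \<in> carrier B" if "i \<in> carrier P" for i using f that by (auto simp: lmod_hom_def)
    have "g (?h x) = lin_ext R B (\<lambda>i. g (\<phi> i)) (s x)"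
      by (rule A.lin_ext_compose[OF B g(1) \<phi>' sx])
    also have "\<dots> = lin_ext R B f (s x)"
      unfolding lin_ext_def by (rule B.finsum_cong') (use supp \<phi> fB in auto)
    also have "\<dots> = f (?\<epsilon> (s x))"
      using P.lin_ext_compose[OF B f, of "\<lambda>x. x" "carrier P" "s x"] sx by simp
    finally show ?thesis using s(2)[OF x] by simp
  qed
  ultimately show ?thesis by (intro bexI[of _ ?h] ballI)
qed

end

theory Submission
  imports Defs
begin

text \<open>A separable bimodule \<open>N\<close> makes every \<open>T\<close>-module \<open>V\<close> a direct summand of \<open>N \<otimes>\<^sub>R (\<^sup>*N \<otimes>\<^sub>T V)\<close>.
  If \<open>\<^sup>*N\<close> is replaced by a suitable sub-bimodule that is finitely generated over \<open>R\<close>, the second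
  factor is a finitely generated \<open>R\<close>-module. For indecomposable \<open>V\<close>, whose endomorphisms are
  bijective or nilpotent by Fitting's lemma, \<open>V\<close> is then a summand of \<open>N \<otimes>\<^sub>R W\<close> for some
  indecomposable \<open>W\<close>. So if \<open>R\<close> is of finite representation type, then \<open>V\<close> occurs among the
  indecomposable summands of finitely many modules \<open>N \<otimes>\<^sub>R W\<close>, each of which has only finitely many
  up to isomorphism. This applies to \<open>N = M\<close> and, with the roles of \<open>R\<close> and \<open>T\<close> exchanged, to
  \<open>N = M\<^sup>*\<close>, where \<open>\<^sup>*N \<cong> M\<close>.\<close>

text \<open>The base rings \<open>k\<close> and \<open>l\<close> are unrelated and neither is asked
  to act compatibly on \<open>M\<close>, so finite generation on one side of a bimodule says nothing
  about the other side, and Hom_T(N, V) is not known to be finitely generated over \<open>R\<close>.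
  What helps is that a splitting of the evaluation map is determined by one element, with finitely
  many terms \<nu>_j \<otimes> f_j. The second tensor factor is therefore not formed: f_j \<otimes>
  x is replaced by the map n \<mapsto> f_j(n) x, and the finitely generated \<open>R\<close>-module
  \<open>S\<close> spanned by such maps inside Hom_T(N, V) takes its place. For an endomorphism
  \<open>e\<close> of \<open>S\<close> the composite V \<rightarrow> N \<otimes> S \<rightarrow> N
  \<otimes> S \<rightarrow> V reads x \<mapsto> sum of e(f_j(-) x)(\<nu>_j); this trace is additive
  in \<open>e\<close> and gives x for the identity. All finiteness comes from descending chains:
  minimal submodules replace decompositions into indecomposables, and an additive trace together
  with the local endomorphism ring of \<open>V\<close> replaces the Krull-Schmidt theorem.\<close>

section \<open>Linear maps and submodules\<close>

lemma lmod_homI: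
  assumes "\<And>x. x \<in> carrier M \<Longrightarrow> h x \<in> carrier N"
    and "\<And>x y. \<lbrakk>x \<in> carrier M; y \<in> carrier M\<rbrakk> \<Longrightarrow> h (x \<oplus>\<^bsub>M\<^esub> y) = h x \<oplus>\<^bsub>N\<^esub> h y"
    and "\<And>a x. \<lbrakk>a \<in> carrier R; x \<in> carrier M\<rbrakk> \<Longrightarrow> h (a \<odot>\<^bsub>M\<^esub> x) = a \<odot>\<^bsub>N\<^esub> h x"
  shows "h \<in> lmod_hom R M N"
  using assms by (auto simp: lmod_hom_def)

lemma lmod_homD:
  assumes "h \<in> lmod_hom R M N"
  shows "x \<in> carrier M \<Longrightarrow> h x \<in> carrier N"
    and "\<lbrakk>x \<in> carrier M; y \<in> carrier M\<rbrakk> \<Longrightarrow> h (x \<oplus>\<^bsub>M\<^esub> y) = h x \<oplus>\<^bsub>N\<^esub> h y"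
    and "\<lbrakk>a \<in> carrier R; x \<in> carrier M\<rbrakk> \<Longrightarrow> h (a \<odot>\<^bsub>M\<^esub> x) = a \<odot>\<^bsub>N\<^esub> h x"
  using assms by (auto simp: lmod_hom_def)

lemma lmod_hom_comp:
  assumes "f \<in> lmod_hom R L M" "g \<in> lmod_hom R M N"
  shows "(\<lambda>x. g (f x)) \<in> lmod_hom R L N"
  using assms by (auto simp: lmod_hom_def Pi_def)

lemma lmod_hom_id: "(\<lambda>x. x) \<in> lmod_hom R M M"
  by (auto simp: lmod_hom_def)

lemma lmod_hom_inv:
  assumes M: "left_module R M" and f: "f \<in> lmod_hom R M N" "bij_betw f (carrier M) (carrier N)"
  shows "inv_into (carrier M) f \<in> lmod_hom R N M"
proof -
  interpret left_module R M by fact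
  let ?g = "inv_into (carrier M) f"
  have inj: "inj_on f (carrier M)" and im: "carrier N = f ` carrier M"
    using f(2) by (auto simp: bij_betw_def)
  have g: "?g (f x) = x" if "x \<in> carrier M" for x using inj that by simp
  show ?thesis
  proof (rule lmod_homI)
    fix x assume "x \<in> carrier N" then show "?g x \<in> carrier M" using im g by auto
  next
    fix x y assume "x \<in> carrier N" "y \<in> carrier N"
    then obtain u v where uv: "u \<in> carrier M" "v \<in> carrier M" "x = f u" "y = f v" using im by auto
    then show "?g (x \<oplus>\<^bsub>N\<^esub> y) = ?g x \<oplus>\<^bsub>M\<^esub> ?g y"
      using g[of "u \<oplus>\<^bsub>M\<^esub> v"] lmod_homD(2)[OF f(1)] g by simp
  next
    fix a x assume a: "a \<in> carrier R" and "x \<in> carrier N"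
    then obtain u where u: "u \<in> carrier M" "x = f u" using im by auto
    then show "?g (a \<odot>\<^bsub>N\<^esub> x) = a \<odot>\<^bsub>M\<^esub> ?g x"
      using g[of "a \<odot>\<^bsub>M\<^esub> u"] lmod_homD(3)[OF f(1)] g a by simp
  qed
qed

lemma lmod_iso_sym:
  assumes "left_module R M" "lmod_iso R M N"
  shows "lmod_iso R N M"
  using assms lmod_hom_inv bij_betw_inv_into unfolding lmod_iso_def by blast

lemma lmod_iso_trans:
  assumes "lmod_iso R L M" "lmod_iso R M N"
  shows "lmod_iso R L N"
proof -
  obtain f g where "f \<in> lmod_hom R L M" "bij_betw f (carrier L) (carrier M)"
    "g \<in> lmod_hom R M N" "bij_betw g (carrier M) (carrier N)"
    using assms unfolding lmod_iso_def by blast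
  then have "g \<circ> f \<in> lmod_hom R L N" "bij_betw (g \<circ> f) (carrier L) (carrier N)"
    using lmod_hom_comp[of f R L M g N] by (auto simp: comp_def intro: bij_betw_trans[unfolded comp_def])
  then show ?thesis unfolding lmod_iso_def by blast
qed

lemma submoduleD:
  assumes "submodule H R M"
  shows "H \<subseteq> carrier M"
    and "\<zero>\<^bsub>M\<^esub> \<in> H"
    and "\<lbrakk>x \<in> H; y \<in> H\<rbrakk> \<Longrightarrow> x \<oplus>\<^bsub>M\<^esub> y \<in> H"
    and "\<lbrakk>a \<in> carrier R; x \<in> H\<rbrakk> \<Longrightarrow> a \<odot>\<^bsub>M\<^esub> x \<in> H"
    and "x \<in> H \<Longrightarrow> \<ominus>\<^bsub>M\<^esub> x \<in> H"
proof -
  interpret submodule H R M by fact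
  show "H \<subseteq> carrier M" "\<zero>\<^bsub>M\<^esub> \<in> H" "\<lbrakk>x \<in> H; y \<in> H\<rbrakk> \<Longrightarrow> x \<oplus>\<^bsub>M\<^esub> y \<in> H"
    "\<lbrakk>a \<in> carrier R; x \<in> H\<rbrakk> \<Longrightarrow> a \<odot>\<^bsub>M\<^esub> x \<in> H" "x \<in> H \<Longrightarrow> \<ominus>\<^bsub>M\<^esub> x \<in> H"
    using subset one_closed m_closed m_inv_closed by (auto simp: a_inv_def)
qed

context left_module
begin

lemma smult_minus:
  assumes "a \<in> carrier R" "x \<in> carrier M"
  shows "(\<ominus> a) \<odot>\<^bsub>M\<^esub> x = \<ominus>\<^bsub>M\<^esub> (a \<odot>\<^bsub>M\<^esub> x)"
proof (rule M.minus_equality[symmetric])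
  show "(\<ominus> a) \<odot>\<^bsub>M\<^esub> x \<oplus>\<^bsub>M\<^esub> a \<odot>\<^bsub>M\<^esub> x = \<zero>\<^bsub>M\<^esub>"
    using assms smult_l_distr[of "\<ominus> a" a x] by (simp add: R.l_neg)
qed (use assms in auto)

text \<open>Closure under negatives, which \<open>submodule\<close> inherits from
  \<open>subgroup\<close>, comes from the action of \<open>\<ominus> \<one>\<close>.\<close>

lemma submoduleI:
  assumes sub: "H \<subseteq> carrier M" and zero: "\<zero>\<^bsub>M\<^esub> \<in> H"
    and add: "\<And>x y. \<lbrakk>x \<in> H; y \<in> H\<rbrakk> \<Longrightarrow> x \<oplus>\<^bsub>M\<^esub> y \<in> H"
    and smult: "\<And>a x. \<lbrakk>a \<in> carrier R; x \<in> H\<rbrakk> \<Longrightarrow> a \<odot>\<^bsub>M\<^esub> x \<in> H"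
  shows "submodule H R M"
proof -
  have "\<ominus>\<^bsub>M\<^esub> x \<in> H" if "x \<in> H" for x
    using smult[of "\<ominus> \<one>" x] smult_minus[of \<one> x] that sub by auto
  then show ?thesis
    using assms by (intro submodule.intro subgroup.intro submodule_axioms.intro) (auto simp: a_inv_def)
qed

lemma submodule_carrier: "submodule (carrier M) R M"
  by (rule submoduleI) auto

lemma submodule_zero: "submodule {\<zero>\<^bsub>M\<^esub>} R M"
  by (rule submoduleI) auto

lemma submodule_Int:
  assumes "submodule A R M" "submodule B R M"
  shows "submodule (A \<inter> B) R M"
  using submoduleD[OF assms(1)] submoduleD[OF assms(2)] by (intro submoduleI) auto

lemma submodule_finsum:
  assumes H: "submodule H R M" and "finite I" "f \<in> I \<rightarrow> H"
  shows "(\<Oplus>\<^bsub>M\<^esub>i\<in>I. f i) \<in> H"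
  using assms(2,3)
proof (induction I)
  case (insert i I)
  have "f \<in> I \<rightarrow> carrier M" "f i \<in> carrier M" using insert.prems submoduleD(1)[OF H] by auto
  then show ?case using insert submoduleD(3)[OF H] by (simp add: Pi_def)
qed (simp add: submoduleD(2)[OF H])

lemma left_module_submodule:
  assumes H: "submodule H R M"
  shows "left_module R (M\<lparr>carrier := H\<rparr>)"
proof -
  note D = submoduleD[OF H]
  have sub: "x \<in> H \<Longrightarrow> x \<in> carrier M" for x using D(1) by auto
  have "abelian_group (M\<lparr>carrier := H\<rparr>)"
  proof (rule abelian_groupI)
    show "\<exists>y\<in>carrier (M\<lparr>carrier := H\<rparr>). y \<oplus>\<^bsub>M\<lparr>carrier := H\<rparr>\<^esub> x = \<zero>\<^bsub>M\<lparr>carrier := H\<rparr>\<^esub>"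
      if "x \<in> carrier (M\<lparr>carrier := H\<rparr>)" for x
      using that by (intro bexI[of _ "\<ominus>\<^bsub>M\<^esub> x"]) (auto simp: M.l_neg sub D)
  qed (auto simp: D sub M.a_ac)
  then show ?thesis
    by (intro left_module.intro left_module_axioms.intro R.ring_axioms)
      (auto simp: D sub smult_l_distr smult_r_distr smult_assoc1)
qed

lemma submodule_of_submodule:
  assumes H: "submodule H R M"
  shows "submodule A R (M\<lparr>carrier := H\<rparr>) \<longleftrightarrow> submodule A R M \<and> A \<subseteq> H"
proof -
  interpret H: left_module R "M\<lparr>carrier := H\<rparr>" by (rule left_module_submodule[OF H])
  show ?thesis
  proof
    assume A: "submodule A R (M\<lparr>carrier := H\<rparr>)"
    then show "submodule A R M \<and> A \<subseteq> H"
      using submoduleD[OF A] submoduleD(1)[OF H] by (auto intro!: submoduleI)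
  next
    assume A: "submodule A R M \<and> A \<subseteq> H"
    then show "submodule A R (M\<lparr>carrier := H\<rparr>)"
      using submoduleD[of A R M] by (auto intro!: H.submoduleI)
  qed
qed

end

lemma lmod_hom_zero:
  assumes "left_module R M" "left_module R N" "h \<in> lmod_hom R M N"
  shows "h \<zero>\<^bsub>M\<^esub> = \<zero>\<^bsub>N\<^esub>"
proof -
  interpret M: left_module R M by fact
  interpret N: left_module R N by fact
  have "h (\<zero>\<^bsub>R\<^esub> \<odot>\<^bsub>M\<^esub> \<zero>\<^bsub>M\<^esub>) = \<zero>\<^bsub>R\<^esub> \<odot>\<^bsub>N\<^esub> h \<zero>\<^bsub>M\<^esub>"
    using lmod_homD(3)[OF assms(3)] by blast
  then show ?thesis using lmod_homD(1)[OF assms(3)] by simp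
qed

lemma lmod_hom_minus:
  assumes "left_module R M" "left_module R N" "h \<in> lmod_hom R M N" "x \<in> carrier M" "y \<in> carrier M"
  shows "h (x \<ominus>\<^bsub>M\<^esub> y) = h x \<ominus>\<^bsub>N\<^esub> h y"
proof -
  interpret M: left_module R M by fact
  interpret N: left_module R N by fact
  note h = lmod_homD[OF assms(3)]
  have "\<ominus>\<^bsub>M\<^esub> y = (\<ominus>\<^bsub>R\<^esub> \<one>\<^bsub>R\<^esub>) \<odot>\<^bsub>M\<^esub> y" using M.smult_minus[of "\<one>\<^bsub>R\<^esub>" y] assms by simp
  then have "h (\<ominus>\<^bsub>M\<^esub> y) = \<ominus>\<^bsub>N\<^esub> h y" using h assms N.smult_minus[of "\<one>\<^bsub>R\<^esub>" "h y"] by simp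
  then show ?thesis using h assms by (simp add: a_minus_def)
qed

lemma lmod_hom_finsum:
  assumes "left_module R M" "left_module R N" "h \<in> lmod_hom R M N"
    and "finite I" "f \<in> I \<rightarrow> carrier M"
  shows "h (\<Oplus>\<^bsub>M\<^esub>i\<in>I. f i) = (\<Oplus>\<^bsub>N\<^esub>i\<in>I. h (f i))"
proof -
  interpret M: left_module R M by fact
  interpret N: left_module R N by fact
  note h = lmod_homD[OF assms(3)]
  show ?thesis
    using assms(4,5)
  proof (induction I)
    case (insert i I)
    then have "f \<in> I \<rightarrow> carrier M" "f i \<in> carrier M" by auto
    with insert h show ?case by (simp add: Pi_def)
  qed (simp add: lmod_hom_zero[OF assms(1-3)])
qed

lemma lmod_hom_inj:
  assumes "left_module R M" "left_module R N" "h \<in> lmod_hom R M N"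
    and ker: "\<And>x. \<lbrakk>x \<in> carrier M; h x = \<zero>\<^bsub>N\<^esub>\<rbrakk> \<Longrightarrow> x = \<zero>\<^bsub>M\<^esub>"
  shows "inj_on h (carrier M)"
proof (rule inj_onI)
  fix x y assume xy: "x \<in> carrier M" "y \<in> carrier M" "h x = h y"
  interpret M: left_module R M by fact
  interpret N: left_module R N by fact
  have "h (x \<ominus>\<^bsub>M\<^esub> y) = \<zero>\<^bsub>N\<^esub>"
    using lmod_hom_minus[OF assms(1-3), of x y] xy lmod_homD(1)[OF assms(3), of y] by (simp add: N.r_neg a_minus_def)
  then have "x \<ominus>\<^bsub>M\<^esub> y = \<zero>\<^bsub>M\<^esub>" by (rule ker[rotated]) (use xy in simp)
  then show "x = y" using M.minus_equality[of x "\<ominus>\<^bsub>M\<^esub> y"] xy by (simp add: a_minus_def)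
qed

lemma submodule_image:
  assumes "left_module R M" "left_module R N" "h \<in> lmod_hom R M N" and S: "submodule S R M"
  shows "submodule (h ` S) R N"
proof -
  interpret N: left_module R N by fact
  note h = lmod_homD[OF assms(3)] and D = submoduleD[OF S]
  show ?thesis
  proof (rule N.submoduleI)
    show "h ` S \<subseteq> carrier N" using D(1) h(1) by auto
    show "\<zero>\<^bsub>N\<^esub> \<in> h ` S" using lmod_hom_zero[OF assms(1-3)] D(2) by (metis imageI)
    show "x \<oplus>\<^bsub>N\<^esub> y \<in> h ` S" if "x \<in> h ` S" "y \<in> h ` S" for x y
    proof -
      from that obtain u v where "u \<in> S" "v \<in> S" "x = h u" "y = h v" by auto
      then have "x \<oplus>\<^bsub>N\<^esub> y = h (u \<oplus>\<^bsub>M\<^esub> v)" "u \<oplus>\<^bsub>M\<^esub> v \<in> S" using D(1,3) h(2) by (auto simp: subset_iff)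
      then show ?thesis by blast
    qed
    show "a \<odot>\<^bsub>N\<^esub> x \<in> h ` S" if "a \<in> carrier R" "x \<in> h ` S" for a x
    proof -
      from that obtain u where "u \<in> S" "x = h u" by auto
      then have "a \<odot>\<^bsub>N\<^esub> x = h (a \<odot>\<^bsub>M\<^esub> u)" "a \<odot>\<^bsub>M\<^esub> u \<in> S" using D(1,4) h(3) that by (auto simp: subset_iff)
      then show ?thesis by blast
    qed
  qed
qed

lemma submodule_vimage:
  assumes "left_module R M" "left_module R N" "h \<in> lmod_hom R M N" and S: "submodule S R N"
  shows "submodule {x \<in> carrier M. h x \<in> S} R M"
proof -
  interpret M: left_module R M by fact
  note h = lmod_homD[OF assms(3)] and D = submoduleD[OF S]
  show ?thesis
    by (rule M.submoduleI) (auto simp: h D lmod_hom_zero[OF assms(1-3)])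
qed

lemma lmod_hom_restrict:
  assumes "h \<in> lmod_hom R M N" "A \<subseteq> carrier M"
  shows "h \<in> lmod_hom R (M\<lparr>carrier := A\<rparr>) N"
  using assms by (auto simp: lmod_hom_def subset_iff)

lemma lmod_hom_corestrict:
  assumes "h \<in> lmod_hom R M N" "h ` carrier M \<subseteq> B"
  shows "h \<in> lmod_hom R M (N\<lparr>carrier := B\<rparr>)"
  using assms by (auto simp: lmod_hom_def)

lemma lmod_hom_incl:
  assumes "h \<in> lmod_hom R M (N\<lparr>carrier := B\<rparr>)" "B \<subseteq> carrier N"
  shows "h \<in> lmod_hom R M N"
  using assms by (auto simp: lmod_hom_def subset_iff)

section \<open>Finitely generated modules\<close>

definition lmod_span :: "('a, 'c) ring_scheme \<Rightarrow> ('a, 'm, 'd) module_scheme \<Rightarrow> 'm set \<Rightarrow> 'm set"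
  where "lmod_span R M A = \<Inter>{S. submodule S R M \<and> A \<subseteq> S}"

lemma (in left_module) lmod_span:
  assumes "A \<subseteq> carrier M"
  shows "submodule (lmod_span R M A) R M" and "A \<subseteq> lmod_span R M A"
proof -
  have sub: "lmod_span R M A \<subseteq> carrier M"
    using submodule_carrier assms by (auto simp: lmod_span_def)
  show "submodule (lmod_span R M A) R M"
    by (rule submoduleI[OF sub]) (auto simp: lmod_span_def submoduleD)
qed (auto simp: lmod_span_def)

lemma lmod_span_least:
  "submodule S R M \<Longrightarrow> A \<subseteq> S \<Longrightarrow> lmod_span R M A \<subseteq> S"
  by (auto simp: lmod_span_def)

text \<open>Trades coefficients for submodules: later proofs take the set of all elements with a
  desired property, check that it is a submodule and that it contains the generators.\<close>

lemma (in left_module) fin_gen_module_iff: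
  "fin_gen_module R M \<longleftrightarrow>
    (\<exists>A. finite A \<and> A \<subseteq> carrier M \<and> (\<forall>S. submodule S R M \<and> A \<subseteq> S \<longrightarrow> S = carrier M))"
proof
  assume "fin_gen_module R M"
  then obtain A where A: "finite A" "A \<subseteq> carrier M"
    and gen: "\<forall>x\<in>carrier M. \<exists>c\<in>A \<rightarrow> carrier R. x = (\<Oplus>\<^bsub>M\<^esub>a\<in>A. c a \<odot>\<^bsub>M\<^esub> a)"
    unfolding fin_gen_module_def by blast
  have "S = carrier M" if S: "submodule S R M" "A \<subseteq> S" for S
  proof
    show "carrier M \<subseteq> S"
    proof
      fix x assume "x \<in> carrier M"
      then obtain c where c: "c \<in> A \<rightarrow> carrier R" "x = (\<Oplus>\<^bsub>M\<^esub>a\<in>A. c a \<odot>\<^bsub>M\<^esub> a)" using gen by blast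
      show "x \<in> S" unfolding c(2)
        by (rule submodule_finsum[OF S(1) A(1)]) (use c(1) S(2) submoduleD(4)[OF S(1)] in auto)
    qed
  qed (rule submoduleD(1)[OF S(1)])
  then show "\<exists>A. finite A \<and> A \<subseteq> carrier M \<and> (\<forall>S. submodule S R M \<and> A \<subseteq> S \<longrightarrow> S = carrier M)"
    using A by blast
next
  assume "\<exists>A. finite A \<and> A \<subseteq> carrier M \<and> (\<forall>S. submodule S R M \<and> A \<subseteq> S \<longrightarrow> S = carrier M)"
  then obtain A where A: "finite A" "A \<subseteq> carrier M"
    and gen: "\<And>S. submodule S R M \<Longrightarrow> A \<subseteq> S \<Longrightarrow> S = carrier M" by blast
  \<comment> \<open>The linear combinations of \<open>A\<close> form a submodule containing
    \<open>A\<close>; the hypothesis forces them to exhaust the module.\<close>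
  define S where "S = {\<Oplus>\<^bsub>M\<^esub>a\<in>A. c a \<odot>\<^bsub>M\<^esub> a | c. c \<in> A \<rightarrow> carrier R}"
  have cl: "(\<lambda>a. c a \<odot>\<^bsub>M\<^esub> a) \<in> A \<rightarrow> carrier M" if "c \<in> A \<rightarrow> carrier R" for c using that A(2) by auto
  have "submodule S R M"
  proof (rule submoduleI)
    show "S \<subseteq> carrier M" unfolding S_def using cl by (auto intro!: M.finsum_closed)
    have "(\<Oplus>\<^bsub>M\<^esub>a\<in>A. \<zero> \<odot>\<^bsub>M\<^esub> a) = \<zero>\<^bsub>M\<^esub>" using A(2) by (intro M.add.finprod_one_eqI) auto
    then show "\<zero>\<^bsub>M\<^esub> \<in> S" unfolding S_def by (intro CollectI exI[of _ "\<lambda>_. \<zero>"]) auto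
  next
    fix x y assume "x \<in> S" "y \<in> S"
    then obtain c d where c: "c \<in> A \<rightarrow> carrier R" "d \<in> A \<rightarrow> carrier R"
      "x = (\<Oplus>\<^bsub>M\<^esub>a\<in>A. c a \<odot>\<^bsub>M\<^esub> a)" "y = (\<Oplus>\<^bsub>M\<^esub>a\<in>A. d a \<odot>\<^bsub>M\<^esub> a)" unfolding S_def by blast
    have "x \<oplus>\<^bsub>M\<^esub> y = (\<Oplus>\<^bsub>M\<^esub>a\<in>A. c a \<odot>\<^bsub>M\<^esub> a \<oplus>\<^bsub>M\<^esub> d a \<odot>\<^bsub>M\<^esub> a)"
      unfolding c(3,4) by (rule M.finsum_addf[symmetric]) (use cl c in auto)
    also have "\<dots> = (\<Oplus>\<^bsub>M\<^esub>a\<in>A. (c a \<oplus> d a) \<odot>\<^bsub>M\<^esub> a)"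
      by (rule M.finsum_cong') (use A(2) c(1,2) in \<open>auto simp: smult_l_distr Pi_def subset_iff\<close>)
    finally show "x \<oplus>\<^bsub>M\<^esub> y \<in> S" unfolding S_def using c(1,2)
      by (intro CollectI exI[of _ "\<lambda>a. c a \<oplus> d a"]) auto
  next
    fix r x assume r: "r \<in> carrier R" and "x \<in> S"
    then obtain c where c: "c \<in> A \<rightarrow> carrier R" "x = (\<Oplus>\<^bsub>M\<^esub>a\<in>A. c a \<odot>\<^bsub>M\<^esub> a)" unfolding S_def by blast
    have "r \<odot>\<^bsub>M\<^esub> x = (\<Oplus>\<^bsub>M\<^esub>a\<in>A. r \<odot>\<^bsub>M\<^esub> (c a \<odot>\<^bsub>M\<^esub> a))"
      unfolding c(2) by (rule smult_finsum) (use r A cl c in auto)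
    also have "\<dots> = (\<Oplus>\<^bsub>M\<^esub>a\<in>A. (r \<otimes> c a) \<odot>\<^bsub>M\<^esub> a)"
      by (rule M.finsum_cong') (use A(2) c(1) r in \<open>auto simp: smult_assoc1 Pi_def subset_iff\<close>)
    finally show "r \<odot>\<^bsub>M\<^esub> x \<in> S" unfolding S_def using c(1) r
      by (intro CollectI exI[of _ "\<lambda>a. r \<otimes> c a"]) auto
  qed
  moreover have "A \<subseteq> S"
  proof
    fix b assume b: "b \<in> A"
    have "(\<Oplus>\<^bsub>M\<^esub>a\<in>A. (if a = b then \<one> else \<zero>) \<odot>\<^bsub>M\<^esub> a) = (\<Oplus>\<^bsub>M\<^esub>a\<in>A. if b = a then a else \<zero>\<^bsub>M\<^esub>)"
      by (rule M.finsum_cong') (use A(2) in auto)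
    also have "\<dots> = b" using M.finsum_singleton[OF b A(1), of "\<lambda>a. a"] A(2) by auto
    finally show "b \<in> S" unfolding S_def by (intro CollectI exI[of _ "\<lambda>a. if a = b then \<one> else \<zero>"]) auto
  qed
  ultimately have eq: "S = carrier M" by (rule gen)
  have "\<exists>c\<in>A \<rightarrow> carrier R. x = (\<Oplus>\<^bsub>M\<^esub>a\<in>A. c a \<odot>\<^bsub>M\<^esub> a)" if "x \<in> carrier M" for x
  proof -
    have "x \<in> S" using that eq by simp
    then obtain c where "c \<in> A \<rightarrow> carrier R" "x = (\<Oplus>\<^bsub>M\<^esub>a\<in>A. c a \<odot>\<^bsub>M\<^esub> a)"
      unfolding S_def by (elim CollectE exE conjE) (rule that)
    then show ?thesis by (intro bexI[of _ c])
  qed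
  then show "fin_gen_module R M"
    unfolding fin_gen_module_def using A by (intro exI[of _ A] conjI ballI)
qed

lemma fin_gen_module_image:
  assumes M: "left_module R M" and N: "left_module R N" and h: "h \<in> lmod_hom R M N" "h ` carrier M = carrier N"
    and fg: "fin_gen_module R M"
  shows "fin_gen_module R N"
proof -
  obtain A where A: "finite A" "A \<subseteq> carrier M" "\<And>S. submodule S R M \<Longrightarrow> A \<subseteq> S \<Longrightarrow> S = carrier M"
    using fg unfolding left_module.fin_gen_module_iff[OF M] by blast
  have "S = carrier N" if S: "submodule S R N" "h ` A \<subseteq> S" for S
  proof -
    have "{x \<in> carrier M. h x \<in> S} = carrier M"
      by (rule A(3)[OF submodule_vimage[OF M N h(1) S(1)]]) (use S(2) A(2) in auto)
    then have "h ` carrier M \<subseteq> S" by auto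
    then show ?thesis using h(2) submoduleD(1)[OF S(1)] by auto
  qed
  then show ?thesis unfolding left_module.fin_gen_module_iff[OF N]
    using A(1,2) h by (intro exI[of _ "h ` A"]) auto
qed

lemma (in left_module) fin_gen_lmod_span:
  assumes "finite A" "A \<subseteq> carrier M"
  shows "fin_gen_module R (M\<lparr>carrier := lmod_span R M A\<rparr>)"
proof -
  interpret S: left_module R "M\<lparr>carrier := lmod_span R M A\<rparr>"
    by (rule left_module_submodule[OF lmod_span(1)[OF assms(2)]])
  show ?thesis
    unfolding S.fin_gen_module_iff submodule_of_submodule[OF lmod_span(1)[OF assms(2)]]
    using assms lmod_span(2)[OF assms(2)] lmod_span_least[of _ R M A]
    by (intro exI[of _ A]) (simp add: subset_antisym)
qed

lemma indecomposable_module_iso: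
  assumes M: "left_module R M" and N: "left_module R N" and iso: "lmod_iso R M N"
    and ind: "indecomposable_module R M"
  shows "indecomposable_module R N"
proof -
  interpret M: left_module R M by fact
  interpret N: left_module R N by fact
  \<comment> \<open>The isomorphism is taken from \<open>N\<close> to \<open>M\<close>, so that a
    decomposition of \<open>N\<close> is pushed forward to one of \<open>M\<close>.\<close>
  obtain f where f: "f \<in> lmod_hom R N M" "bij_betw f (carrier N) (carrier M)"
    using lmod_iso_sym[OF M iso] unfolding lmod_iso_def by blast
  note h = lmod_homD[OF f(1)]
  have inj: "inj_on f (carrier N)" and im: "f ` carrier N = carrier M"
    using f(2) by (auto simp: bij_betw_def)
  have f0: "f \<zero>\<^bsub>N\<^esub> = \<zero>\<^bsub>M\<^esub>" by (rule lmod_hom_zero[OF N M f(1)])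
  have triv: "A = {\<zero>\<^bsub>N\<^esub>}" if fA: "f ` A = {\<zero>\<^bsub>M\<^esub>}" and A: "A \<subseteq> carrier N" for A
  proof -
    have "a = \<zero>\<^bsub>N\<^esub>" if a: "a \<in> A" for a
    proof (rule inj_onD[OF inj])
      show "f a = f \<zero>\<^bsub>N\<^esub>" unfolding f0 using fA a by blast
    qed (use A a in auto)
    moreover have "A \<noteq> {}" using fA by auto
    ultimately show ?thesis by blast
  qed
  show ?thesis
    unfolding indecomposable_module_def
  proof (intro conjI allI impI)
    show "carrier N \<noteq> {\<zero>\<^bsub>N\<^esub>}"
      using ind im f0 unfolding indecomposable_module_def by auto
  next
    fix A B assume AB: "submodule A R N \<and> submodule B R N \<and> A <+>\<^bsub>N\<^esub> B = carrier N \<and> A \<inter> B = {\<zero>\<^bsub>N\<^esub>}"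
    then have A: "A \<subseteq> carrier N" and B: "B \<subseteq> carrier N" using submoduleD(1) by blast+
    have "f ` A \<inter> f ` B = {\<zero>\<^bsub>M\<^esub>}"
      using inj_on_image_Int[OF inj A B] AB f0 by auto
    moreover have "f ` A <+>\<^bsub>M\<^esub> f ` B = carrier M"
    proof -
      have "f ` A <+>\<^bsub>M\<^esub> f ` B = (\<Union>a\<in>A. \<Union>b\<in>B. {f a \<oplus>\<^bsub>M\<^esub> f b})"
        by (simp add: set_add_def set_mult_def)
      also have "\<dots> = (\<Union>a\<in>A. \<Union>b\<in>B. {f (a \<oplus>\<^bsub>N\<^esub> b)})"
        using h(2)[OF subsetD[OF A] subsetD[OF B]] by simp
      also have "\<dots> = f ` (A <+>\<^bsub>N\<^esub> B)"
        by (simp add: set_add_def set_mult_def image_UN)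
      finally have "f ` A <+>\<^bsub>M\<^esub> f ` B = f ` (A <+>\<^bsub>N\<^esub> B)" .
      then show ?thesis using AB im by simp
    qed
    ultimately have "f ` A = {\<zero>\<^bsub>M\<^esub>} \<or> f ` B = {\<zero>\<^bsub>M\<^esub>}"
      using ind AB submodule_image[OF N M f(1)] unfolding indecomposable_module_def by blast
    then show "A = {\<zero>\<^bsub>N\<^esub>} \<or> B = {\<zero>\<^bsub>N\<^esub>}" using triv A B by blast
  qed
qed

section \<open>The descending chain condition\<close>

definition dcc_module :: "('a, 'c) ring_scheme \<Rightarrow> ('a, 'm, 'd) module_scheme \<Rightarrow> bool"
  where "dcc_module R M \<longleftrightarrow>
    (\<forall>S::nat \<Rightarrow> 'm set. (\<forall>n. submodule (S n) R M \<and> S (Suc n) \<subseteq> S n) \<longrightarrow> (\<exists>n. \<forall>m\<ge>n. S m = S n))"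

lemma dcc_moduleD:
  assumes "dcc_module R M" "\<And>n. submodule (S n) R M" "\<And>n. S (Suc n) \<subseteq> S n"
  shows "\<exists>n. \<forall>m\<ge>n. S m = S n"
  using assms unfolding dcc_module_def by blast

text \<open>Otherwise dependent choice yields a strictly descending chain. Minimal submodules found
  this way take over the role of direct sum decompositions.\<close>

lemma dcc_module_minimal:
  assumes dcc: "dcc_module R M" and P: "P H" and sub: "\<And>H. P H \<Longrightarrow> submodule H R M"
  shows "\<exists>H. P H \<and> (\<forall>H'. P H' \<and> H' \<subseteq> H \<longrightarrow> H' = H)"
proof (rule ccontr)
  assume no: "\<not> (\<exists>H. P H \<and> (\<forall>H'. P H' \<and> H' \<subseteq> H \<longrightarrow> H' = H))"
  have *: "\<exists>H'. P H' \<and> H' \<subset> H" if "P H" for H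
    using no that by (metis psubsetI)
  have "\<exists>S. \<forall>n. P (S n) \<and> S (Suc n) \<subset> S n"
    by (rule dependent_nat_choice) (use P * in blast)+
  then obtain S where S: "\<And>n. P (S n)" "\<And>n. S (Suc n) \<subset> S n" by blast
  have "\<exists>n. \<forall>m\<ge>n. S m = S n"
    by (rule dcc_moduleD[OF dcc]) (use sub[OF S(1)] S(2) in \<open>simp_all add: psubset_imp_subset\<close>)
  then obtain n where "\<forall>m\<ge>n. S m = S n" ..
  then have "S (Suc n) = S n" by (metis le_SucI order_refl)
  then show False using S(2)[of n] by simp
qed

lemma dcc_module_induct:
  assumes dcc: "dcc_module R M" and H: "submodule H R M"
    and step: "\<And>H. submodule H R M \<Longrightarrow> (\<And>H'. submodule H' R M \<Longrightarrow> H' \<subset> H \<Longrightarrow> Q H') \<Longrightarrow> Q H"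
  shows "Q H"
proof (rule ccontr)
  assume "\<not> Q H"
  with H have "submodule H R M \<and> \<not> Q H" by blast
  then obtain K where K: "submodule K R M \<and> \<not> Q K"
    "\<forall>H'. (submodule H' R M \<and> \<not> Q H') \<and> H' \<subseteq> K \<longrightarrow> H' = K"
    using dcc_module_minimal[OF dcc, of "\<lambda>H. submodule H R M \<and> \<not> Q H" H] by metis
  show False using step[of K] K by blast
qed

lemma dcc_module_image:
  assumes M: "left_module R M" and N: "left_module R N"
    and h: "h \<in> lmod_hom R M N" "h ` carrier M = carrier N" and dcc: "dcc_module R M"
  shows "dcc_module R N"
  unfolding dcc_module_def
proof (intro allI impI)
  fix S :: "nat \<Rightarrow> _ set" assume S: "\<forall>n. submodule (S n) R N \<and> S (Suc n) \<subseteq> S n"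
  let ?S = "\<lambda>n. {x \<in> carrier M. h x \<in> S n}"
  have "\<exists>n. \<forall>m\<ge>n. ?S m = ?S n"
    by (rule dcc_moduleD[OF dcc]) (use S submodule_vimage[OF M N h(1)] in auto)
  then obtain n where n: "\<And>m. m \<ge> n \<Longrightarrow> ?S m = ?S n" by blast
  \<comment> \<open>Surjectivity recovers each member of the chain from its preimage.\<close>
  have "S m = h ` ?S m" for m
    using S submoduleD(1)[of "S m" R N] h(2) by auto
  then show "\<exists>n. \<forall>m\<ge>n. S m = S n" using n by metis
qed

text \<open>\<open>D\<close> embeds into the finite product of the \<open>V a\<close>. Expressing
  this by coordinate maps covers free modules of finite rank and finite powers at once.\<close>

lemma dcc_module_jointly_injective:
  assumes D: "left_module R D" and A: "finite A"
    and V: "\<And>a. a \<in> A \<Longrightarrow> left_module R (V a) \<and> dcc_module R (V a) \<and> f a \<in> lmod_hom R D (V a)"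
    and inj: "\<And>x. x \<in> carrier D \<Longrightarrow> (\<And>a. a \<in> A \<Longrightarrow> f a x = \<zero>\<^bsub>V a\<^esub>) \<Longrightarrow> x = \<zero>\<^bsub>D\<^esub>"
  shows "dcc_module R D"
proof -
  interpret D: left_module R D by fact
  \<comment> \<open>The induction on \<open>A\<close> needs a submodule \<open>U\<close>: after
    splitting off \<open>f a\<close>, the remaining maps are jointly injective only on the kernel of
    \<open>f a\<close>.\<close>
  have "\<exists>n. \<forall>m\<ge>n. S m = S n"
    if "submodule U R D" "\<And>x. x \<in> U \<Longrightarrow> (\<And>a. a \<in> A \<Longrightarrow> f a x = \<zero>\<^bsub>V a\<^esub>) \<Longrightarrow> x = \<zero>\<^bsub>D\<^esub>"
      "\<And>n. submodule (S n) R D" "\<And>n. S (Suc n) \<subseteq> S n" "S 0 \<subseteq> U" for U and S :: "nat \<Rightarrow> _ set"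
    using A V that
  proof (induction A arbitrary: U S)
    case empty
    have "S n = {\<zero>\<^bsub>D\<^esub>}" for n
    proof -
      have "S n \<subseteq> S 0" using lift_Suc_antimono_le[of S, OF empty.prems(5)] by blast
      then have "S n \<subseteq> {\<zero>\<^bsub>D\<^esub>}" using empty.prems(3,6) by blast
      then show ?thesis using submoduleD(2)[OF empty.prems(4)] by blast
    qed
    then show ?case by simp
  next
    case (insert a A)
    have anti: "m \<ge> n \<Longrightarrow> S m \<subseteq> S n" for m n using lift_Suc_antimono_le[of S, OF insert.prems(5)] .
    have Va: "left_module R (V a)" "dcc_module R (V a)" and fa: "f a \<in> lmod_hom R D (V a)"
      using insert.prems(1)[of a] by auto
    note SD = submoduleD[OF insert.prems(4)]
    define K where "K = {x \<in> U. f a x = \<zero>\<^bsub>V a\<^esub>}"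
    have "{x \<in> carrier D. f a x \<in> {\<zero>\<^bsub>V a\<^esub>}} \<inter> U = K"
      using submoduleD(1)[OF insert.prems(2)] by (auto simp: K_def)
    then have K: "submodule K R D"
      using D.submodule_Int[OF submodule_vimage[OF D Va(1) fa left_module.submodule_zero[OF Va(1)]] insert.prems(2)]
      by metis
    have "\<exists>n. \<forall>m\<ge>n. S m \<inter> K = S n \<inter> K"
    proof (rule insert.IH[OF _ K])
      show "x = \<zero>\<^bsub>D\<^esub>" if "x \<in> K" "\<And>b. b \<in> A \<Longrightarrow> f b x = \<zero>\<^bsub>V b\<^esub>" for x
        using insert.prems(3)[of x] that by (auto simp: K_def)
    qed (use insert.prems K D.submodule_Int in \<open>auto dest: subsetD[OF insert.prems(5)]\<close>)
    then obtain n1 where n1: "\<And>m. m \<ge> n1 \<Longrightarrow> S m \<inter> K = S n1 \<inter> K" by blast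
    have "\<exists>n. \<forall>m\<ge>n. f a ` S m = f a ` S n"
      by (rule dcc_moduleD[OF Va(2)])
        (use submodule_image[OF D Va(1) fa] insert.prems in \<open>simp_all add: image_mono\<close>)
    then obtain n2 where n2: "\<And>m. m \<ge> n2 \<Longrightarrow> f a ` S m = f a ` S n2" by blast
    let ?N = "max n1 n2"
    \<comment> \<open>A submodule \<open>S m\<close> of \<open>S ?N\<close> with the same image
      under \<open>f a\<close> and the same intersection with \<open>K\<close> is all of
      \<open>S ?N\<close>: subtract from \<open>x\<close> an element of \<open>S m\<close> with the
      same image.\<close>
    have "S ?N \<subseteq> S m" if m: "m \<ge> ?N" for m
    proof
      fix x assume x: "x \<in> S ?N"
      then have "f a x \<in> f a ` S m" using n2[of m] n2[of ?N] m by auto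
      then obtain y where y: "y \<in> S m" "f a y = f a x" by auto
      have xy: "x \<in> carrier D" "y \<in> carrier D" using x y SD(1) by auto
      have "y \<in> S ?N" using y anti[OF m] by auto
      then have 1: "x \<ominus>\<^bsub>D\<^esub> y \<in> S ?N" using x SD(3,5) by (simp add: a_minus_def)
      have "f a (x \<ominus>\<^bsub>D\<^esub> y) = f a x \<ominus>\<^bsub>V a\<^esub> f a x"
        using lmod_hom_minus[OF D Va(1) fa xy] y by simp
      also have "\<dots> = \<zero>\<^bsub>V a\<^esub>"
        using abelian_group.r_neg[of "V a" "f a x"] lmod_homD(1)[OF fa xy(1)] Va(1)
        by (simp add: a_minus_def left_module_def)
      finally have "x \<ominus>\<^bsub>D\<^esub> y \<in> S ?N \<inter> K"
        using 1 anti[of 0 ?N] insert.prems(6) unfolding K_def by auto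
      then have "x \<ominus>\<^bsub>D\<^esub> y \<in> S m" using n1[of ?N] n1[of m] m by auto
      then have "(x \<ominus>\<^bsub>D\<^esub> y) \<oplus>\<^bsub>D\<^esub> y \<in> S m" using y SD(3) by blast
      moreover have "(x \<ominus>\<^bsub>D\<^esub> y) \<oplus>\<^bsub>D\<^esub> y = x"
        using xy by (simp add: a_minus_def D.M.a_assoc D.M.l_neg)
      ultimately show "x \<in> S m" by simp
    qed
    then have "\<forall>m\<ge>?N. S m = S ?N" using anti by blast
    then show ?case by blast
  qed
  from this[OF D.submodule_carrier inj] show ?thesis
    unfolding dcc_module_def using submoduleD(1) by blast
qed

section \<open>Restriction of scalars to the commutative base ring\<close>

definition restrict_lmod :: "('k \<Rightarrow> 'a) \<Rightarrow> ('a, 'm, 'd) module_scheme \<Rightarrow> ('k, 'm) module"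
  where "restrict_lmod \<phi> V =
    \<lparr>carrier = carrier V, monoid.mult = undefined, one = undefined, ring.zero = ring.zero V,
     add = add V, smult = (\<lambda>c x. \<phi> c \<odot>\<^bsub>V\<^esub> x)\<rparr>"

lemma restrict_lmod_simps [simp]:
  "carrier (restrict_lmod \<phi> V) = carrier V" "\<zero>\<^bsub>restrict_lmod \<phi> V\<^esub> = \<zero>\<^bsub>V\<^esub>"
  "x \<oplus>\<^bsub>restrict_lmod \<phi> V\<^esub> y = x \<oplus>\<^bsub>V\<^esub> y" "c \<odot>\<^bsub>restrict_lmod \<phi> V\<^esub> x = \<phi> c \<odot>\<^bsub>V\<^esub> x"
  by (simp_all add: restrict_lmod_def)

lemma restrict_scalars_simps [simp]:
  "carrier (restrict_scalars \<phi> R) = carrier R" "\<zero>\<^bsub>restrict_scalars \<phi> R\<^esub> = \<zero>\<^bsub>R\<^esub>"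
  "x \<oplus>\<^bsub>restrict_scalars \<phi> R\<^esub> y = x \<oplus>\<^bsub>R\<^esub> y" "c \<odot>\<^bsub>restrict_scalars \<phi> R\<^esub> x = \<phi> c \<otimes>\<^bsub>R\<^esub> x"
  by (simp_all add: restrict_scalars_def)

lemma left_module_restrict_lmod:
  assumes "left_module R V" "ring k" "\<phi> \<in> ring_hom k R"
  shows "left_module k (restrict_lmod \<phi> V)"
proof -
  interpret V: left_module R V by fact
  interpret k: ring k by fact
  have "abelian_group (restrict_lmod \<phi> V)"
  proof (rule abelian_groupI)
    show "\<exists>y\<in>carrier (restrict_lmod \<phi> V). y \<oplus>\<^bsub>restrict_lmod \<phi> V\<^esub> x = \<zero>\<^bsub>restrict_lmod \<phi> V\<^esub>"
      if "x \<in> carrier (restrict_lmod \<phi> V)" for x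
      using that by (intro bexI[of _ "\<ominus>\<^bsub>V\<^esub> x"]) (auto simp: V.M.l_neg)
  qed (auto simp: V.M.a_ac)
  then show ?thesis
    using ring_hom_closed[OF assms(3)] ring_hom_add[OF assms(3)] ring_hom_mult[OF assms(3)]
      ring_hom_one[OF assms(3)]
    by (intro left_module.intro left_module_axioms.intro k.ring_axioms)
      (auto simp: V.smult_l_distr V.smult_r_distr V.smult_assoc1)
qed

lemma left_module_restrict_scalars:
  assumes "ring R" "ring k" "\<phi> \<in> ring_hom k R"
  shows "left_module k (restrict_scalars \<phi> R)"
proof -
  interpret R: ring R by fact
  interpret k: ring k by fact
  have "abelian_group (restrict_scalars \<phi> R)"
  proof (rule abelian_groupI)
    show "\<exists>y\<in>carrier (restrict_scalars \<phi> R). y \<oplus>\<^bsub>restrict_scalars \<phi> R\<^esub> x = \<zero>\<^bsub>restrict_scalars \<phi> R\<^esub>"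
      if "x \<in> carrier (restrict_scalars \<phi> R)" for x
      using that by (intro bexI[of _ "\<ominus>\<^bsub>R\<^esub> x"]) (auto simp: R.l_neg)
  qed (auto simp: R.a_ac)
  then show ?thesis
    using ring_hom_closed[OF assms(3)] ring_hom_add[OF assms(3)] ring_hom_mult[OF assms(3)]
      ring_hom_one[OF assms(3)]
    by (intro left_module.intro left_module_axioms.intro k.ring_axioms)
      (auto simp: R.l_distr R.r_distr R.m_assoc)
qed

lemma submodule_restrict_lmod:
  assumes "left_module R V" "ring k" "\<phi> \<in> ring_hom k R" "submodule H R V"
  shows "submodule H k (restrict_lmod \<phi> V)"
proof -
  interpret left_module k "restrict_lmod \<phi> V" by (rule left_module_restrict_lmod[OF assms(1-3)])
  show ?thesis
    using submoduleD[OF assms(4)] ring_hom_closed[OF assms(3)] by (intro submoduleI) auto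
qed

text \<open>The regular module is \<open>restrict_scalars\<close> along the identity; by
  commutativity its submodules are ideals, to which the chain condition of the locale
  applies.\<close>

lemma (in artinian_cring) dcc_module_regular: "dcc_module R (restrict_scalars (\<lambda>x. x) R)"
  unfolding dcc_module_def
proof (intro allI impI)
  fix S :: "nat \<Rightarrow> _ set"
  assume S: "\<forall>n. submodule (S n) R (restrict_scalars (\<lambda>x. x) R) \<and> S (Suc n) \<subseteq> S n"
  have "ideal (S n) R" for n
  proof -
    have sub: "submodule (S n) R (restrict_scalars (\<lambda>x. x) R)" using S by blast
    note D = submoduleD[OF sub, simplified]
    have neg: "\<ominus> x \<in> S n" if "x \<in> S n" for x
    proof -
      have "x \<in> carrier R" using D(1) that by auto
      then have "\<ominus> x = (\<ominus> \<one>) \<otimes> x" by (simp add: l_minus)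
      then show ?thesis using D(4)[of "\<ominus> \<one>" x] that by simp
    qed
    show ?thesis
    proof (rule idealI[OF ring_axioms])
      show "subgroup (S n) (add_monoid R)"
        using D neg by (intro subgroup.intro) (auto simp: a_inv_def)
      show "x \<otimes> a \<in> S n" "a \<otimes> x \<in> S n" if "a \<in> S n" "x \<in> carrier R" for a x
        using D(4)[of x a] that m_comm[of a x] D(1) by auto
    qed
  qed
  then show "\<exists>n. \<forall>m\<ge>n. S m = S n" using descending_chain_condition[of S] S by blast
qed

section \<open>Finitely generated modules over Artin rings and Artin algebras\<close>

lemma (in left_module) free_lmod_onto:
  assumes A: "A \<subseteq> carrier M" "\<And>S. submodule S R M \<Longrightarrow> A \<subseteq> S \<Longrightarrow> S = carrier M"
  shows "lin_ext R M (\<lambda>x. x) ` carrier (free_lmod R A) = carrier M"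
proof -
  let ?F = "free_lmod R A" and ?e = "lin_ext R M (\<lambda>x. x)"
  have F: "left_module R ?F" by (rule free_lmod[OF R.ring_axioms])
  have e: "?e \<in> lmod_hom R ?F M" by (rule lin_ext_hom) (use A(1) in auto)
  have "A \<subseteq> ?e ` carrier ?F"
  proof
    fix x assume x: "x \<in> A"
    let ?c = "\<lambda>i. if i = x then \<one> else \<zero>"
    have "?c \<in> carrier ?F"
      using x by (auto simp: free_lmod_def intro: finite_subset[of _ "{x}"])
    moreover have "?e ?c = x"
      using x A(1) by (subst lin_ext_superset[of "{x}"]) auto
    ultimately show "x \<in> ?e ` carrier ?F" by (metis imageI)
  qed
  then show ?thesis
    by (rule A(2)[OF submodule_image[OF F left_module_axioms e left_module.submodule_carrier[OF F]]])
qed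

text \<open>Such a module is a quotient of a free module on a finite set, and the coordinates embed
  the latter into finitely many copies of \<open>k\<close>.\<close>

lemma dcc_module_fin_gen:
  assumes k: "artinian_cring k" and V: "left_module k V" and fg: "fin_gen_module k V"
  shows "dcc_module k V"
proof -
  interpret k: artinian_cring k by fact
  interpret V: left_module k V by fact
  obtain A where A: "finite A" "A \<subseteq> carrier V" "\<And>S. submodule S k V \<Longrightarrow> A \<subseteq> S \<Longrightarrow> S = carrier V"
    using fg unfolding V.fin_gen_module_iff by blast
  let ?F = "free_lmod k A" and ?e = "lin_ext k V (\<lambda>x. x)"
  have F: "left_module k ?F" by (rule free_lmod[OF k.ring_axioms])
  interpret F: left_module k ?F by fact
  have e: "?e \<in> lmod_hom k ?F V" by (rule V.lin_ext_hom) (use A(2) in auto)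
  have surj: "?e ` carrier ?F = carrier V" by (rule V.free_lmod_onto[OF A(2,3)])
  have id: "(\<lambda>x. x) \<in> ring_hom k k" by (auto simp: ring_hom_def)
  have "dcc_module k ?F"
  proof (rule dcc_module_jointly_injective[OF F A(1), where V = "\<lambda>_. restrict_scalars (\<lambda>x. x) k" and f = "\<lambda>a c. c a"])
    fix a
    show "left_module k (restrict_scalars (\<lambda>x. x) k) \<and> dcc_module k (restrict_scalars (\<lambda>x. x) k) \<and>
        (\<lambda>c. c a) \<in> lmod_hom k ?F (restrict_scalars (\<lambda>x. x) k)"
      using left_module_restrict_scalars[OF k.ring_axioms k.ring_axioms id] k.dcc_module_regular
      by (auto simp: lmod_hom_def free_lmod_def)
  next
    fix x assume "x \<in> carrier ?F" "\<And>a. a \<in> A \<Longrightarrow> x a = \<zero>\<^bsub>restrict_scalars (\<lambda>x. x) k\<^esub>"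
    then show "x = \<zero>\<^bsub>?F\<^esub>" by (auto simp: free_lmod_def fun_eq_iff)
  qed
  then show ?thesis by (rule dcc_module_image[OF F V e surj])
qed

context artin_algebra
begin

text \<open>If \<open>D\<close> generates \<open>R\<close> over \<open>k\<close> and
  \<open>A\<close> generates \<open>V\<close> over \<open>R\<close>, then the products of both
  generate \<open>V\<close> over \<open>k\<close>.\<close>

lemma fin_gen_restrict_lmod:
  assumes V: "left_module R V" and fg: "fin_gen_module R V"
  shows "fin_gen_module k (restrict_lmod \<phi> V)"
proof -
  interpret V: left_module R V by fact
  have kV: "left_module k (restrict_lmod \<phi> V)"
    by (rule left_module_restrict_lmod[OF V k.ring_axioms structure_map])
  have kR: "left_module k (restrict_scalars \<phi> R)"
    by (rule left_module_restrict_scalars[OF R.ring_axioms k.ring_axioms structure_map])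
  note \<phi> = ring_hom_closed[OF structure_map]
  obtain A where A: "finite A" "A \<subseteq> carrier V" "\<And>S. submodule S R V \<Longrightarrow> A \<subseteq> S \<Longrightarrow> S = carrier V"
    using fg unfolding V.fin_gen_module_iff by blast
  obtain D where D: "finite D" "D \<subseteq> carrier R"
    "\<And>S. submodule S k (restrict_scalars \<phi> R) \<Longrightarrow> D \<subseteq> S \<Longrightarrow> S = carrier R"
    using finitely_generated unfolding left_module.fin_gen_module_iff[OF kR] by auto
  let ?B = "(\<lambda>(t, x). t \<odot>\<^bsub>V\<^esub> x) ` (D \<times> A)"
  have "S = carrier V" if S: "submodule S k (restrict_lmod \<phi> V)" "?B \<subseteq> S" for S
  proof -
    note SD = submoduleD[OF S(1), simplified]
    have "{t \<in> carrier R. \<forall>x\<in>A. t \<odot>\<^bsub>V\<^esub> x \<in> S} = carrier R"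
    proof (rule D(3))
      show "submodule {t \<in> carrier R. \<forall>x\<in>A. t \<odot>\<^bsub>V\<^esub> x \<in> S} k (restrict_scalars \<phi> R)"
        using A(2) SD \<phi>
        by (intro left_module.submoduleI[OF kR]) (auto simp: V.smult_l_distr V.smult_assoc1 subset_iff)
    qed (use S(2) D(2) in auto)
    then have RA: "t \<odot>\<^bsub>V\<^esub> x \<in> S" if "t \<in> carrier R" "x \<in> A" for t x using that by auto
    \<comment> \<open>\<open>S\<close> is only a \<open>k\<close>-submodule, while the generators in
      \<open>A\<close> speak about \<open>R\<close>-submodules; this set is the largest
      \<open>R\<close>-submodule inside \<open>S\<close>.\<close>
    have "{x \<in> carrier V. \<forall>t\<in>carrier R. t \<odot>\<^bsub>V\<^esub> x \<in> S} = carrier V"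
    proof (rule A(3))
      show "submodule {x \<in> carrier V. \<forall>t\<in>carrier R. t \<odot>\<^bsub>V\<^esub> x \<in> S} R V"
        using SD by (intro V.submoduleI) (auto simp: V.smult_r_distr V.smult_assoc1[symmetric])
    qed (use RA A(2) in auto)
    then have "x \<in> S" if "x \<in> carrier V" for x
      using that V.smult_one[of x] by (metis (mono_tags, lifting) R.one_closed mem_Collect_eq)
    then show ?thesis using SD(1) by auto
  qed
  then show ?thesis
    unfolding left_module.fin_gen_module_iff[OF kV] using A D
    by (intro exI[of _ ?B]) auto
qed

lemma dcc_restrict_lmod:
  assumes V: "left_module R V" and fg: "fin_gen_module R V"
  shows "dcc_module k (restrict_lmod \<phi> V)"
  by (rule dcc_module_fin_gen[OF k.artinian_cring_axioms
        left_module_restrict_lmod[OF V k.ring_axioms structure_map] fin_gen_restrict_lmod[OF assms]])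

lemma dcc_fin_gen:
  assumes V: "left_module R V" and fg: "fin_gen_module R V"
  shows "dcc_module R V"
  using dcc_restrict_lmod[OF assms] submodule_restrict_lmod[OF V k.ring_axioms structure_map]
  unfolding dcc_module_def by blast

end

section \<open>Endomorphisms of indecomposable modules\<close>

definition prod_lmod :: "'i set \<Rightarrow> ('i \<Rightarrow> ('a, 'm, 'd) module_scheme) \<Rightarrow> ('a, 'i \<Rightarrow> 'm) module"
  where "prod_lmod I V =
    \<lparr>carrier = (\<Pi>\<^sub>E i\<in>I. carrier (V i)), monoid.mult = undefined, one = undefined,
     ring.zero = (\<lambda>i\<in>I. \<zero>\<^bsub>V i\<^esub>), add = (\<lambda>f g. \<lambda>i\<in>I. f i \<oplus>\<^bsub>V i\<^esub> g i),
     smult = (\<lambda>a f. \<lambda>i\<in>I. a \<odot>\<^bsub>V i\<^esub> f i)\<rparr>"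

lemma prod_lmod_simps:
  "carrier (prod_lmod I V) = (\<Pi>\<^sub>E i\<in>I. carrier (V i))"
  "\<zero>\<^bsub>prod_lmod I V\<^esub> = (\<lambda>i\<in>I. \<zero>\<^bsub>V i\<^esub>)"
  "f \<oplus>\<^bsub>prod_lmod I V\<^esub> g = (\<lambda>i\<in>I. f i \<oplus>\<^bsub>V i\<^esub> g i)"
  "a \<odot>\<^bsub>prod_lmod I V\<^esub> f = (\<lambda>i\<in>I. a \<odot>\<^bsub>V i\<^esub> f i)"
  by (simp_all add: prod_lmod_def)

lemma left_module_prod_lmod:
  assumes "ring R" and V: "\<And>i. i \<in> I \<Longrightarrow> left_module R (V i)"
  shows "left_module R (prod_lmod I V)"
proof -
  interpret R: ring R by fact
  have ab: "abelian_group (V i)" if "i \<in> I" for i using V[OF that] by (simp add: left_module_def)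
  have am: "abelian_monoid (V i)" if "i \<in> I" for i using ab[OF that] by (simp add: abelian_group_def)
  note ax = left_module.smult_closed[OF V] left_module.smult_l_distr[OF V] left_module.smult_r_distr[OF V]
    left_module.smult_assoc1[OF V] left_module.smult_one[OF V]
  note gx = abelian_monoid.a_closed[OF am] abelian_monoid.zero_closed[OF am] abelian_monoid.a_assoc[OF am]
    abelian_monoid.l_zero[OF am]
  have "abelian_group (prod_lmod I V)"
  proof (rule abelian_groupI)
    fix x assume x: "x \<in> carrier (prod_lmod I V)"
    show "\<exists>y\<in>carrier (prod_lmod I V). y \<oplus>\<^bsub>prod_lmod I V\<^esub> x = \<zero>\<^bsub>prod_lmod I V\<^esub>"
      using x abelian_group.l_neg[OF ab] abelian_group.a_inv_closed[OF ab]
      by (intro bexI[of _ "\<lambda>i\<in>I. \<ominus>\<^bsub>V i\<^esub> x i"]) (auto simp: prod_lmod_simps PiE_iff intro!: restrict_ext)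
    show "\<zero>\<^bsub>prod_lmod I V\<^esub> \<oplus>\<^bsub>prod_lmod I V\<^esub> x = x"
      using x gx by (auto simp: prod_lmod_simps PiE_iff extensional_def fun_eq_iff)
  next
    fix x y assume "x \<in> carrier (prod_lmod I V)" "y \<in> carrier (prod_lmod I V)"
    then show "x \<oplus>\<^bsub>prod_lmod I V\<^esub> y = y \<oplus>\<^bsub>prod_lmod I V\<^esub> x"
      using abelian_monoid.a_comm[OF am] by (auto simp: prod_lmod_simps PiE_iff intro!: restrict_ext)
  qed (auto simp: prod_lmod_simps PiE_iff gx intro!: restrict_ext)
  then show ?thesis
    by (intro left_module.intro left_module_axioms.intro R.ring_axioms)
      (auto simp: prod_lmod_simps PiE_iff ax extensional_def intro!: restrict_ext)
qed

lemma prod_lmod_proj: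
  "i \<in> I \<Longrightarrow> (\<lambda>f. f i) \<in> lmod_hom R (prod_lmod I V) (V i)"
  by (auto simp: lmod_hom_def prod_lmod_simps PiE_iff)

lemma lmod_hom_eq_on_gens:
  assumes V: "left_module R V" and W: "left_module R W"
    and A: "\<And>S. submodule S R V \<Longrightarrow> A \<subseteq> S \<Longrightarrow> S = carrier V" "A \<subseteq> carrier V"
    and f: "f \<in> lmod_hom R V W" and g: "g \<in> lmod_hom R V W" and eq: "\<And>x. x \<in> A \<Longrightarrow> f x = g x"
    and x: "x \<in> carrier V"
  shows "f x = g x"
proof -
  interpret V: left_module R V by fact
  have "{x \<in> carrier V. f x = g x} = carrier V"
  proof (rule A(1))
    show "submodule {x \<in> carrier V. f x = g x} R V"
      by (rule V.submoduleI)
        (auto simp: lmod_homD[OF f] lmod_homD[OF g] lmod_hom_zero[OF V W f] lmod_hom_zero[OF V W g])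
  qed (use A(2) eq in auto)
  then show ?thesis using x by auto
qed

lemma lmod_hom_funpow:
  "f \<in> lmod_hom R V V \<Longrightarrow> f ^^ n \<in> lmod_hom R V V"
proof (induction n)
  case (Suc n)
  then show ?case using lmod_hom_comp[of "f ^^ n" R V V f V] by (simp add: comp_def)
qed (simp add: lmod_hom_id id_def)

lemma lmod_hom_add:
  assumes "left_module R W" "f \<in> lmod_hom R V W" "g \<in> lmod_hom R V W"
  shows "(\<lambda>x. f x \<oplus>\<^bsub>W\<^esub> g x) \<in> lmod_hom R V W"
proof -
  interpret W: left_module R W by fact
  show ?thesis
    by (rule lmod_homI)
      (auto simp: lmod_homD[OF assms(2)] lmod_homD[OF assms(3)] W.smult_r_distr W.M.a_ac)
qed

lemma lmod_hom_const_zero: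
  assumes "left_module R W"
  shows "(\<lambda>x. \<zero>\<^bsub>W\<^esub>) \<in> lmod_hom R V W"
proof -
  interpret W: left_module R W by fact
  show ?thesis by (rule lmod_homI) auto
qed

section \<open>Endomorphisms of modules over an Artin algebra\<close>

context artin_algebra
begin

text \<open>The maps \<open>g f\<^sup>n\<close>, recorded by their values on a finite set of generators, form a descending
  chain of \<open>k\<close>-submodules of a finite power of \<open>V\<close>. This makes the kernels of the powers of \<open>f\<close>
  stabilize without knowing that \<open>k\<close> is Noetherian.\<close>

lemma endomorphism_powers:
  assumes V: "left_module R V" and fg: "fin_gen_module R V" and f: "f \<in> lmod_hom R V V"
  shows "\<exists>n. \<exists>g\<in>lmod_hom R V V. \<forall>x\<in>carrier V. (f ^^ n) x = g ((f ^^ Suc n) x)"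
proof -
  interpret V: left_module R V by fact
  note \<phi> = ring_hom_closed[OF structure_map]
  let ?V = "restrict_lmod \<phi> V"
  have kV: "left_module k ?V"
    by (rule left_module_restrict_lmod[OF V k.ring_axioms structure_map])
  obtain A where A: "finite A" "A \<subseteq> carrier V" "\<And>S. submodule S R V \<Longrightarrow> A \<subseteq> S \<Longrightarrow> S = carrier V"
    using fg unfolding V.fin_gen_module_iff by blast
  let ?D = "prod_lmod A (\<lambda>_. ?V)"
  have D: "left_module k ?D" by (rule left_module_prod_lmod[OF k.ring_axioms kV])
  have dcc: "dcc_module k ?D"
  proof (rule dcc_module_jointly_injective[OF D A(1)])
    show "left_module k ?V \<and> dcc_module k ?V \<and> (\<lambda>h. h a) \<in> lmod_hom k ?D ?V" if "a \<in> A" for a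
      using kV dcc_restrict_lmod[OF V fg] prod_lmod_proj[OF that, of k "\<lambda>_. ?V"] by blast
    show "h = \<zero>\<^bsub>?D\<^esub>" if "h \<in> carrier ?D" "\<And>a. a \<in> A \<Longrightarrow> h a = \<zero>\<^bsub>?V\<^esub>" for h
      using that by (auto simp: prod_lmod_simps PiE_iff extensional_def fun_eq_iff)
  qed
  have fA: "(f ^^ n) a \<in> carrier V" if "a \<in> A" for n a
    using lmod_homD(1)[OF lmod_hom_funpow[OF f]] that A(2) by blast
  define C where "C n = {\<lambda>a\<in>A. g ((f ^^ n) a) | g. g \<in> lmod_hom R V V}" for n
  have sub: "submodule (C n) k ?D" for n
  proof (rule left_module.submoduleI[OF D])
    show "C n \<subseteq> carrier ?D"
      using lmod_homD(1)[OF _ fA] by (fastforce simp: C_def prod_lmod_simps)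
    show "\<zero>\<^bsub>?D\<^esub> \<in> C n"
      unfolding C_def prod_lmod_simps restrict_lmod_simps
      using lmod_hom_const_zero[OF V, of V] by (intro CollectI exI[of _ "\<lambda>x. \<zero>\<^bsub>V\<^esub>"]) simp
    show "x \<oplus>\<^bsub>?D\<^esub> y \<in> C n" if xy: "x \<in> C n" "y \<in> C n" for x y
    proof -
      obtain g h where gh: "g \<in> lmod_hom R V V" "h \<in> lmod_hom R V V"
        "x = (\<lambda>a\<in>A. g ((f ^^ n) a))" "y = (\<lambda>a\<in>A. h ((f ^^ n) a))"
        using xy unfolding C_def by blast
      have "x \<oplus>\<^bsub>?D\<^esub> y = (\<lambda>a\<in>A. g ((f ^^ n) a) \<oplus>\<^bsub>V\<^esub> h ((f ^^ n) a))"
        unfolding gh(3,4) prod_lmod_simps by (rule restrict_ext) simp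
      then show ?thesis unfolding C_def using lmod_hom_add[OF V gh(1,2)]
        by (intro CollectI exI[of _ "\<lambda>x. g x \<oplus>\<^bsub>V\<^esub> h x"]) simp
    qed
    show "c \<odot>\<^bsub>?D\<^esub> x \<in> C n" if c: "c \<in> carrier k" and x: "x \<in> C n" for c x
    proof -
      obtain g where g: "g \<in> lmod_hom R V V" "x = (\<lambda>a\<in>A. g ((f ^^ n) a))"
        using x unfolding C_def by blast
      have "c \<odot>\<^bsub>?D\<^esub> x = (\<lambda>a\<in>A. \<phi> c \<odot>\<^bsub>V\<^esub> g ((f ^^ n) a))"
        unfolding g(2) prod_lmod_simps by (rule restrict_ext) simp
      \<comment> \<open>Centrality of \<open>\<phi> c\<close> is what makes this multiple of
        \<open>g\<close> linear over \<open>R\<close>.\<close>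
      moreover have "(\<lambda>x. \<phi> c \<odot>\<^bsub>V\<^esub> g x) \<in> lmod_hom R V V"
        using \<phi> c central[OF c]
        by (intro lmod_homI) (auto simp: lmod_homD[OF g(1)] V.smult_r_distr V.smult_assoc1[symmetric])
      ultimately show ?thesis unfolding C_def
        by (intro CollectI exI[of _ "\<lambda>x. \<phi> c \<odot>\<^bsub>V\<^esub> g x"]) simp
    qed
  qed
  have "C (Suc n) \<subseteq> C n" for n
  proof
    fix x assume "x \<in> C (Suc n)"
    then obtain g where g: "g \<in> lmod_hom R V V" "x = (\<lambda>a\<in>A. g ((f ^^ Suc n) a))"
      unfolding C_def by blast
    then have "x = (\<lambda>a\<in>A. g (f ((f ^^ n) a)))" by simp
    then show "x \<in> C n" unfolding C_def using lmod_hom_comp[OF f g(1)]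
      by (intro CollectI exI[of _ "\<lambda>x. g (f x)"]) simp
  qed
  then obtain n where n: "\<And>m. m \<ge> n \<Longrightarrow> C m = C n"
    using dcc_moduleD[where S = C, OF dcc sub] by blast
  \<comment> \<open>With \<open>g\<close> the identity, \<open>f ^^ n\<close> is recorded in
    \<open>C n\<close>; as the chain is constant from \<open>n\<close> on, \<open>f ^^ n\<close>
    also factors through \<open>f ^^ Suc n\<close>.\<close>
  have "(\<lambda>a\<in>A. (f ^^ n) a) \<in> C n"
    unfolding C_def using lmod_hom_id[of R V] by (intro CollectI exI[of _ "\<lambda>x. x"]) simp
  then have "(\<lambda>a\<in>A. (f ^^ n) a) \<in> C (Suc n)" using n[of "Suc n"] by simp
  then obtain g where g: "g \<in> lmod_hom R V V" "(\<lambda>a\<in>A. (f ^^ n) a) = (\<lambda>a\<in>A. g ((f ^^ Suc n) a))"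
    unfolding C_def by blast
  have "(f ^^ n) x = g ((f ^^ Suc n) x)" if "x \<in> carrier V" for x
  proof (rule lmod_hom_eq_on_gens[OF V V A(3,2) lmod_hom_funpow[OF f] lmod_hom_comp[OF lmod_hom_funpow[OF f] g(1)] _ that])
    show "(f ^^ n) a = g ((f ^^ Suc n) a)" if "a \<in> A" for a
      using fun_cong[OF g(2), of a] that by simp
  qed
  then show ?thesis using g(1) by blast
qed

text \<open>For large \<open>N\<close> the module is the direct sum of the kernel and the image of
  \<open>f ^^ N\<close>, and one of them vanishes. Kernels stabilize by
  \<open>endomorphism_powers\<close>, images by the descending chain condition.\<close>

lemma fitting:
  assumes V: "left_module R V" and fg: "fin_gen_module R V" and ind: "indecomposable_module R V"
    and f: "f \<in> lmod_hom R V V"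
  shows "bij_betw f (carrier V) (carrier V) \<or> (\<exists>n. \<forall>x\<in>carrier V. (f ^^ n) x = \<zero>\<^bsub>V\<^esub>)"
proof -
  interpret V: left_module R V by fact
  note fn = lmod_hom_funpow[OF f]
  have f0: "(f ^^ n) \<zero>\<^bsub>V\<^esub> = \<zero>\<^bsub>V\<^esub>" for n by (rule lmod_hom_zero[OF V V fn])
  obtain n1 g where g: "g \<in> lmod_hom R V V"
    and n1: "\<And>x. x \<in> carrier V \<Longrightarrow> (f ^^ n1) x = g ((f ^^ Suc n1) x)"
    using endomorphism_powers[OF V fg f] by blast
  have "\<exists>n. \<forall>m\<ge>n. (f ^^ m) ` carrier V = (f ^^ n) ` carrier V"
  proof (rule dcc_moduleD[OF dcc_fin_gen[OF V fg]])
    show "submodule ((f ^^ n) ` carrier V) R V" for n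
      by (rule submodule_image[OF V V fn V.submodule_carrier])
    show "(f ^^ Suc n) ` carrier V \<subseteq> (f ^^ n) ` carrier V" for n
      using lmod_homD(1)[OF f] by (auto simp: funpow_swap1)
  qed
  then obtain n2 where n2: "\<And>m. m \<ge> n2 \<Longrightarrow> (f ^^ m) ` carrier V = (f ^^ n2) ` carrier V"
    by blast
  \<comment> \<open>\<open>n1\<close> governs the kernels and \<open>n2\<close> the images. The
    successor makes \<open>N\<close> positive, so that the kernel of \<open>f\<close> lies in that
    of \<open>f ^^ N\<close> and the image of \<open>f ^^ N\<close> in that of
    \<open>f\<close>.\<close>
  define N where "N = Suc (max n1 n2)"
  have N: "n1 \<le> N" "n2 \<le> N" by (simp_all add: N_def)
  let ?K = "{x \<in> carrier V. (f ^^ N) x \<in> {\<zero>\<^bsub>V\<^esub>}}" and ?I = "(f ^^ N) ` carrier V"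
  \<comment> \<open>Splitting off \<open>f ^^ (m - n1)\<close> first shows that \<open>g\<close>
    recovers \<open>f ^^ m\<close> from \<open>f ^^ Suc m\<close> for every
    \<open>m \<ge> n1\<close>, not only for \<open>n1\<close>.\<close>
  have step: "(f ^^ m) x = \<zero>\<^bsub>V\<^esub>" if "m \<ge> n1" "x \<in> carrier V" "(f ^^ Suc m) x = \<zero>\<^bsub>V\<^esub>" for m x
  proof -
    have "(f ^^ m) x = (f ^^ n1) ((f ^^ (m - n1)) x)"
      using that(1) by (metis comp_apply funpow_add le_add_diff_inverse)
    also have "\<dots> = g ((f ^^ Suc n1) ((f ^^ (m - n1)) x))"
      by (rule n1) (rule lmod_homD(1)[OF fn that(2)])
    also have "(f ^^ Suc n1) ((f ^^ (m - n1)) x) = (f ^^ Suc m) x"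
      using that(1) by (metis add_Suc comp_apply funpow_add le_add_diff_inverse)
    finally show ?thesis unfolding that(3) lmod_hom_zero[OF V V g] .
  qed
  have ker: "(f ^^ N) x = \<zero>\<^bsub>V\<^esub>" if x: "x \<in> carrier V" and "(f ^^ (j + N)) x = \<zero>\<^bsub>V\<^esub>" for j x
    using that(2)
  proof (induction j)
    case (Suc j)
    have "(f ^^ (j + N)) x = \<zero>\<^bsub>V\<^esub>"
      by (rule step[OF _ x]) (use Suc.prems N in simp_all)
    then show ?case by (rule Suc.IH)
  qed simp
  have K: "submodule ?K R V" by (rule submodule_vimage[OF V V fn V.submodule_zero])
  have I: "submodule ?I R V" by (rule submodule_image[OF V V fn V.submodule_carrier])
  have "?K \<inter> ?I = {\<zero>\<^bsub>V\<^esub>}"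
  proof -
    have "x = \<zero>\<^bsub>V\<^esub>" if xK: "x \<in> ?K" and xI: "x \<in> ?I" for x
    proof -
      obtain y where y: "y \<in> carrier V" "x = (f ^^ N) y" using xI by blast
      then have "(f ^^ (N + N)) y = \<zero>\<^bsub>V\<^esub>" using xK by (simp add: funpow_add)
      then show ?thesis using ker[OF y(1)] y(2) by blast
    qed
    then show ?thesis using submoduleD(2)[OF K] submoduleD(2)[OF I] by blast
  qed
  moreover have "?K <+>\<^bsub>V\<^esub> ?I = carrier V"
  proof
    show "?K <+>\<^bsub>V\<^esub> ?I \<subseteq> carrier V"
      using submoduleD(1)[OF K] submoduleD(1)[OF I] V.M.a_closed unfolding set_add_def set_mult_def
      by (auto)
    show "carrier V \<subseteq> ?K <+>\<^bsub>V\<^esub> ?I"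
    proof
      fix x assume x: "x \<in> carrier V"
      \<comment> \<open>Since \<open>f ^^ N\<close> and \<open>f ^^ (N + N)\<close> have the same
        image, subtracting a suitable element of \<open>?I\<close> from \<open>x\<close> leaves
        something killed by \<open>f ^^ N\<close>.\<close>
      have "(f ^^ N) ` carrier V = (f ^^ (N + N)) ` carrier V"
        using n2[of N] n2[of "N + N"] N by simp
      then obtain y where y: "y \<in> carrier V" "(f ^^ N) x = (f ^^ (N + N)) y"
        using x by (metis (no_types, lifting) imageE imageI)
      define z where "z = (f ^^ N) y"
      have z: "z \<in> ?I" "z \<in> carrier V" "(f ^^ N) x = (f ^^ N) z"
        using y lmod_homD(1)[OF fn] by (auto simp: z_def funpow_add)
      have "(f ^^ N) (x \<ominus>\<^bsub>V\<^esub> z) = (f ^^ N) z \<ominus>\<^bsub>V\<^esub> (f ^^ N) z"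
        using lmod_hom_minus[OF V V fn x z(2)] z(3) by simp
      also have "\<dots> = \<zero>\<^bsub>V\<^esub>" using lmod_homD(1)[OF fn z(2)] by (simp only: a_minus_def V.M.r_neg)
      finally have "x \<ominus>\<^bsub>V\<^esub> z \<in> ?K" using x z(2) by simp
      moreover have "x = (x \<ominus>\<^bsub>V\<^esub> z) \<oplus>\<^bsub>V\<^esub> z"
        using x z(2) by (simp add: a_minus_def V.M.a_assoc V.M.l_neg)
      ultimately show "x \<in> ?K <+>\<^bsub>V\<^esub> ?I" using z(1) unfolding set_add_def set_mult_def by auto
    qed
  qed
  ultimately have "?K = {\<zero>\<^bsub>V\<^esub>} \<or> ?I = {\<zero>\<^bsub>V\<^esub>}"
    using ind K I unfolding indecomposable_module_def by blast
  then show ?thesis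
  proof
    assume "?I = {\<zero>\<^bsub>V\<^esub>}"
    then have "\<forall>x\<in>carrier V. (f ^^ N) x = \<zero>\<^bsub>V\<^esub>" by blast
    then show ?thesis by blast
  next
    assume K0: "?K = {\<zero>\<^bsub>V\<^esub>}"
    have "inj_on f (carrier V)"
    proof (rule lmod_hom_inj[OF V V f])
      fix x assume x: "x \<in> carrier V" "f x = \<zero>\<^bsub>V\<^esub>"
      then have "(f ^^ N) x = \<zero>\<^bsub>V\<^esub>" using f0[of "max n1 n2"] by (simp add: N_def funpow_swap1)
      then show "x = \<zero>\<^bsub>V\<^esub>" using K0 x(1) by blast
    qed
    moreover have "carrier V \<subseteq> f ` carrier V"
    proof
      fix x assume "x \<in> carrier V"
      then have "x \<in> ?K <+>\<^bsub>V\<^esub> ?I" using \<open>?K <+>\<^bsub>V\<^esub> ?I = carrier V\<close> by blast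
      then obtain a b where ab: "a \<in> ?K" "b \<in> ?I" "x = a \<oplus>\<^bsub>V\<^esub> b" unfolding set_add_def set_mult_def by auto
      have "a = \<zero>\<^bsub>V\<^esub>" using K0 ab(1) by blast
      moreover have "b \<in> carrier V" using ab(2) submoduleD(1)[OF I] by blast
      ultimately have "x \<in> ?I" using ab(2,3) by simp
      then obtain y where "y \<in> carrier V" "x = f ((f ^^ max n1 n2) y)" by (auto simp: N_def)
      then show "x \<in> f ` carrier V" using lmod_homD(1)[OF fn] by blast
    qed
    ultimately show ?thesis using lmod_homD(1)[OF f] by (auto simp: bij_betw_def)
  qed
qed

text \<open>After composing with the inverse of the sum, the summands \<open>?a\<close> and
  \<open>?b\<close> add up to the identity. If neither were bijective, both would be nilpotent by
  \<open>fitting\<close>. But \<open>?a\<close> is the identity on the kernel of \<open>?b\<close>,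
  so nilpotency of \<open>?a\<close> makes \<open>?b\<close> injective, and an injective nilpotent
  map forces \<open>V\<close> to be zero.\<close>

lemma local_endomorphisms:
  assumes V: "left_module R V" and fg: "fin_gen_module R V" and ind: "indecomposable_module R V"
    and f: "f \<in> lmod_hom R V V" and g: "g \<in> lmod_hom R V V"
    and bij: "bij_betw (\<lambda>x. f x \<oplus>\<^bsub>V\<^esub> g x) (carrier V) (carrier V)"
  shows "bij_betw f (carrier V) (carrier V) \<or> bij_betw g (carrier V) (carrier V)"
proof -
  interpret V: left_module R V by fact
  let ?h = "\<lambda>x. f x \<oplus>\<^bsub>V\<^esub> g x"
  define i where "i = inv_into (carrier V) ?h"
  have i: "i \<in> lmod_hom R V V" unfolding i_def by (rule lmod_hom_inv[OF V lmod_hom_add[OF V f g] bij])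
  have ibij: "bij_betw i (carrier V) (carrier V)" unfolding i_def by (rule bij_betw_inv_into[OF bij])
  have ih: "i (?h x) = x" if "x \<in> carrier V" for x
    unfolding i_def using bij_betw_inv_into_left[OF bij that] by simp
  let ?a = "\<lambda>x. i (f x)" and ?b = "\<lambda>x. i (g x)"
  have a: "?a \<in> lmod_hom R V V" and b: "?b \<in> lmod_hom R V V" by (auto intro: lmod_hom_comp f g i)
  have ab: "?a x \<oplus>\<^bsub>V\<^esub> ?b x = x" if "x \<in> carrier V" for x
    using ih[OF that] lmod_homD(2)[OF i] lmod_homD(1)[OF f that] lmod_homD(1)[OF g that] by simp
  have lift: "bij_betw u (carrier V) (carrier V)"
    if u: "u \<in> lmod_hom R V V" and "bij_betw (\<lambda>x. i (u x)) (carrier V) (carrier V)" for u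
    using bij_betw_comp_iff2[OF ibij, of u "carrier V"] lmod_homD(1)[OF u] that(2) by (auto simp: comp_def)
  show ?thesis
  proof (rule ccontr)
    assume no: "\<not> ?thesis"
    obtain n where n: "\<forall>x\<in>carrier V. (?a ^^ n) x = \<zero>\<^bsub>V\<^esub>"
      using fitting[OF V fg ind a] lift[OF f] no by blast
    obtain m where m: "\<forall>x\<in>carrier V. (?b ^^ m) x = \<zero>\<^bsub>V\<^esub>"
      using fitting[OF V fg ind b] lift[OF g] no by blast
    have kerb: "x = \<zero>\<^bsub>V\<^esub>" if x: "x \<in> carrier V" "?b x = \<zero>\<^bsub>V\<^esub>" for x
    proof -
      have "?a x = x" using ab[OF x(1)] x lmod_homD(1)[OF a x(1)] by simp
      then have "(?a ^^ j) x = x" for j by (induction j) auto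
      then show ?thesis using n x(1) by metis
    qed
    have "(?b ^^ j) x = \<zero>\<^bsub>V\<^esub> \<Longrightarrow> x = \<zero>\<^bsub>V\<^esub>" if "x \<in> carrier V" for j x
    proof (induction j)
      case (Suc j)
      then show ?case using kerb[OF lmod_homD(1)[OF lmod_hom_funpow[OF b] that, of j]] by simp
    qed simp
    then have "carrier V = {\<zero>\<^bsub>V\<^esub>}" using m by blast
    then show False using ind unfolding indecomposable_module_def by blast
  qed
qed

end

section \<open>Direct summands\<close>

text \<open>Composing \<open>v\<close> with the inverse of the bijection would give a retraction of
  \<open>u\<close>. Asking for bijectivity instead matches what \<open>local_endomorphisms\<close>
  delivers.\<close>

definition lmod_summand ::
  "('a, 'c) ring_scheme \<Rightarrow> ('a, 'm, 'd) module_scheme \<Rightarrow> ('a, 'n, 'e) module_scheme \<Rightarrow> bool"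
  where "lmod_summand R V W \<longleftrightarrow>
    (\<exists>u\<in>lmod_hom R V W. \<exists>v\<in>lmod_hom R W V. bij_betw (\<lambda>x. v (u x)) (carrier V) (carrier V))"

lemma lmod_summandI:
  assumes "u \<in> lmod_hom R V W" "v \<in> lmod_hom R W V" "bij_betw (\<lambda>x. v (u x)) (carrier V) (carrier V)"
  shows "lmod_summand R V W"
  using assms unfolding lmod_summand_def by (intro bexI[of _ u] bexI[of _ v])

lemma direct_sum_projections:
  assumes M: "left_module R M" and A: "submodule A R M" and B: "submodule B R M"
    and sum: "A <+>\<^bsub>M\<^esub> B = carrier M" and int: "A \<inter> B = {\<zero>\<^bsub>M\<^esub>}"
  shows "\<exists>p\<in>lmod_hom R M (M\<lparr>carrier := A\<rparr>). \<exists>q\<in>lmod_hom R M (M\<lparr>carrier := B\<rparr>).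
    \<forall>x\<in>carrier M. p x \<oplus>\<^bsub>M\<^esub> q x = x"
proof -
  interpret M: left_module R M by fact
  note DA = submoduleD[OF A] and DB = submoduleD[OF B]
  have uniq: "a = a'" "b = b'"
    if ab: "a \<in> A" "a' \<in> A" "b \<in> B" "b' \<in> B" and eq: "a \<oplus>\<^bsub>M\<^esub> b = a' \<oplus>\<^bsub>M\<^esub> b'" for a a' b b'
  proof -
    have c: "a \<in> carrier M" "a' \<in> carrier M" "b \<in> carrier M" "b' \<in> carrier M"
      using ab DA(1) DB(1) by auto
    have "a = a' \<oplus>\<^bsub>M\<^esub> b' \<oplus>\<^bsub>M\<^esub> \<ominus>\<^bsub>M\<^esub> b"
      using eq c by (metis M.M.a_assoc M.M.a_inv_closed M.M.r_neg M.M.r_zero)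
    then have "\<ominus>\<^bsub>M\<^esub> a' \<oplus>\<^bsub>M\<^esub> a = b' \<oplus>\<^bsub>M\<^esub> \<ominus>\<^bsub>M\<^esub> b"
      using c by (simp add: M.M.a_assoc M.M.r_neg1)
    moreover have "\<ominus>\<^bsub>M\<^esub> a' \<oplus>\<^bsub>M\<^esub> a \<in> A" "b' \<oplus>\<^bsub>M\<^esub> \<ominus>\<^bsub>M\<^esub> b \<in> B" using ab DA DB by auto
    ultimately have "\<ominus>\<^bsub>M\<^esub> a' \<oplus>\<^bsub>M\<^esub> a \<in> A \<inter> B" by simp
    then have 0: "\<ominus>\<^bsub>M\<^esub> a' \<oplus>\<^bsub>M\<^esub> a = \<zero>\<^bsub>M\<^esub>" using int by simp
    have "a' \<oplus>\<^bsub>M\<^esub> (\<ominus>\<^bsub>M\<^esub> a' \<oplus>\<^bsub>M\<^esub> a) = a" using c by (rule_tac M.M.r_neg2)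
    then show "a = a'" unfolding 0 using c by simp
    then show "b = b'" using eq c by simp
  qed
  define P where "P x a b \<longleftrightarrow> a \<in> A \<and> b \<in> B \<and> a \<oplus>\<^bsub>M\<^esub> b = x" for x a b
  have "\<exists>a b. P x a b" if x: "x \<in> carrier M" for x
  proof -
    have "x \<in> A <+>\<^bsub>M\<^esub> B" using x sum by simp
    then obtain a b where "a \<in> A" "b \<in> B" "x = a \<oplus>\<^bsub>M\<^esub> b"
      unfolding set_add_def set_mult_def by auto
    then show ?thesis unfolding P_def by blast
  qed
  then obtain p q where pq: "\<And>x. x \<in> carrier M \<Longrightarrow> P x (p x) (q x)" by metis
  note pq' = pq[unfolded P_def]
  have pq_eq: "p x = a" "q x = b" if "x \<in> carrier M" "a \<in> A" "b \<in> B" "a \<oplus>\<^bsub>M\<^esub> b = x" for x a b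
    using uniq[of "p x" a "q x" b] pq'[OF that(1)] that by simp_all
  have pqc: "p x \<in> carrier M" "q x \<in> carrier M" if "x \<in> carrier M" for x
    using pq'[OF that] DA(1) DB(1) by auto
  have add: "p (x \<oplus>\<^bsub>M\<^esub> y) = p x \<oplus>\<^bsub>M\<^esub> p y" "q (x \<oplus>\<^bsub>M\<^esub> y) = q x \<oplus>\<^bsub>M\<^esub> q y"
    if xy: "x \<in> carrier M" "y \<in> carrier M" for x y
  proof -
    have "(p x \<oplus>\<^bsub>M\<^esub> p y) \<oplus>\<^bsub>M\<^esub> (q x \<oplus>\<^bsub>M\<^esub> q y) = (p x \<oplus>\<^bsub>M\<^esub> q x) \<oplus>\<^bsub>M\<^esub> (p y \<oplus>\<^bsub>M\<^esub> q y)"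
      using pqc xy by (simp add: M.M.a_ac)
    also have "\<dots> = x \<oplus>\<^bsub>M\<^esub> y" using pq' xy by simp
    finally show "p (x \<oplus>\<^bsub>M\<^esub> y) = p x \<oplus>\<^bsub>M\<^esub> p y" "q (x \<oplus>\<^bsub>M\<^esub> y) = q x \<oplus>\<^bsub>M\<^esub> q y"
      using pq_eq[OF M.M.a_closed[OF xy] DA(3) DB(3)] pq'[OF xy(1)] pq'[OF xy(2)] by blast+
  qed
  have smult: "p (r \<odot>\<^bsub>M\<^esub> x) = r \<odot>\<^bsub>M\<^esub> p x" "q (r \<odot>\<^bsub>M\<^esub> x) = r \<odot>\<^bsub>M\<^esub> q x"
    if rx: "r \<in> carrier R" "x \<in> carrier M" for r x
  proof -
    have "r \<odot>\<^bsub>M\<^esub> p x \<oplus>\<^bsub>M\<^esub> r \<odot>\<^bsub>M\<^esub> q x = r \<odot>\<^bsub>M\<^esub> (p x \<oplus>\<^bsub>M\<^esub> q x)"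
      using pqc rx by (simp add: M.smult_r_distr)
    also have "\<dots> = r \<odot>\<^bsub>M\<^esub> x" using pq' rx by simp
    finally show "p (r \<odot>\<^bsub>M\<^esub> x) = r \<odot>\<^bsub>M\<^esub> p x" "q (r \<odot>\<^bsub>M\<^esub> x) = r \<odot>\<^bsub>M\<^esub> q x"
      using pq_eq[OF M.smult_closed[OF rx] DA(4)[OF rx(1)] DB(4)[OF rx(1)]] pq'[OF rx(2)] by blast+
  qed
  show ?thesis
    by (intro bexI[of _ p] bexI[of _ q]) (use pq' add smult in \<open>auto intro!: lmod_homI\<close>)
qed

text \<open>\<open>W\<close> is the direct sum of the image of \<open>u\<close> and the kernel of
  \<open>v\<close>. The image is nonzero because \<open>V\<close> is, so the kernel vanishes and
  \<open>u\<close> is bijective.\<close>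

lemma summand_indecomposable_iso:
  assumes V: "left_module R V" and W: "left_module R W" and s: "lmod_summand R V W"
    and indV: "indecomposable_module R V" and indW: "indecomposable_module R W"
  shows "lmod_iso R V W"
proof -
  interpret V: left_module R V by fact
  interpret W: left_module R W by fact
  obtain u v where u: "u \<in> lmod_hom R V W" and v: "v \<in> lmod_hom R W V"
    and bij: "bij_betw (\<lambda>x. v (u x)) (carrier V) (carrier V)"
    using s unfolding lmod_summand_def by blast
  have inj: "inj_on (\<lambda>x. v (u x)) (carrier V)" and surj: "(\<lambda>x. v (u x)) ` carrier V = carrier V"
    using bij by (auto simp: bij_betw_def)
  note hu = lmod_homD[OF u] and hv = lmod_homD[OF v]
  have u0: "u \<zero>\<^bsub>V\<^esub> = \<zero>\<^bsub>W\<^esub>" and v0: "v \<zero>\<^bsub>W\<^esub> = \<zero>\<^bsub>V\<^esub>"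
    by (rule lmod_hom_zero[OF V W u], rule lmod_hom_zero[OF W V v])
  let ?I = "u ` carrier V" and ?K = "{x \<in> carrier W. v x \<in> {\<zero>\<^bsub>V\<^esub>}}"
  have I: "submodule ?I R W" by (rule submodule_image[OF V W u V.submodule_carrier])
  have K: "submodule ?K R W" by (rule submodule_vimage[OF W V v V.submodule_zero])
  have inju: "inj_on u (carrier V)"
    using inj by (auto simp: inj_on_def)
  have "x = \<zero>\<^bsub>W\<^esub>" if x: "x \<in> ?I" "x \<in> ?K" for x
  proof -
    from x(1) obtain y where y: "y \<in> carrier V" "x = u y" by blast
    have "v (u y) = v (u \<zero>\<^bsub>V\<^esub>)" using x(2) y u0 v0 by simp
    then have "y = \<zero>\<^bsub>V\<^esub>" using inj_onD[OF inj, of y "\<zero>\<^bsub>V\<^esub>"] y(1) by simp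
    then show ?thesis using y u0 by simp
  qed
  then have int: "?I \<inter> ?K = {\<zero>\<^bsub>W\<^esub>}"
    using submoduleD(2)[OF I] submoduleD(2)[OF K] by blast
  have "carrier W \<subseteq> ?I <+>\<^bsub>W\<^esub> ?K"
  proof
    fix x assume x: "x \<in> carrier W"
    have "v x \<in> (\<lambda>x. v (u x)) ` carrier V" unfolding surj using hv(1)[OF x] .
    then obtain y where y: "y \<in> carrier V" "v x = v (u y)" by blast
    have "v (x \<ominus>\<^bsub>W\<^esub> u y) = v x \<ominus>\<^bsub>V\<^esub> v (u y)"
      by (rule lmod_hom_minus[OF W V v x hu(1)[OF y(1)]])
    also have "\<dots> = \<zero>\<^bsub>V\<^esub>" unfolding y(2) a_minus_def by (rule V.M.r_neg) (use hu hv y in blast)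
    finally have "x \<ominus>\<^bsub>W\<^esub> u y \<in> ?K" using x hu(1)[OF y(1)] by simp
    moreover have "x = u y \<oplus>\<^bsub>W\<^esub> (x \<ominus>\<^bsub>W\<^esub> u y)"
      using x hu(1)[OF y(1)] by (simp add: a_minus_def W.M.a_lcomm W.M.r_neg)
    ultimately show "x \<in> ?I <+>\<^bsub>W\<^esub> ?K" using y(1) unfolding set_add_def set_mult_def by auto
  qed
  moreover have "?I <+>\<^bsub>W\<^esub> ?K \<subseteq> carrier W"
    using submoduleD(1)[OF I] submoduleD(1)[OF K] unfolding set_add_def set_mult_def by auto
  ultimately have sum: "?I <+>\<^bsub>W\<^esub> ?K = carrier W" by blast
  have "?I \<noteq> {\<zero>\<^bsub>W\<^esub>}"
  proof
    assume I0: "?I = {\<zero>\<^bsub>W\<^esub>}"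
    have "carrier V \<subseteq> {\<zero>\<^bsub>V\<^esub>}"
    proof
      fix x assume x: "x \<in> carrier V"
      then have "u x \<in> ?I" by (rule imageI)
      then have "u x = u \<zero>\<^bsub>V\<^esub>" unfolding I0 u0 by simp
      then show "x \<in> {\<zero>\<^bsub>V\<^esub>}" using inj_onD[OF inju, of x "\<zero>\<^bsub>V\<^esub>"] x by simp
    qed
    then show False using indV unfolding indecomposable_module_def by blast
  qed
  then have K0: "?K = {\<zero>\<^bsub>W\<^esub>}"
    using indW I K int sum unfolding indecomposable_module_def by blast
  have "?I = carrier W"
  proof
    show "carrier W \<subseteq> ?I"
    proof
      fix x assume "x \<in> carrier W"
      then have "x \<in> ?I <+>\<^bsub>W\<^esub> ?K" using sum by blast
      then obtain a where "a \<in> ?I" "x = a \<oplus>\<^bsub>W\<^esub> \<zero>\<^bsub>W\<^esub>" unfolding K0 set_add_def set_mult_def by auto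
      then show "x \<in> ?I" using submoduleD(1)[OF I] by auto
    qed
  qed (rule submoduleD(1)[OF I])
  then show ?thesis using u inju unfolding lmod_iso_def by (auto simp: bij_betw_def)
qed

text \<open>With the projections \<open>p\<close> and \<open>q\<close>, the composite v u is the sum
  of v p u and v q u, and \<open>local_endomorphisms\<close> makes one of these bijective. This is
  the exchange step of the Krull-Schmidt theorem.\<close>

lemma (in artin_algebra) summand_direct_sum:
  assumes V: "left_module R V" "fin_gen_module R V" "indecomposable_module R V"
    and W: "left_module R W" and s: "lmod_summand R V W"
    and A: "submodule A R W" and B: "submodule B R W"
    and sum: "A <+>\<^bsub>W\<^esub> B = carrier W" and int: "A \<inter> B = {\<zero>\<^bsub>W\<^esub>}"
  shows "lmod_summand R V (W\<lparr>carrier := A\<rparr>) \<or> lmod_summand R V (W\<lparr>carrier := B\<rparr>)"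
proof -
  obtain u v where u: "u \<in> lmod_hom R V W" and v: "v \<in> lmod_hom R W V"
    and bij: "bij_betw (\<lambda>x. v (u x)) (carrier V) (carrier V)"
    using s unfolding lmod_summand_def by blast
  obtain p q where p: "p \<in> lmod_hom R W (W\<lparr>carrier := A\<rparr>)" and q: "q \<in> lmod_hom R W (W\<lparr>carrier := B\<rparr>)"
    and pq: "\<And>x. x \<in> carrier W \<Longrightarrow> p x \<oplus>\<^bsub>W\<^esub> q x = x"
    using direct_sum_projections[OF W A B sum int] by blast
  note p' = lmod_hom_incl[OF p submoduleD(1)[OF A]] and q' = lmod_hom_incl[OF q submoduleD(1)[OF B]]
  have eq: "v (u x) = v (p (u x)) \<oplus>\<^bsub>V\<^esub> v (q (u x))" if "x \<in> carrier V" for x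
    using lmod_homD(2)[OF v, of "p (u x)" "q (u x)"] pq lmod_homD(1)[OF u that]
      lmod_homD(1)[OF p'] lmod_homD(1)[OF q'] by simp
  have "bij_betw (\<lambda>x. v (p (u x)) \<oplus>\<^bsub>V\<^esub> v (q (u x))) (carrier V) (carrier V)"
    by (rule iffD1[OF bij_betw_cong bij]) (rule eq)
  then have "bij_betw (\<lambda>x. v (p (u x))) (carrier V) (carrier V) \<or>
      bij_betw (\<lambda>x. v (q (u x))) (carrier V) (carrier V)"
    by (intro local_endomorphisms[OF V] lmod_hom_comp[OF u] lmod_hom_comp[OF _ v] p' q')
  moreover have "lmod_summand R V (W\<lparr>carrier := A\<rparr>)" if "bij_betw (\<lambda>x. v (p (u x))) (carrier V) (carrier V)"
    by (rule lmod_summandI[OF lmod_hom_comp[OF u p] lmod_hom_restrict[OF v submoduleD(1)[OF A]] that])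
  moreover have "lmod_summand R V (W\<lparr>carrier := B\<rparr>)" if "bij_betw (\<lambda>x. v (q (u x))) (carrier V) (carrier V)"
    by (rule lmod_summandI[OF lmod_hom_comp[OF u q] lmod_hom_restrict[OF v submoduleD(1)[OF B]] that])
  ultimately show ?thesis by blast
qed

text \<open>By induction over the submodules of \<open>W\<close>: a decomposable one splits into two
  proper submodules, and an indecomposable summand is a summand of one of them. An indecomposable
  one admits only itself.\<close>

lemma (in artin_algebra) finite_indecomposable_summands:
  fixes W :: "('a, 'w, 'd) module_scheme"
  assumes W: "left_module R W" and dcc: "dcc_module R W"
  shows "\<exists>Zs :: ('a, 'w, 'd) module_scheme set. finite Zs \<and>
    (\<forall>V\<in>fg_indec_modules R. lmod_summand R V W \<longrightarrow> (\<exists>Z\<in>Zs. lmod_iso R V Z))"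
proof -
  interpret W: left_module R W by fact
  let ?Q = "\<lambda>H. \<exists>Zs :: ('a, 'w, 'd) module_scheme set. finite Zs \<and>
    (\<forall>V\<in>fg_indec_modules R. lmod_summand R V (W\<lparr>carrier := H\<rparr>) \<longrightarrow> (\<exists>Z\<in>Zs. lmod_iso R V Z))"
  have "?Q (carrier W)"
  proof (rule dcc_module_induct[OF dcc W.submodule_carrier])
    fix H assume H: "submodule H R W" and IH: "\<And>H'. submodule H' R W \<Longrightarrow> H' \<subset> H \<Longrightarrow> ?Q H'"
    let ?H = "W\<lparr>carrier := H\<rparr>"
    interpret H: left_module R ?H by (rule W.left_module_submodule[OF H])
    show "?Q H"
    proof (cases "H = {\<zero>\<^bsub>W\<^esub>}")
      case True
      have "\<not> lmod_summand R V ?H" if "V \<in> fg_indec_modules R" for V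
      proof
        assume "lmod_summand R V ?H"
        then obtain u v where u: "u \<in> lmod_hom R V ?H" and v: "v \<in> lmod_hom R ?H V"
          and bij: "bij_betw (\<lambda>x. v (u x)) (carrier V) (carrier V)"
          unfolding lmod_summand_def by blast
        have V: "left_module R V" and ind: "indecomposable_module R V"
          using that by (auto simp: fg_indec_modules_def)
        have "v (u x) = \<zero>\<^bsub>V\<^esub>" if "x \<in> carrier V" for x
          using lmod_homD(1)[OF u that] lmod_hom_zero[OF H.left_module_axioms V v] True by simp
        then have "(\<lambda>x. v (u x)) ` carrier V \<subseteq> {\<zero>\<^bsub>V\<^esub>}" by blast
        then have "carrier V \<subseteq> {\<zero>\<^bsub>V\<^esub>}" using bij by (simp add: bij_betw_def)
        moreover have "\<zero>\<^bsub>V\<^esub> \<in> carrier V"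
          using submoduleD(2)[OF left_module.submodule_carrier[OF V]] .
        ultimately show False using ind unfolding indecomposable_module_def by blast
      qed
      then show ?thesis by blast
    next
      case H0: False
      show ?thesis
      proof (cases "indecomposable_module R ?H")
        case True
        have "lmod_iso R V ?H" if "V \<in> fg_indec_modules R" "lmod_summand R V ?H" for V
          using that summand_indecomposable_iso[OF _ H.left_module_axioms _ _ True]
          by (auto simp: fg_indec_modules_def)
        then show ?thesis by (intro exI[of _ "{?H}"]) blast
      next
        case False
        then obtain A B where AB: "submodule A R ?H" "submodule B R ?H" "A <+>\<^bsub>?H\<^esub> B = carrier ?H"
          "A \<inter> B = {\<zero>\<^bsub>?H\<^esub>}" "A \<noteq> {\<zero>\<^bsub>W\<^esub>}" "B \<noteq> {\<zero>\<^bsub>W\<^esub>}"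
          using H0 unfolding indecomposable_module_def by auto
        have A: "submodule A R W" "A \<subseteq> H" and B: "submodule B R W" "B \<subseteq> H"
          using AB(1,2) W.submodule_of_submodule[OF H] by blast+
        have "A \<noteq> H" "B \<noteq> H" using AB(4-6) A(2) B(2) by auto
        then have "?Q A" "?Q B" using IH[OF A(1)] IH[OF B(1)] A(2) B(2) by (metis psubsetI)+
        then obtain As Bs :: "('a, 'w, 'd) module_scheme set" where AB': "finite As" "finite Bs"
          "\<And>V. V \<in> fg_indec_modules R \<Longrightarrow> lmod_summand R V (W\<lparr>carrier := A\<rparr>) \<Longrightarrow> \<exists>Z\<in>As. lmod_iso R V Z"
          "\<And>V. V \<in> fg_indec_modules R \<Longrightarrow> lmod_summand R V (W\<lparr>carrier := B\<rparr>) \<Longrightarrow> \<exists>Z\<in>Bs. lmod_iso R V Z"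
          by blast
        have "\<exists>Z\<in>As \<union> Bs. lmod_iso R V Z" if V: "V \<in> fg_indec_modules R" "lmod_summand R V ?H" for V
        proof -
          have "lmod_summand R V (?H\<lparr>carrier := A\<rparr>) \<or> lmod_summand R V (?H\<lparr>carrier := B\<rparr>)"
            using summand_direct_sum[OF _ _ _ H.left_module_axioms V(2) AB(1-4)] V(1)
            by (auto simp: fg_indec_modules_def)
          then show ?thesis using AB'(3,4)[OF V(1)] by auto
        qed
        then show ?thesis using AB'(1,2) by (intro exI[of _ "As \<union> Bs"]) auto
      qed
    qed
  qed
  then show ?thesis by simp
qed

section \<open>Representatives of isomorphism classes\<close>

text \<open>The modules in \<open>Zs\<close> may have any carrier type. A class is recovered from
  \<open>Z\<close> as the set of all members of \<open>fg_indec_modules R\<close> isomorphic to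
  \<open>Z\<close>.\<close>

lemma finite_representation_typeI:
  assumes fin: "finite Zs" and iso: "\<And>V. V \<in> fg_indec_modules R \<Longrightarrow> \<exists>Z\<in>Zs. lmod_iso R V Z"
  shows "finite_representation_type R"
proof -
  let ?r = "{(M, N). M \<in> fg_indec_modules R \<and> N \<in> fg_indec_modules R \<and> lmod_iso R M N}"
  have "fg_indec_modules R // ?r \<subseteq> (\<lambda>Z. {N \<in> fg_indec_modules R. lmod_iso R N Z}) ` Zs"
  proof
    fix c assume "c \<in> fg_indec_modules R // ?r"
    then obtain V where V: "V \<in> fg_indec_modules R" "c = ?r `` {V}" by (auto simp: quotient_def)
    obtain Z where Z: "Z \<in> Zs" "lmod_iso R V Z" using iso[OF V(1)] by blast
    have lm: "N \<in> fg_indec_modules R \<Longrightarrow> left_module R N" for N by (simp add: fg_indec_modules_def)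
    have "lmod_iso R V N \<longleftrightarrow> lmod_iso R N Z" if "N \<in> fg_indec_modules R" for N
    proof
      assume "lmod_iso R V N"
      then show "lmod_iso R N Z" by (rule lmod_iso_trans[OF lmod_iso_sym[OF lm[OF V(1)]] Z(2)])
    next
      assume "lmod_iso R N Z"
      then show "lmod_iso R V N" by (rule lmod_iso_trans[OF Z(2) lmod_iso_sym[OF lm[OF that]]])
    qed
    then have "c = {N \<in> fg_indec_modules R. lmod_iso R N Z}" using V by auto
    then show "c \<in> (\<lambda>Z. {N \<in> fg_indec_modules R. lmod_iso R N Z}) ` Zs" using Z(1) by blast
  qed
  then show ?thesis unfolding finite_representation_type_def by (rule finite_subset) (simp add: fin)
qed

lemma finite_representation_typeD:
  assumes "finite_representation_type R"
  obtains Vs where "finite Vs" "Vs \<subseteq> fg_indec_modules R"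
    "\<And>V. V \<in> fg_indec_modules R \<Longrightarrow> \<exists>U\<in>Vs. lmod_iso R V U"
proof -
  let ?r = "{(M, N). M \<in> fg_indec_modules R \<and> N \<in> fg_indec_modules R \<and> lmod_iso R M N}"
  let ?Vs = "(\<lambda>c. SOME U. U \<in> c) ` (fg_indec_modules R // ?r)"
  have "(SOME U. U \<in> ?r `` {V}) \<in> fg_indec_modules R \<and> lmod_iso R V (SOME U. U \<in> ?r `` {V})"
    if "V \<in> fg_indec_modules R" for V
  proof -
    have "lmod_iso R V V" unfolding lmod_iso_def using lmod_hom_id[of R V]
      by (rule bexI[rotated]) (simp add: bij_betw_def)
    then have "V \<in> ?r `` {V}" using that by simp
    then have "(SOME U. U \<in> ?r `` {V}) \<in> ?r `` {V}" by (rule someI)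
    moreover have "U \<in> fg_indec_modules R \<and> lmod_iso R V U" if "U \<in> ?r `` {V}" for U
      using that by auto
    ultimately show ?thesis by blast
  qed
  note some = this
  show thesis
  proof
    show "finite ?Vs" using assms unfolding finite_representation_type_def by simp
    show "?Vs \<subseteq> fg_indec_modules R" using some by (auto simp: quotient_def)
    show "\<exists>U\<in>?Vs. lmod_iso R V U" if "V \<in> fg_indec_modules R" for V
      using some[OF that] quotientI[OF that, of ?r] by blast
  qed
qed

section \<open>Bimodules and their homomorphisms\<close>

lemma additive_finsum:
  assumes M: "abelian_monoid M" and N: "abelian_monoid N"
    and h: "\<And>x. x \<in> carrier M \<Longrightarrow> h x \<in> carrier N" "h \<zero>\<^bsub>M\<^esub> = \<zero>\<^bsub>N\<^esub>"
      "\<And>x y. \<lbrakk>x \<in> carrier M; y \<in> carrier M\<rbrakk> \<Longrightarrow> h (x \<oplus>\<^bsub>M\<^esub> y) = h x \<oplus>\<^bsub>N\<^esub> h y"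
    and "finite I" "f \<in> I \<rightarrow> carrier M"
  shows "h (\<Oplus>\<^bsub>M\<^esub>i\<in>I. f i) = (\<Oplus>\<^bsub>N\<^esub>i\<in>I. h (f i))"
proof -
  interpret M: abelian_monoid M by fact
  interpret N: abelian_monoid N by fact
  show ?thesis
    using assms(6,7)
  proof (induction I)
    case (insert i I)
    then have "f \<in> I \<rightarrow> carrier M" "f i \<in> carrier M" by auto
    with insert h show ?case by (simp add: Pi_def)
  qed (simp add: h)
qed

lemma (in abelian_monoid) finsum_swap:
  assumes "finite I" "finite J" "\<And>i j. i \<in> I \<Longrightarrow> j \<in> J \<Longrightarrow> f i j \<in> carrier G"
  shows "(\<Oplus>i\<in>I. \<Oplus>j\<in>J. f i j) = (\<Oplus>j\<in>J. \<Oplus>i\<in>I. f i j)"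
  using assms(1,3)
proof (induction I)
  case (insert i I)
  have cl: "f i \<in> J \<rightarrow> carrier G" "(\<lambda>j. \<Oplus>i\<in>I. f i j) \<in> J \<rightarrow> carrier G"
    "(\<lambda>i. \<Oplus>j\<in>J. f i j) \<in> I \<rightarrow> carrier G" "(\<Oplus>j\<in>J. f i j) \<in> carrier G"
    using insert.prems by (auto intro!: finsum_closed)
  have "(\<Oplus>i'\<in>insert i I. \<Oplus>j\<in>J. f i' j) = (\<Oplus>j\<in>J. f i j) \<oplus> (\<Oplus>j\<in>J. \<Oplus>i\<in>I. f i j)"
    using insert cl by simp
  also have "\<dots> = (\<Oplus>j\<in>J. f i j \<oplus> (\<Oplus>i\<in>I. f i j))"
    by (rule finsum_addf[symmetric]) (use cl in auto)
  also have "\<dots> = (\<Oplus>j\<in>J. \<Oplus>i'\<in>insert i I. f i' j)"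
    by (rule finsum_cong') (use insert in \<open>auto intro!: finsum_closed simp: Pi_def\<close>)
  finally show ?case .
qed simp

lemma right_part_simps [simp]:
  "carrier (right_part M) = carrier M" "\<zero>\<^bsub>right_part M\<^esub> = \<zero>\<^bsub>M\<^esub>"
  "x \<oplus>\<^bsub>right_part M\<^esub> y = x \<oplus>\<^bsub>M\<^esub> y" "r \<odot>\<^bsub>right_part M\<^esub> x = x \<odot>\<^sub>r\<^bsub>M\<^esub> r"
  by (simp_all add: right_part_def)

lemma op_ring_simps [simp]:
  "carrier (op_ring R) = carrier R" "\<zero>\<^bsub>op_ring R\<^esub> = \<zero>\<^bsub>R\<^esub>" "\<one>\<^bsub>op_ring R\<^esub> = \<one>\<^bsub>R\<^esub>"
  "x \<oplus>\<^bsub>op_ring R\<^esub> y = x \<oplus>\<^bsub>R\<^esub> y" "x \<otimes>\<^bsub>op_ring R\<^esub> y = y \<otimes>\<^bsub>R\<^esub> x"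
  by (simp_all add: op_ring_def)

lemma finsum_right_part: "finsum (right_part M) = finsum M"
  by (simp add: finsum_def[abs_def] finprod_def[abs_def] right_part_def fun_eq_iff)

context bimodule
begin

lemma rsmult_closed [simp, intro]:
  "x \<in> carrier M \<Longrightarrow> r \<in> carrier R \<Longrightarrow> x \<odot>\<^sub>r\<^bsub>M\<^esub> r \<in> carrier M"
  using right.smult_closed[of r x] by simp

lemma rsmult_distr:
  "x \<in> carrier M \<Longrightarrow> y \<in> carrier M \<Longrightarrow> r \<in> carrier R \<Longrightarrow>
    (x \<oplus>\<^bsub>M\<^esub> y) \<odot>\<^sub>r\<^bsub>M\<^esub> r = x \<odot>\<^sub>r\<^bsub>M\<^esub> r \<oplus>\<^bsub>M\<^esub> y \<odot>\<^sub>r\<^bsub>M\<^esub> r"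
  "x \<in> carrier M \<Longrightarrow> r \<in> carrier R \<Longrightarrow> s \<in> carrier R \<Longrightarrow>
    x \<odot>\<^sub>r\<^bsub>M\<^esub> (r \<oplus>\<^bsub>R\<^esub> s) = x \<odot>\<^sub>r\<^bsub>M\<^esub> r \<oplus>\<^bsub>M\<^esub> x \<odot>\<^sub>r\<^bsub>M\<^esub> s"
  using right.smult_r_distr[of r x y] right.smult_l_distr[of r s x] by simp_all

lemma rsmult_assoc:
  "x \<in> carrier M \<Longrightarrow> r \<in> carrier R \<Longrightarrow> s \<in> carrier R \<Longrightarrow>
    x \<odot>\<^sub>r\<^bsub>M\<^esub> (r \<otimes>\<^bsub>R\<^esub> s) = (x \<odot>\<^sub>r\<^bsub>M\<^esub> r) \<odot>\<^sub>r\<^bsub>M\<^esub> s"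
  using right.smult_assoc1[of s r x] by simp

lemma rsmult_one [simp]: "x \<in> carrier M \<Longrightarrow> x \<odot>\<^sub>r\<^bsub>M\<^esub> \<one>\<^bsub>R\<^esub> = x"
  using right.smult_one[of x] by simp

end

section \<open>Modules of homomorphisms\<close>

text \<open>Receptacle for the tensor product over \<open>T\<close> of the left dual of
  \<open>N\<close> with \<open>V\<close>, whose element f \<otimes> x acts as n \<mapsto> f(n) x.
  Maps are extensional so that agreement on \<open>N\<close> is equality.\<close>

definition hom_module ::
  "('t, 'b) ring_scheme \<Rightarrow> ('t, 'r, 'n, 'd) bimodule_scheme \<Rightarrow> ('t, 'v, 'e) module_scheme \<Rightarrow>
    ('r, 'n \<Rightarrow> 'v) module"
  where "hom_module T N V =
    \<lparr>carrier = lmod_hom T N V \<inter> extensional (carrier N), monoid.mult = undefined, one = undefined,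
     ring.zero = (\<lambda>n\<in>carrier N. \<zero>\<^bsub>V\<^esub>), add = (\<lambda>g h. \<lambda>n\<in>carrier N. g n \<oplus>\<^bsub>V\<^esub> h n),
     smult = (\<lambda>r h. \<lambda>n\<in>carrier N. h (n \<odot>\<^sub>r\<^bsub>N\<^esub> r))\<rparr>"

lemma hom_module_simps:
  "carrier (hom_module T N V) = lmod_hom T N V \<inter> extensional (carrier N)"
  "\<zero>\<^bsub>hom_module T N V\<^esub> = (\<lambda>n\<in>carrier N. \<zero>\<^bsub>V\<^esub>)"
  "g \<oplus>\<^bsub>hom_module T N V\<^esub> h = (\<lambda>n\<in>carrier N. g n \<oplus>\<^bsub>V\<^esub> h n)"
  "r \<odot>\<^bsub>hom_module T N V\<^esub> h = (\<lambda>n\<in>carrier N. h (n \<odot>\<^sub>r\<^bsub>N\<^esub> r))"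
  by (simp_all add: hom_module_def)

lemma hom_module_eqI:
  assumes "g \<in> carrier (hom_module T N V)" "h \<in> carrier (hom_module T N V)"
    and "\<And>n. n \<in> carrier N \<Longrightarrow> g n = h n"
  shows "g = h"
  using assms by (auto simp: hom_module_simps intro: extensionalityI)

lemma (in bimodule) left_module_hom_module:
  assumes V: "left_module T V"
  shows "left_module R (hom_module T M V)"
proof -
  interpret V: left_module T V by fact
  let ?H = "hom_module T M V"
  have hom: "(\<lambda>n\<in>carrier M. g n) \<in> carrier ?H" if "g \<in> lmod_hom T M V" for g
    using that by (auto simp: hom_module_simps lmod_hom_def)
  have D: "h n \<in> carrier V" "h (n \<oplus>\<^bsub>M\<^esub> n') = h n \<oplus>\<^bsub>V\<^esub> h n'" "h (t \<odot>\<^bsub>M\<^esub> n) = t \<odot>\<^bsub>V\<^esub> h n"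
    if "h \<in> carrier ?H" "n \<in> carrier M" "n' \<in> carrier M" "t \<in> carrier T" for h n n' t
    using that lmod_homD[of h T M V] by (auto simp: hom_module_simps)
  have val: "h n \<in> carrier V" if "h \<in> carrier ?H" "n \<in> carrier M" for h n
    using D(1)[OF that] by blast
  have lh: "h \<in> lmod_hom T M V" if "h \<in> carrier ?H" for h using that by (simp add: hom_module_simps)
  have add: "g \<oplus>\<^bsub>?H\<^esub> h \<in> carrier ?H" if "g \<in> carrier ?H" "h \<in> carrier ?H" for g h
    unfolding hom_module_simps(3) by (rule hom[OF lmod_hom_add[OF V lh lh]]) (use that in auto)
  have smult: "r \<odot>\<^bsub>?H\<^esub> h \<in> carrier ?H" if r: "r \<in> carrier R" and h: "h \<in> carrier ?H" for r h
    unfolding hom_module_simps(4)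
    by (rule hom, rule lmod_homI) (use r lmod_homD[OF lh[OF h]] in \<open>auto simp: rsmult_distr smult_rsmult\<close>)
  have zero: "\<zero>\<^bsub>?H\<^esub> \<in> carrier ?H"
    unfolding hom_module_simps(2) by (rule hom[OF lmod_hom_const_zero[OF V]])
  have "abelian_group ?H"
  proof (rule abelian_groupI)
    fix g h assume gh: "g \<in> carrier ?H" "h \<in> carrier ?H"
    show "g \<oplus>\<^bsub>?H\<^esub> h = h \<oplus>\<^bsub>?H\<^esub> g"
      unfolding hom_module_simps by (rule restrict_ext) (use val gh in \<open>simp add: V.M.a_comm\<close>)
  next
    fix f g h assume "f \<in> carrier ?H" "g \<in> carrier ?H" "h \<in> carrier ?H"
    then show "f \<oplus>\<^bsub>?H\<^esub> g \<oplus>\<^bsub>?H\<^esub> h = f \<oplus>\<^bsub>?H\<^esub> (g \<oplus>\<^bsub>?H\<^esub> h)"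
      unfolding hom_module_simps(3) by (intro restrict_ext) (use val in \<open>simp add: V.M.a_assoc\<close>)
  next
    fix h assume h: "h \<in> carrier ?H"
    show "\<zero>\<^bsub>?H\<^esub> \<oplus>\<^bsub>?H\<^esub> h = h"
      by (rule hom_module_eqI[OF add[OF zero h] h]) (use val[OF h] in \<open>simp add: hom_module_simps\<close>)
    have neg: "h (\<ominus>\<^bsub>M\<^esub> n) \<oplus>\<^bsub>V\<^esub> h n = \<zero>\<^bsub>V\<^esub>" if "n \<in> carrier M" for n
      using lmod_homD(2)[OF lh[OF h], of "\<ominus>\<^bsub>M\<^esub> n" n] that
        lmod_hom_zero[OF left_module_axioms V lh[OF h]] by (simp add: M.l_neg)
    have "(\<lambda>n. h (\<ominus>\<^bsub>M\<^esub> n)) \<in> lmod_hom T M V"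
    proof (rule lmod_homI)
      fix t n assume tn: "t \<in> carrier T" "n \<in> carrier M"
      have "\<ominus>\<^bsub>M\<^esub> (t \<odot>\<^bsub>M\<^esub> n) = t \<odot>\<^bsub>M\<^esub> (\<ominus>\<^bsub>M\<^esub> n)"
        using smult_r_distr[OF tn(1) _ tn(2), of "\<ominus>\<^bsub>M\<^esub> n"] tn by (intro M.minus_equality) (simp_all add: M.l_neg)
      then show "h (\<ominus>\<^bsub>M\<^esub> (t \<odot>\<^bsub>M\<^esub> n)) = t \<odot>\<^bsub>V\<^esub> h (\<ominus>\<^bsub>M\<^esub> n)"
        using lmod_homD(3)[OF lh[OF h] tn(1)] tn by simp
    qed (use lmod_homD(1,2)[OF lh[OF h]] in \<open>simp_all add: M.minus_add\<close>)
    then show "\<exists>g\<in>carrier ?H. g \<oplus>\<^bsub>?H\<^esub> h = \<zero>\<^bsub>?H\<^esub>"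
      by (intro bexI[OF _ hom]) (auto simp: hom_module_simps neg intro!: restrict_ext)
  qed (fact add zero)+
  then show ?thesis
  proof (intro left_module.intro left_module_axioms.intro right_ring.ring_axioms)
    fix r s h assume rs: "r \<in> carrier R" "s \<in> carrier R" and h: "h \<in> carrier ?H"
    show "(r \<oplus>\<^bsub>R\<^esub> s) \<odot>\<^bsub>?H\<^esub> h = r \<odot>\<^bsub>?H\<^esub> h \<oplus>\<^bsub>?H\<^esub> s \<odot>\<^bsub>?H\<^esub> h"
      unfolding hom_module_simps
      by (rule restrict_ext) (use rs lmod_homD(2)[OF lh[OF h]] in \<open>simp add: rsmult_distr\<close>)
    show "(r \<otimes>\<^bsub>R\<^esub> s) \<odot>\<^bsub>?H\<^esub> h = r \<odot>\<^bsub>?H\<^esub> (s \<odot>\<^bsub>?H\<^esub> h)"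
      unfolding hom_module_simps by (rule restrict_ext) (use rs in \<open>simp add: rsmult_assoc\<close>)
  next
    fix h assume h: "h \<in> carrier ?H"
    show "\<one>\<^bsub>R\<^esub> \<odot>\<^bsub>?H\<^esub> h = h"
      by (rule hom_module_eqI[OF smult[OF right_ring.one_closed h] h]) (simp add: hom_module_simps)
  next
    fix r g h assume "r \<in> carrier R" "g \<in> carrier ?H" "h \<in> carrier ?H"
    then show "r \<odot>\<^bsub>?H\<^esub> (g \<oplus>\<^bsub>?H\<^esub> h) = r \<odot>\<^bsub>?H\<^esub> g \<oplus>\<^bsub>?H\<^esub> r \<odot>\<^bsub>?H\<^esub> h"
      unfolding hom_module_simps by (intro restrict_ext) simp
  qed (simp_all add: smult)
qed

lemma (in bimodule) finsum_hom_module: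
  assumes V: "left_module T V" and "finite I" "h \<in> I \<rightarrow> carrier (hom_module T M V)" "n \<in> carrier M"
  shows "(\<Oplus>\<^bsub>hom_module T M V\<^esub>i\<in>I. h i) n = (\<Oplus>\<^bsub>V\<^esub>i\<in>I. h i n)"
proof -
  interpret V: left_module T V by fact
  interpret H: left_module R "hom_module T M V" by (rule left_module_hom_module[OF V])
  show ?thesis
    by (rule additive_finsum[where h = "\<lambda>g. g n", OF H.M.abelian_monoid_axioms V.M.abelian_monoid_axioms _ _ _ assms(2,3)])
      (use assms(4) in \<open>auto simp: hom_module_simps lmod_hom_def\<close>)
qed

lemma lmod_hom_prodI:
  assumes "\<And>x. x \<in> carrier M \<Longrightarrow> h x \<in> carrier (prod_lmod I V)"
    and "\<And>i. i \<in> I \<Longrightarrow> (\<lambda>x. h x i) \<in> lmod_hom R M (V i)"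
    and M: "left_module R M"
  shows "h \<in> lmod_hom R M (prod_lmod I V)"
proof -
  interpret M: left_module R M by fact
  have ext: "h x = (\<lambda>i\<in>I. h x i)" if "x \<in> carrier M" for x
    using assms(1)[OF that] by (auto simp: prod_lmod_simps PiE_iff extensional_def fun_eq_iff)
  show ?thesis
  proof (rule lmod_homI[OF assms(1)])
    fix x y assume xy: "x \<in> carrier M" "y \<in> carrier M"
    have "h (x \<oplus>\<^bsub>M\<^esub> y) = (\<lambda>i\<in>I. h (x \<oplus>\<^bsub>M\<^esub> y) i)" using ext xy by blast
    also have "\<dots> = h x \<oplus>\<^bsub>prod_lmod I V\<^esub> h y"
      unfolding prod_lmod_simps by (rule restrict_ext) (use lmod_homD(2)[OF assms(2)] xy in simp)
    finally show "h (x \<oplus>\<^bsub>M\<^esub> y) = h x \<oplus>\<^bsub>prod_lmod I V\<^esub> h y" .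
  next
    fix a x assume ax: "a \<in> carrier R" "x \<in> carrier M"
    have "h (a \<odot>\<^bsub>M\<^esub> x) = (\<lambda>i\<in>I. h (a \<odot>\<^bsub>M\<^esub> x) i)" using ext ax by blast
    also have "\<dots> = a \<odot>\<^bsub>prod_lmod I V\<^esub> h x"
      unfolding prod_lmod_simps by (rule restrict_ext) (use lmod_homD(3)[OF assms(2)] ax in simp)
    finally show "h (a \<odot>\<^bsub>M\<^esub> x) = a \<odot>\<^bsub>prod_lmod I V\<^esub> h x" .
  qed
qed

text \<open>\<open>finsum\<close> refers to the carrier of its structure, so the two sums are not
  equal by definition.\<close>

lemma finsum_submodule:
  assumes M: "left_module R M" and S: "submodule S R M" and I: "finite I" "f \<in> I \<rightarrow> S"
  shows "(\<Oplus>\<^bsub>M\<lparr>carrier := S\<rparr>\<^esub>i\<in>I. f i) = (\<Oplus>\<^bsub>M\<^esub>i\<in>I. f i)"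
proof -
  interpret M: left_module R M by fact
  interpret S: left_module R "M\<lparr>carrier := S\<rparr>" by (rule M.left_module_submodule[OF S])
  show ?thesis
    by (rule additive_finsum[where h = "\<lambda>x. x", OF S.M.abelian_monoid_axioms M.M.abelian_monoid_axioms _ _ _ I(1)])
      (use I submoduleD(1)[OF S] in auto)
qed

section \<open>A substitute for the tensor product\<close>

text \<open>\<open>tensor_image\<close> is the image of \<open>N \<otimes>\<^sub>R U\<close> in the product of all its targets: by adjunction,
  the linear maps \<open>N \<otimes>\<^sub>R U \<rightarrow> V\<close> are the linear maps \<open>U \<rightarrow> Hom(N, V)\<close>, and \<open>V\<close> ranges over the
  modules carried by sets of type \<^typ>\<open>(nat \<Rightarrow> 't) set\<close>.\<close>

definition hom_tests ::
  "('t, 'b) ring_scheme \<Rightarrow> ('r, 'c) ring_scheme \<Rightarrow> ('t, 'r, 'n, 'd) bimodule_scheme \<Rightarrow>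
    ('r, 'u, 'e) module_scheme \<Rightarrow> (('t, (nat \<Rightarrow> 't) set) module \<times> ('u \<Rightarrow> 'n \<Rightarrow> (nat \<Rightarrow> 't) set)) set"
  where "hom_tests T R N U = {(V, s). left_module T V \<and> s \<in> lmod_hom R U (hom_module T N V)}"

definition pure_tensor ::
  "('t, 'b) ring_scheme \<Rightarrow> ('r, 'c) ring_scheme \<Rightarrow> ('t, 'r, 'n, 'd) bimodule_scheme \<Rightarrow>
    ('r, 'u, 'e) module_scheme \<Rightarrow> 'n \<Rightarrow> 'u \<Rightarrow>
    ('t, (nat \<Rightarrow> 't) set) module \<times> ('u \<Rightarrow> 'n \<Rightarrow> (nat \<Rightarrow> 't) set) \<Rightarrow> (nat \<Rightarrow> 't) set"
  where "pure_tensor T R N U n u = (\<lambda>p\<in>hom_tests T R N U. snd p u n)"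

definition tensor_image ::
  "('t, 'b) ring_scheme \<Rightarrow> ('r, 'c) ring_scheme \<Rightarrow> ('t, 'r, 'n, 'd) bimodule_scheme \<Rightarrow>
    ('r, 'u, 'e) module_scheme \<Rightarrow>
    ('t, ('t, (nat \<Rightarrow> 't) set) module \<times> ('u \<Rightarrow> 'n \<Rightarrow> (nat \<Rightarrow> 't) set) \<Rightarrow> (nat \<Rightarrow> 't) set) module"
  where "tensor_image T R N U =
    (let P = prod_lmod (hom_tests T R N U) fst in
      P\<lparr>carrier := lmod_span T P {pure_tensor T R N U n u | n u. n \<in> carrier N \<and> u \<in> carrier U}\<rparr>)"

context bimodule
begin

lemma left_module_hom_tests: "left_module T (prod_lmod (hom_tests T R M U) fst)"
  by (rule left_module_prod_lmod) (auto simp: hom_tests_def R.ring_axioms)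

lemma hom_testsD:
  assumes "p \<in> hom_tests T R M U"
  shows "left_module T (fst p)" "snd p \<in> lmod_hom R U (hom_module T M (fst p))"
    "u \<in> carrier U \<Longrightarrow> snd p u \<in> lmod_hom T M (fst p)"
proof -
  show 1: "left_module T (fst p)" and 2: "snd p \<in> lmod_hom R U (hom_module T M (fst p))"
    using assms by (auto simp: hom_tests_def)
  show "snd p u \<in> lmod_hom T M (fst p)" if "u \<in> carrier U"
    using lmod_homD(1)[OF 2 that] by (simp add: hom_module_simps)
qed

lemma pure_tensor_closed:
  "n \<in> carrier M \<Longrightarrow> u \<in> carrier U \<Longrightarrow>
    pure_tensor T R M U n u \<in> carrier (prod_lmod (hom_tests T R M U) fst)"
  using lmod_homD(1)[OF hom_testsD(3)] by (auto simp: pure_tensor_def prod_lmod_simps)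

lemma pure_tensor_hom:
  assumes u: "u \<in> carrier U"
  shows "(\<lambda>n. pure_tensor T R M U n u) \<in> lmod_hom T M (prod_lmod (hom_tests T R M U) fst)"
proof (rule lmod_hom_prodI[OF pure_tensor_closed[OF _ u] _ left_module_axioms])
  show "(\<lambda>n. pure_tensor T R M U n u p) \<in> lmod_hom T M (fst p)" if "p \<in> hom_tests T R M U" for p
    using hom_testsD(3)[OF that u] that by (simp add: pure_tensor_def)
qed

text \<open>Balancedness is built into the tests: each is linear into Hom_T(M, V), where
  \<open>r\<close> acts through the right action on \<open>M\<close>.\<close>

lemma pure_tensor_right:
  assumes U: "left_module R U" and n: "n \<in> carrier M"
  shows "pure_tensor T R M U n \<zero>\<^bsub>U\<^esub> = \<zero>\<^bsub>prod_lmod (hom_tests T R M U) fst\<^esub>"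
    and "\<lbrakk>u \<in> carrier U; v \<in> carrier U\<rbrakk> \<Longrightarrow> pure_tensor T R M U n (u \<oplus>\<^bsub>U\<^esub> v) =
      pure_tensor T R M U n u \<oplus>\<^bsub>prod_lmod (hom_tests T R M U) fst\<^esub> pure_tensor T R M U n v"
    and "\<lbrakk>r \<in> carrier R; u \<in> carrier U\<rbrakk> \<Longrightarrow>
      pure_tensor T R M U n (r \<odot>\<^bsub>U\<^esub> u) = pure_tensor T R M U (n \<odot>\<^sub>r\<^bsub>M\<^esub> r) u"
proof -
  show "pure_tensor T R M U n \<zero>\<^bsub>U\<^esub> = \<zero>\<^bsub>prod_lmod (hom_tests T R M U) fst\<^esub>"
    unfolding pure_tensor_def prod_lmod_simps
  proof (rule restrict_ext)
    fix p assume p: "p \<in> hom_tests T R M U"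
    show "snd p \<zero>\<^bsub>U\<^esub> n = \<zero>\<^bsub>fst p\<^esub>"
      using lmod_hom_zero[OF U left_module_hom_module[OF hom_testsD(1)[OF p]] hom_testsD(2)[OF p]] n
      by (simp add: hom_module_simps)
  qed
  show "pure_tensor T R M U n (u \<oplus>\<^bsub>U\<^esub> v) =
      pure_tensor T R M U n u \<oplus>\<^bsub>prod_lmod (hom_tests T R M U) fst\<^esub> pure_tensor T R M U n v"
    if uv: "u \<in> carrier U" "v \<in> carrier U"
    unfolding pure_tensor_def prod_lmod_simps
  proof (rule restrict_ext)
    fix p assume p: "p \<in> hom_tests T R M U"
    show "snd p (u \<oplus>\<^bsub>U\<^esub> v) n = (\<lambda>p\<in>hom_tests T R M U. snd p u n) p \<oplus>\<^bsub>fst p\<^esub> (\<lambda>p\<in>hom_tests T R M U. snd p v n) p"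
      using lmod_homD(2)[OF hom_testsD(2)[OF p] uv] n p by (simp add: hom_module_simps)
  qed
  show "pure_tensor T R M U n (r \<odot>\<^bsub>U\<^esub> u) = pure_tensor T R M U (n \<odot>\<^sub>r\<^bsub>M\<^esub> r) u"
    if ru: "r \<in> carrier R" "u \<in> carrier U"
    unfolding pure_tensor_def
  proof (rule restrict_ext)
    fix p assume p: "p \<in> hom_tests T R M U"
    show "snd p (r \<odot>\<^bsub>U\<^esub> u) n = snd p u (n \<odot>\<^sub>r\<^bsub>M\<^esub> r)"
      using lmod_homD(3)[OF hom_testsD(2)[OF p] ru] n by (simp add: hom_module_simps)
  qed
qed

text \<open>Tensors of generators of the two factors generate, which is shown one factor at a
  time.\<close>

lemma tensor_image:
  assumes fgM: "fin_gen_module T M" and U: "left_module R U" and fgU: "fin_gen_module R U"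
  shows "left_module T (tensor_image T R M U)" and "fin_gen_module T (tensor_image T R M U)"
proof -
  interpret U: left_module R U by fact
  let ?P = "prod_lmod (hom_tests T R M U) fst" and ?t = "pure_tensor T R M U"
  interpret P: left_module T ?P by (rule left_module_hom_tests)
  let ?G = "{?t n u | n u. n \<in> carrier M \<and> u \<in> carrier U}"
  have G: "?G \<subseteq> carrier ?P" by (auto intro!: pure_tensor_closed)
  obtain A where A: "finite A" "A \<subseteq> carrier M" "\<And>S. submodule S T M \<Longrightarrow> A \<subseteq> S \<Longrightarrow> S = carrier M"
    using fgM unfolding fin_gen_module_iff by blast
  obtain B where B: "finite B" "B \<subseteq> carrier U" "\<And>S. submodule S R U \<Longrightarrow> B \<subseteq> S \<Longrightarrow> S = carrier U"
    using fgU unfolding U.fin_gen_module_iff by blast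
  let ?gens = "(\<lambda>(n, u). ?t n u) ` (A \<times> B)"
  have gens: "?gens \<subseteq> ?G" using A(2) B(2) by auto
  have all: "lmod_span T ?P ?G \<subseteq> S" if S: "submodule S T ?P" "?gens \<subseteq> S" for S
  proof -
    have 1: "?t n u \<in> S" if u: "u \<in> B" and n: "n \<in> carrier M" for n u
    proof -
      have uU: "u \<in> carrier U" using u B(2) by blast
      have "{n \<in> carrier M. ?t n u \<in> S} = carrier M"
        by (rule A(3)[OF submodule_vimage[OF left_module_axioms P.left_module_axioms pure_tensor_hom[OF uU] S(1)]])
          (use S(2) A(2) u in auto)
      then show ?thesis using n by blast
    qed
    \<comment> \<open>The condition ranges over all of \<open>M\<close>, because moving a scalar
      \<open>r\<close> from the second factor to the first replaces \<open>n\<close> by n r.\<close>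
    have "{u \<in> carrier U. \<forall>n\<in>carrier M. ?t n u \<in> S} = carrier U"
    proof (rule B(3))
      show "submodule {u \<in> carrier U. \<forall>n\<in>carrier M. ?t n u \<in> S} R U"
        by (rule U.submoduleI) (auto simp: pure_tensor_right[OF U] submoduleD[OF S(1)])
    qed (use 1 B(2) in auto)
    then have "?G \<subseteq> S" by blast
    then show ?thesis by (rule lmod_span_least[OF S(1)])
  qed
  have span: "submodule (lmod_span T ?P ?G) T ?P" by (rule P.lmod_span(1)[OF G])
  have eq: "tensor_image T R M U = ?P\<lparr>carrier := lmod_span T ?P ?G\<rparr>" by (simp add: tensor_image_def Let_def)
  show lm: "left_module T (tensor_image T R M U)"
    unfolding eq by (rule P.left_module_submodule[OF span])
  show "fin_gen_module T (tensor_image T R M U)"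
    unfolding left_module.fin_gen_module_iff[OF lm]
  proof (intro exI[of _ ?gens] conjI allI impI)
    show "finite ?gens" using A(1) B(1) by simp
    show "?gens \<subseteq> carrier (tensor_image T R M U)" using gens P.lmod_span(2)[OF G] unfolding eq by auto
    show "S = carrier (tensor_image T R M U)" if S: "submodule S T (tensor_image T R M U) \<and> ?gens \<subseteq> S" for S
    proof -
      have "submodule S T ?P" "S \<subseteq> lmod_span T ?P ?G"
        using S unfolding eq P.submodule_of_submodule[OF span] by blast+
      then show ?thesis using all[of S] S unfolding eq by simp
    qed
  qed
qed

end

section \<open>Casimir systems\<close>

text \<open>The element \<open>\<Sum> \<nu>\<^sub>j \<otimes> f\<^sub>j\<close> of \<open>N \<otimes>\<^sub>R \<^sup>*N\<close> is central and evaluates to \<open>1\<close>; \<open>\<alpha> t\<close> is the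
  matrix by which \<open>t\<close> acts on the \<open>\<nu>\<^sub>j\<close> from the left and on the \<open>f\<^sub>j\<close> from the right. In
  particular the \<open>R\<close>-span of the \<open>f\<^sub>j\<close> is a finitely generated sub-bimodule of \<open>\<^sup>*N\<close>, although
  \<open>\<^sup>*N\<close> itself need not be known to be finitely generated over \<open>R\<close>.\<close>

locale casimir_system = bimodule T R N
  for T :: "('t, 'b) ring_scheme" (structure) and R :: "('r, 'c) ring_scheme" (structure)
    and N :: "('t, 'r, 'n, 'd) bimodule_scheme" (structure) +
  fixes J :: "'j set" and \<nu> :: "'j \<Rightarrow> 'n" and f :: "'j \<Rightarrow> 'n \<Rightarrow> 't" and \<alpha> :: "'t \<Rightarrow> 'j \<Rightarrow> 'j \<Rightarrow> 'r"
  assumes finite_J: "finite J"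
    and \<nu>: "j \<in> J \<Longrightarrow> \<nu> j \<in> carrier N"
    and f: "j \<in> J \<Longrightarrow> f j \<in> lmod_hom T N (regular_bimodule T)"
    and \<alpha>: "\<lbrakk>t \<in> carrier T; i \<in> J; j \<in> J\<rbrakk> \<Longrightarrow> \<alpha> t i j \<in> carrier R"
    and f_\<nu>: "(\<Oplus>j\<in>J. f j (\<nu> j)) = \<one>"
    and smult_\<nu>: "\<lbrakk>t \<in> carrier T; l \<in> J\<rbrakk> \<Longrightarrow> t \<odot>\<^bsub>N\<^esub> \<nu> l = (\<Oplus>\<^bsub>N\<^esub>j\<in>J. \<nu> j \<odot>\<^sub>r\<^bsub>N\<^esub> \<alpha> t j l)"
    and f_mult: "\<lbrakk>t \<in> carrier T; j \<in> J; n \<in> carrier N\<rbrakk> \<Longrightarrow>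
      f j n \<otimes> t = (\<Oplus>l\<in>J. f l (n \<odot>\<^sub>r\<^bsub>N\<^esub> \<alpha> t j l))"
begin

text \<open>The image of f_j \<otimes> x in Hom_T(N, V).\<close>

definition component :: "('t, 'v, 'z) module_scheme \<Rightarrow> 'j \<Rightarrow> 'v \<Rightarrow> 'n \<Rightarrow> 'v"
  where "component V j x = (\<lambda>n\<in>carrier N. f j n \<odot>\<^bsub>V\<^esub> x)"

lemma f_simps:
  assumes "j \<in> J" "n \<in> carrier N"
  shows "f j n \<in> carrier T"
    and "n' \<in> carrier N \<Longrightarrow> f j (n \<oplus>\<^bsub>N\<^esub> n') = f j n \<oplus> f j n'"
    and "t \<in> carrier T \<Longrightarrow> f j (t \<odot>\<^bsub>N\<^esub> n) = t \<otimes> f j n"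
  using lmod_homD[OF f[OF assms(1)]] assms(2) by (simp_all add: regular_bimodule_def)

lemma component_closed:
  assumes V: "left_module T V" and jx: "j \<in> J" "x \<in> carrier V"
  shows "component V j x \<in> carrier (hom_module T N V)"
proof -
  interpret V: left_module T V by fact
  have "(\<lambda>n. f j n \<odot>\<^bsub>V\<^esub> x) \<in> lmod_hom T N V"
    by (rule lmod_homI) (use f_simps jx in \<open>simp_all add: V.smult_l_distr V.smult_assoc1\<close>)
  then show ?thesis by (auto simp: component_def hom_module_simps lmod_hom_def)
qed

lemma component_add:
  assumes V: "left_module T V" and jx: "j \<in> J" "x \<in> carrier V" "x' \<in> carrier V"
  shows "component V j (x \<oplus>\<^bsub>V\<^esub> x') = component V j x \<oplus>\<^bsub>hom_module T N V\<^esub> component V j x'"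
proof -
  interpret V: left_module T V by fact
  show ?thesis
    unfolding component_def hom_module_simps by (rule restrict_ext) (use f_simps jx in \<open>simp add: V.smult_r_distr\<close>)
qed

text \<open>In terms of tensors, f_j \<otimes> t x = f_j t \<otimes> x, and f_j t is an
  \<open>R\<close>-combination of the f_l. Hence the components of generators of \<open>V\<close>
  span all components over \<open>R\<close>.\<close>

lemma component_smult:
  assumes V: "left_module T V" and j: "j \<in> J" and x: "x \<in> carrier V" and t: "t \<in> carrier T"
  shows "component V j (t \<odot>\<^bsub>V\<^esub> x) = (\<Oplus>\<^bsub>hom_module T N V\<^esub>l\<in>J. \<alpha> t j l \<odot>\<^bsub>hom_module T N V\<^esub> component V l x)"
proof -
  interpret V: left_module T V by fact
  interpret H: left_module R "hom_module T N V" by (rule left_module_hom_module[OF V])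
  have cl: "(\<lambda>l. \<alpha> t j l \<odot>\<^bsub>hom_module T N V\<^esub> component V l x) \<in> J \<rightarrow> carrier (hom_module T N V)"
    using \<alpha>[OF t j] component_closed[OF V _ x] by auto
  show ?thesis
  proof (rule hom_module_eqI)
    show "component V j (t \<odot>\<^bsub>V\<^esub> x) \<in> carrier (hom_module T N V)" by (rule component_closed[OF V j]) (use t x in auto)
    show "(\<Oplus>\<^bsub>hom_module T N V\<^esub>l\<in>J. \<alpha> t j l \<odot>\<^bsub>hom_module T N V\<^esub> component V l x) \<in> carrier (hom_module T N V)"
      by (rule H.M.finsum_closed[OF cl])
    fix n assume n: "n \<in> carrier N"
    have "component V j (t \<odot>\<^bsub>V\<^esub> x) n = (f j n \<otimes> t) \<odot>\<^bsub>V\<^esub> x"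
      using n f_simps(1)[OF j n] t x by (simp add: component_def V.smult_assoc1)
    also have "\<dots> = (\<Oplus>l\<in>J. f l (n \<odot>\<^sub>r\<^bsub>N\<^esub> \<alpha> t j l)) \<odot>\<^bsub>V\<^esub> x"
      using f_mult[OF t j n] by simp
    also have "\<dots> = (\<Oplus>\<^bsub>V\<^esub>l\<in>J. f l (n \<odot>\<^sub>r\<^bsub>N\<^esub> \<alpha> t j l) \<odot>\<^bsub>V\<^esub> x)"
      by (rule additive_finsum[where h = "\<lambda>s. s \<odot>\<^bsub>V\<^esub> x", OF R.abelian_monoid_axioms V.M.abelian_monoid_axioms _ _ _ finite_J])
        (use x f_simps(1) \<alpha>[OF t j] n in \<open>auto simp: V.smult_l_distr\<close>)
    also have "\<dots> = (\<Oplus>\<^bsub>V\<^esub>l\<in>J. (\<alpha> t j l \<odot>\<^bsub>hom_module T N V\<^esub> component V l x) n)"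
      by (rule V.M.finsum_cong') (use x f_simps(1) \<alpha>[OF t j] n in \<open>auto simp: hom_module_simps component_def\<close>)
    also have "\<dots> = (\<Oplus>\<^bsub>hom_module T N V\<^esub>l\<in>J. \<alpha> t j l \<odot>\<^bsub>hom_module T N V\<^esub> component V l x) n"
      by (rule finsum_hom_module[OF V finite_J cl n, symmetric])
    finally show "component V j (t \<odot>\<^bsub>V\<^esub> x) n = (\<Oplus>\<^bsub>hom_module T N V\<^esub>l\<in>J. \<alpha> t j l \<odot>\<^bsub>hom_module T N V\<^esub> component V l x) n" .
  qed
qed

text \<open>The Casimir element evaluates to \<open>\<one>\<close>, so the trace of the identity is
  the identity of \<open>V\<close>.\<close>

lemma component_sum:
  assumes V: "left_module T V" and x: "x \<in> carrier V"
  shows "(\<Oplus>\<^bsub>V\<^esub>j\<in>J. component V j x (\<nu> j)) = x"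
proof -
  interpret V: left_module T V by fact
  have "(\<Oplus>\<^bsub>V\<^esub>j\<in>J. component V j x (\<nu> j)) = (\<Oplus>\<^bsub>V\<^esub>j\<in>J. f j (\<nu> j) \<odot>\<^bsub>V\<^esub> x)"
    by (rule V.M.finsum_cong') (use x \<nu> f_simps(1) in \<open>auto simp: component_def\<close>)
  also have "\<dots> = (\<Oplus>j\<in>J. f j (\<nu> j)) \<odot>\<^bsub>V\<^esub> x"
    by (rule additive_finsum[where h = "\<lambda>s. s \<odot>\<^bsub>V\<^esub> x", OF R.abelian_monoid_axioms V.M.abelian_monoid_axioms _ _ _ finite_J, symmetric])
      (use x f_simps(1) \<nu> in \<open>auto simp: V.smult_l_distr\<close>)
  finally show ?thesis using x f_\<nu> by simp
qed

text \<open>By adjunction \<open>s\<close> is a \<open>T\<close>-linear map N \<otimes> S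
  \<rightarrow> W, here composed with x \<mapsto> sum of \<nu>_j \<otimes> (f_j \<otimes> x).
  Linearity of the composite over \<open>T\<close> is the centrality of the Casimir element.\<close>

lemma trace_hom:
  assumes V: "left_module T V" and W: "left_module T W"
    and S: "submodule S R (hom_module T N V)" "\<And>j x. j \<in> J \<Longrightarrow> x \<in> carrier V \<Longrightarrow> component V j x \<in> S"
    and s: "s \<in> lmod_hom R ((hom_module T N V)\<lparr>carrier := S\<rparr>) (hom_module T N W)"
  shows "(\<lambda>x. \<Oplus>\<^bsub>W\<^esub>j\<in>J. s (component V j x) (\<nu> j)) \<in> lmod_hom T V W"
proof -
  interpret V: left_module T V by fact
  interpret W: left_module T W by fact
  let ?H = "hom_module T N V" and ?K = "hom_module T N W"
  have H: "left_module R ?H" and K: "left_module R ?K" by (rule left_module_hom_module, fact)+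
  interpret H: left_module R ?H by fact
  interpret K: left_module R ?K by fact
  have HS: "left_module R (?H\<lparr>carrier := S\<rparr>)" by (rule H.left_module_submodule[OF S(1)])
  note sD = lmod_homD[OF s, simplified]
  have sl: "s (component V j x) \<in> lmod_hom T N W" if "j \<in> J" "x \<in> carrier V" for j x
    using sD(1)[OF S(2)[OF that]] by (simp add: hom_module_simps)
  have cl: "s (component V j x) n \<in> carrier W" if "j \<in> J" "x \<in> carrier V" "n \<in> carrier N" for j x n
    using lmod_homD(1)[OF sl[OF that(1,2)] that(3)] .
  show ?thesis
  proof (rule lmod_homI)
    show "(\<Oplus>\<^bsub>W\<^esub>j\<in>J. s (component V j x) (\<nu> j)) \<in> carrier W" if "x \<in> carrier V" for x
      by (rule W.M.finsum_closed) (use cl that \<nu> in auto)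
  next
    fix x x' assume x: "x \<in> carrier V" "x' \<in> carrier V"
    have "s (component V j (x \<oplus>\<^bsub>V\<^esub> x')) (\<nu> j) = s (component V j x) (\<nu> j) \<oplus>\<^bsub>W\<^esub> s (component V j x') (\<nu> j)" if j: "j \<in> J" for j
      using component_add[OF V j x] sD(2)[OF S(2)[OF j x(1)] S(2)[OF j x(2)]] \<nu>[OF j]
      by (simp add: hom_module_simps)
    then have "(\<Oplus>\<^bsub>W\<^esub>j\<in>J. s (component V j (x \<oplus>\<^bsub>V\<^esub> x')) (\<nu> j)) =
        (\<Oplus>\<^bsub>W\<^esub>j\<in>J. s (component V j x) (\<nu> j) \<oplus>\<^bsub>W\<^esub> s (component V j x') (\<nu> j))"
      by (intro W.M.finsum_cong') (use cl x \<nu> in auto)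
    also have "\<dots> = (\<Oplus>\<^bsub>W\<^esub>j\<in>J. s (component V j x) (\<nu> j)) \<oplus>\<^bsub>W\<^esub> (\<Oplus>\<^bsub>W\<^esub>j\<in>J. s (component V j x') (\<nu> j))"
      by (rule W.M.finsum_addf) (use cl x \<nu> in auto)
    finally show "(\<Oplus>\<^bsub>W\<^esub>j\<in>J. s (component V j (x \<oplus>\<^bsub>V\<^esub> x')) (\<nu> j)) =
        (\<Oplus>\<^bsub>W\<^esub>j\<in>J. s (component V j x) (\<nu> j)) \<oplus>\<^bsub>W\<^esub> (\<Oplus>\<^bsub>W\<^esub>j\<in>J. s (component V j x') (\<nu> j))" .
  next
    fix t x assume t: "t \<in> carrier T" and x: "x \<in> carrier V"
    have val: "s (component V j (t \<odot>\<^bsub>V\<^esub> x)) (\<nu> j) = (\<Oplus>\<^bsub>W\<^esub>l\<in>J. s (component V l x) (\<nu> j \<odot>\<^sub>r\<^bsub>N\<^esub> \<alpha> t j l))"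
      if j: "j \<in> J" for j
    proof -
      have inS: "(\<lambda>l. \<alpha> t j l \<odot>\<^bsub>?H\<^esub> component V l x) \<in> J \<rightarrow> S"
        using submoduleD(4)[OF S(1) \<alpha>[OF t j] S(2)[OF _ x]] by auto
      have "s (component V j (t \<odot>\<^bsub>V\<^esub> x)) = s (\<Oplus>\<^bsub>?H\<lparr>carrier := S\<rparr>\<^esub>l\<in>J. \<alpha> t j l \<odot>\<^bsub>?H\<^esub> component V l x)"
        unfolding component_smult[OF V j x t] finsum_submodule[OF H S(1) finite_J inS] ..
      also have "\<dots> = (\<Oplus>\<^bsub>?K\<^esub>l\<in>J. s (\<alpha> t j l \<odot>\<^bsub>?H\<^esub> component V l x))"
        by (rule lmod_hom_finsum[OF HS K s finite_J]) (use inS in simp)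
      also have "\<dots> = (\<Oplus>\<^bsub>?K\<^esub>l\<in>J. \<alpha> t j l \<odot>\<^bsub>?K\<^esub> s (component V l x))"
        by (rule K.M.finsum_cong') (use sD(3)[OF \<alpha>[OF t j] S(2)[OF _ x]] sD(1)[OF S(2)[OF _ x]] \<alpha>[OF t j] in auto)
      finally have "s (component V j (t \<odot>\<^bsub>V\<^esub> x)) (\<nu> j) = (\<Oplus>\<^bsub>?K\<^esub>l\<in>J. \<alpha> t j l \<odot>\<^bsub>?K\<^esub> s (component V l x)) (\<nu> j)"
        by simp
      also have "\<dots> = (\<Oplus>\<^bsub>W\<^esub>l\<in>J. (\<alpha> t j l \<odot>\<^bsub>?K\<^esub> s (component V l x)) (\<nu> j))"
        by (rule finsum_hom_module[OF W finite_J _ \<nu>[OF j]])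
          (use sD(1)[OF S(2)[OF _ x]] \<alpha>[OF t j] in auto)
      also have "\<dots> = (\<Oplus>\<^bsub>W\<^esub>l\<in>J. s (component V l x) (\<nu> j \<odot>\<^sub>r\<^bsub>N\<^esub> \<alpha> t j l))"
        by (rule W.M.finsum_cong') (use cl[OF _ x] \<nu>[OF j] \<alpha>[OF t j] in \<open>auto simp: hom_module_simps\<close>)
      finally show ?thesis .
    qed
    have c2: "s (component V l x) (\<nu> j \<odot>\<^sub>r\<^bsub>N\<^esub> \<alpha> t j l) \<in> carrier W" if "j \<in> J" "l \<in> J" for j l
      using cl[OF that(2) x] \<nu>[OF that(1)] \<alpha>[OF t that] by auto
    have "(\<Oplus>\<^bsub>W\<^esub>j\<in>J. s (component V j (t \<odot>\<^bsub>V\<^esub> x)) (\<nu> j)) =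
        (\<Oplus>\<^bsub>W\<^esub>j\<in>J. \<Oplus>\<^bsub>W\<^esub>l\<in>J. s (component V l x) (\<nu> j \<odot>\<^sub>r\<^bsub>N\<^esub> \<alpha> t j l))"
      by (rule W.M.finsum_cong') (use val c2 in \<open>auto intro!: W.M.finsum_closed\<close>)
    \<comment> \<open>Exchanging the sums lets the matrix of \<open>t\<close>, which came from its
      right action on the f_j, be read as its left action on the \<nu>_l.\<close>
    also have "\<dots> = (\<Oplus>\<^bsub>W\<^esub>l\<in>J. \<Oplus>\<^bsub>W\<^esub>j\<in>J. s (component V l x) (\<nu> j \<odot>\<^sub>r\<^bsub>N\<^esub> \<alpha> t j l))"
      by (rule W.M.finsum_swap[OF finite_J finite_J c2])
    also have "\<dots> = (\<Oplus>\<^bsub>W\<^esub>l\<in>J. t \<odot>\<^bsub>W\<^esub> s (component V l x) (\<nu> l))"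
    proof (rule W.M.finsum_cong'[OF refl])
      show "(\<lambda>l. t \<odot>\<^bsub>W\<^esub> s (component V l x) (\<nu> l)) \<in> J \<rightarrow> carrier W" using t cl[OF _ x \<nu>] by auto
      fix l assume l: "l \<in> J"
      have "(\<Oplus>\<^bsub>W\<^esub>j\<in>J. s (component V l x) (\<nu> j \<odot>\<^sub>r\<^bsub>N\<^esub> \<alpha> t j l)) = s (component V l x) (\<Oplus>\<^bsub>N\<^esub>j\<in>J. \<nu> j \<odot>\<^sub>r\<^bsub>N\<^esub> \<alpha> t j l)"
        by (rule lmod_hom_finsum[OF left_module_axioms W sl[OF l x] finite_J, symmetric])
          (use \<nu> \<alpha>[OF t _ l] in auto)
      also have "\<dots> = t \<odot>\<^bsub>W\<^esub> s (component V l x) (\<nu> l)"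
        unfolding smult_\<nu>[OF t l, symmetric] by (rule lmod_homD(3)[OF sl[OF l x] t \<nu>[OF l]])
      finally show "(\<Oplus>\<^bsub>W\<^esub>j\<in>J. s (component V l x) (\<nu> j \<odot>\<^sub>r\<^bsub>N\<^esub> \<alpha> t j l)) = t \<odot>\<^bsub>W\<^esub> s (component V l x) (\<nu> l)" .
    qed
    also have "\<dots> = t \<odot>\<^bsub>W\<^esub> (\<Oplus>\<^bsub>W\<^esub>l\<in>J. s (component V l x) (\<nu> l))"
      by (rule W.smult_finsum[symmetric, OF t finite_J]) (use cl x \<nu> in auto)
    finally show "(\<Oplus>\<^bsub>W\<^esub>j\<in>J. s (component V j (t \<odot>\<^bsub>V\<^esub> x)) (\<nu> j)) = t \<odot>\<^bsub>W\<^esub> (\<Oplus>\<^bsub>W\<^esub>j\<in>J. s (component V j x) (\<nu> j))" .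
  qed
qed

text \<open>The maps are V \<rightarrow> N \<otimes> U, sending x to the sum of \<nu>_j \<otimes>
  a(f_j \<otimes> x), and the map N \<otimes> U \<rightarrow> V adjoint to \<open>b\<close>; their
  composite is the trace of \<open>b\<close> after \<open>a\<close>.\<close>

lemma summand_tensor_image:
  fixes V :: "('t, (nat \<Rightarrow> 't) set) module"
  assumes V: "left_module T V" and U: "left_module R U"
    and S: "submodule S R (hom_module T N V)" "\<And>j x. j \<in> J \<Longrightarrow> x \<in> carrier V \<Longrightarrow> component V j x \<in> S"
    and a: "a \<in> lmod_hom R ((hom_module T N V)\<lparr>carrier := S\<rparr>) U"
    and b: "b \<in> lmod_hom R U (hom_module T N V)"
    and bij: "bij_betw (\<lambda>x. \<Oplus>\<^bsub>V\<^esub>j\<in>J. b (a (component V j x)) (\<nu> j)) (carrier V) (carrier V)"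
  shows "lmod_summand T V (tensor_image T R N U)"
proof -
  let ?P = "prod_lmod (hom_tests T R N U) fst" and ?t = "pure_tensor T R N U"
  interpret P: left_module T ?P by (rule left_module_hom_tests)
  let ?G = "{?t n u | n u. n \<in> carrier N \<and> u \<in> carrier U}"
  have G: "?G \<subseteq> carrier ?P" by (auto intro!: pure_tensor_closed)
  have eq: "tensor_image T R N U = ?P\<lparr>carrier := lmod_span T ?P ?G\<rparr>" by (simp add: tensor_image_def Let_def)
  define u where "u x = (\<Oplus>\<^bsub>?P\<^esub>j\<in>J. ?t (\<nu> j) (a (component V j x)))" for x
  have ay: "a (component V j x) \<in> carrier U" if "j \<in> J" "x \<in> carrier V" for j x
    using lmod_homD(1)[OF a] S(2)[OF that] by simp
  have tG: "(\<lambda>j. ?t (\<nu> j) (a (component V j x))) \<in> J \<rightarrow> ?G" if "x \<in> carrier V" for x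
    using ay that \<nu> by blast
  have u_span: "u x \<in> lmod_span T ?P ?G" if "x \<in> carrier V" for x
    unfolding u_def
    by (rule P.submodule_finsum[OF P.lmod_span(1)[OF G] finite_J]) (use tG[OF that] P.lmod_span(2)[OF G] in blast)
  have u_p: "u x p = (\<Oplus>\<^bsub>fst p\<^esub>j\<in>J. snd p (a (component V j x)) (\<nu> j))"
    if x: "x \<in> carrier V" and p: "p \<in> hom_tests T R N U" for x p
  proof -
    interpret p: left_module T "fst p" by (rule hom_testsD(1)[OF p])
    have "u x p = (\<Oplus>\<^bsub>fst p\<^esub>j\<in>J. ?t (\<nu> j) (a (component V j x)) p)"
      unfolding u_def
      by (rule lmod_hom_finsum[OF P.left_module_axioms p.left_module_axioms prod_lmod_proj[OF p] finite_J])
        (use tG[OF x] G in blast)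
    also have "\<dots> = (\<Oplus>\<^bsub>fst p\<^esub>j\<in>J. snd p (a (component V j x)) (\<nu> j))"
      by (rule p.M.finsum_cong')
        (use p lmod_homD(1)[OF hom_testsD(3)[OF p ay[OF _ x]] \<nu>] in \<open>auto simp: pure_tensor_def\<close>)
    finally show ?thesis .
  qed
  have "u \<in> lmod_hom T V ?P"
  proof (rule lmod_hom_prodI[OF _ _ V])
    show "u x \<in> carrier ?P" if "x \<in> carrier V" for x
      using u_span[OF that] submoduleD(1)[OF P.lmod_span(1)[OF G]] by blast
    show "(\<lambda>x. u x p) \<in> lmod_hom T V (fst p)" if p: "p \<in> hom_tests T R N U" for p
    proof -
      \<comment> \<open>Each coordinate of \<open>u\<close> is a trace, for the composite of
        \<open>a\<close> with the test \<open>snd p\<close>.\<close>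
      have "(\<lambda>x. \<Oplus>\<^bsub>fst p\<^esub>j\<in>J. snd p (a (component V j x)) (\<nu> j)) \<in> lmod_hom T V (fst p)"
        by (rule trace_hom[OF V hom_testsD(1)[OF p] S lmod_hom_comp[OF a hom_testsD(2)[OF p]]])
      then show ?thesis
        using u_p[OF _ p] left_module.submodule_carrier[OF V]
          abelian_monoid.a_closed[of V] left_module.smult_closed[OF V] V
        by (simp add: lmod_hom_def Pi_def left_module_def abelian_group_def)
    qed
  qed
  then have u: "u \<in> lmod_hom T V (tensor_image T R N U)"
    unfolding eq by (rule lmod_hom_corestrict) (use u_span in blast)
  \<comment> \<open>The adjoint of \<open>b\<close> is the projection to the coordinate
    \<open>(V, b)\<close>, which exists because \<open>V\<close> has the carrier type over which the
    tests range.\<close>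
  have q: "(V, b) \<in> hom_tests T R N U" using V b by (simp add: hom_tests_def)
  have v: "(\<lambda>z. z (V, b)) \<in> lmod_hom T (tensor_image T R N U) V"
    unfolding eq
    using lmod_hom_restrict[OF prod_lmod_proj[OF q, of T fst] submoduleD(1)[OF P.lmod_span(1)[OF G]]] by simp
  show ?thesis
  proof (rule lmod_summandI[OF u v], rule iffD1[OF bij_betw_cong bij])
    show "(\<Oplus>\<^bsub>V\<^esub>j\<in>J. b (a (component V j x)) (\<nu> j)) = u x (V, b)" if "x \<in> carrier V" for x
      using u_p[OF that q] by simp
  qed
qed

end

section \<open>Reduction to indecomposable modules over R\<close>

text \<open>If one summand is everything, the other, meeting it in zero, vanishes. The criterion
  suits a minimality argument, which sees only projections adding up to the identity.\<close>

lemma indecomposable_moduleI: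
  fixes W :: "('a, 'w, 'd) module_scheme"
  assumes W: "left_module R W" and nz: "carrier W \<noteq> {\<zero>\<^bsub>W\<^esub>}"
    and min: "\<And>A B p q. \<lbrakk>submodule A R W; submodule B R W; p \<in> lmod_hom R W (W\<lparr>carrier := A\<rparr>);
      q \<in> lmod_hom R W (W\<lparr>carrier := B\<rparr>); \<forall>x\<in>carrier W. p x \<oplus>\<^bsub>W\<^esub> q x = x\<rbrakk> \<Longrightarrow>
      A = carrier W \<or> B = carrier W"
  shows "indecomposable_module R W"
  unfolding indecomposable_module_def
proof (intro conjI allI impI)
  fix A B assume "submodule A R W \<and> submodule B R W \<and> A <+>\<^bsub>W\<^esub> B = carrier W \<and> A \<inter> B = {\<zero>\<^bsub>W\<^esub>}"
  then have A: "submodule A R W" and B: "submodule B R W"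
    and AB: "A <+>\<^bsub>W\<^esub> B = carrier W" "A \<inter> B = {\<zero>\<^bsub>W\<^esub>}" by blast+
  obtain p q where pq: "p \<in> lmod_hom R W (W\<lparr>carrier := A\<rparr>)" "q \<in> lmod_hom R W (W\<lparr>carrier := B\<rparr>)"
    "\<forall>x\<in>carrier W. p x \<oplus>\<^bsub>W\<^esub> q x = x"
    using direct_sum_projections[OF W A B AB] by blast
  show "A = {\<zero>\<^bsub>W\<^esub>} \<or> B = {\<zero>\<^bsub>W\<^esub>}"
    using min[OF A B pq] AB(2) submoduleD(1)[OF A] submoduleD(1)[OF B] by blast
qed (rule nz)

context casimir_system
begin

text \<open>\<open>V\<close> is a summand of \<open>N \<otimes>\<^sub>R S\<close> for the span \<open>S\<close> of the components of the elements of \<open>V\<close>.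
  Instead of decomposing \<open>S\<close>, take \<open>W\<close> minimal among the submodules through which this still
  works: by locality of the endomorphisms of \<open>V\<close> it is indecomposable.\<close>

lemma indecomposable_intermediate:
  fixes V :: "('t, 'v, 'z) module_scheme"
  assumes R: "artin_algebra k R \<phi>" and T: "artin_algebra l T \<psi>"
    and V: "left_module T V" and fgV: "fin_gen_module T V" and indV: "indecomposable_module T V"
  shows "\<exists>S W e. submodule S R (hom_module T N V) \<and> (\<forall>j\<in>J. \<forall>x\<in>carrier V. component V j x \<in> S) \<and>
    submodule W R (hom_module T N V) \<and>
    fin_gen_module R ((hom_module T N V)\<lparr>carrier := W\<rparr>) \<and>
    indecomposable_module R ((hom_module T N V)\<lparr>carrier := W\<rparr>) \<and>
    e \<in> lmod_hom R ((hom_module T N V)\<lparr>carrier := S\<rparr>) ((hom_module T N V)\<lparr>carrier := W\<rparr>) \<and>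
    bij_betw (\<lambda>x. \<Oplus>\<^bsub>V\<^esub>j\<in>J. e (component V j x) (\<nu> j)) (carrier V) (carrier V)"
proof -
  interpret RA: artin_algebra k R \<phi> by (rule R)
  interpret TA: artin_algebra l T \<psi> by (rule T)
  interpret V: left_module T V by fact
  let ?H = "hom_module T N V"
  have H: "left_module R ?H" by (rule left_module_hom_module[OF V])
  interpret H: left_module R ?H by (rule H)
  obtain A where A: "finite A" "A \<subseteq> carrier V" "\<And>S. submodule S T V \<Longrightarrow> A \<subseteq> S \<Longrightarrow> S = carrier V"
    using fgV unfolding V.fin_gen_module_iff by blast
  \<comment> \<open>Components of generators of \<open>V\<close>: there are finitely many, and by
    \<open>component_smult\<close> their span contains every component.\<close>
  let ?gens = "(\<lambda>(j, a). component V j a) ` (J \<times> A)"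
  have gens: "?gens \<subseteq> carrier ?H" using component_closed[OF V] A(2) by auto
  define S where "S = lmod_span R ?H ?gens"
  have S: "submodule S R ?H" unfolding S_def by (rule H.lmod_span(1)[OF gens])
  note SD = submoduleD[OF S]
  let ?S = "?H\<lparr>carrier := S\<rparr>"
  have HS: "left_module R ?S" by (rule H.left_module_submodule[OF S])
  interpret HS: left_module R ?S by (rule HS)
  have fgS: "fin_gen_module R ?S" unfolding S_def by (rule H.fin_gen_lmod_span[OF _ gens]) (use A(1) finite_J in simp)
  have y0: "component V j \<zero>\<^bsub>V\<^esub> = \<zero>\<^bsub>?H\<^esub>" if "j \<in> J" for j
    unfolding component_def hom_module_simps by (rule restrict_ext) (use f_simps(1)[OF that] in simp)
  have "{x \<in> carrier V. \<forall>j\<in>J. component V j x \<in> S} = carrier V"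
  proof (rule A(3))
    show "submodule {x \<in> carrier V. \<forall>j\<in>J. component V j x \<in> S} T V"
    proof (rule V.submoduleI)
      fix t x assume t: "t \<in> carrier T" and x: "x \<in> {x \<in> carrier V. \<forall>j\<in>J. component V j x \<in> S}"
      have "component V j (t \<odot>\<^bsub>V\<^esub> x) \<in> S" if j: "j \<in> J" for j
      proof -
        have "(\<Oplus>\<^bsub>?H\<^esub>i\<in>J. \<alpha> t j i \<odot>\<^bsub>?H\<^esub> component V i x) \<in> S"
          by (rule H.submodule_finsum[OF S finite_J]) (use x SD(4) \<alpha>[OF t j] in auto)
        then show ?thesis using component_smult[OF V j _ t, of x] x by simp
      qed
      then show "t \<odot>\<^bsub>V\<^esub> x \<in> {x \<in> carrier V. \<forall>j\<in>J. component V j x \<in> S}" using t x by auto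
    qed (use SD y0 component_add[OF V] in auto)
    show "A \<subseteq> {x \<in> carrier V. \<forall>j\<in>J. component V j x \<in> S}"
      using A(2) H.lmod_span(2)[OF gens] unfolding S_def by auto
  qed
  then have yS: "component V j x \<in> S" if "j \<in> J" "x \<in> carrier V" for j x using that by auto
  \<comment> \<open>The trace of \<open>e\<close>, that is, the endomorphism of \<open>V\<close>
    factoring through the map that \<open>e\<close> induces on N \<otimes> S.\<close>
  let ?\<theta> = "\<lambda>e x. \<Oplus>\<^bsub>V\<^esub>j\<in>J. e (component V j x) (\<nu> j)"
  have \<theta>: "?\<theta> e \<in> lmod_hom T V V" if "e \<in> lmod_hom R ?S ?S" for e
    using trace_hom[OF V V S yS lmod_hom_incl[OF that]] SD(1) by simp
  let ?B = "\<lambda>e. bij_betw (?\<theta> e) (carrier V) (carrier V)"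
  \<comment> \<open>\<open>W\<close> qualifies if an endomorphism of \<open>S\<close> with values in
    \<open>W\<close> still has a bijective trace, so that \<open>V\<close> remains a summand of N
    \<otimes> W.\<close>
  define Q where "Q W \<longleftrightarrow> submodule W R ?S \<and> (\<exists>e\<in>lmod_hom R ?S ?S. e ` S \<subseteq> W \<and> ?B e)" for W
  have QI: "Q W" if "submodule W R ?S" "e \<in> lmod_hom R ?S ?S" "e ` S \<subseteq> W" "?B e" for W e
    unfolding Q_def using that by (intro conjI bexI[of _ e])
  have "Q S"
    unfolding Q_def
  proof (intro conjI bexI[of _ "\<lambda>x. x"])
    show "submodule S R ?S" using HS.submodule_carrier by simp
    show "?B (\<lambda>x. x)"
      by (rule iffD1[OF bij_betw_cong bij_betw_id[unfolded id_def]]) (simp add: component_sum[OF V])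
  qed (simp_all add: lmod_hom_id)
  then have "\<exists>W. Q W \<and> (\<forall>W'. Q W' \<and> W' \<subseteq> W \<longrightarrow> W' = W)"
    by (rule dcc_module_minimal[OF RA.dcc_fin_gen[OF HS fgS]]) (simp add: Q_def)
  then obtain W where W: "Q W" "\<And>W'. Q W' \<Longrightarrow> W' \<subseteq> W \<Longrightarrow> W' = W" by blast
  then have WS: "submodule W R ?S" unfolding Q_def by blast
  obtain e where e: "e \<in> lmod_hom R ?S ?S" "e ` S \<subseteq> W" "?B e"
    using W(1) unfolding Q_def by blast
  have WH: "submodule W R ?H" "W \<subseteq> S" using WS H.submodule_of_submodule[OF S] by blast+
  let ?W = "?H\<lparr>carrier := W\<rparr>"
  have LW: "left_module R ?W" by (rule H.left_module_submodule[OF WH(1)])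
  have eW: "e \<in> lmod_hom R ?S ?W"
    using lmod_hom_corestrict[OF e(1), of W] e(2) by simp
  have "Q (e ` S)"
    by (rule QI[OF _ e(1) subset_refl e(3)])
      (use submodule_image[OF HS HS e(1) HS.submodule_carrier] in simp)
  \<comment> \<open>Minimality makes \<open>W\<close> the whole image of \<open>e\<close>, hence a
    quotient of \<open>S\<close>. This gives finite generation of a submodule without an ascending
    chain condition.\<close>
  then have eS: "e ` S = W" by (rule W(2)[OF _ e(2)])
  have fgW: "fin_gen_module R ?W"
    by (rule fin_gen_module_image[OF HS LW eW _ fgS]) (simp add: eS)
  have cl: "e (component V j x) (\<nu> j) \<in> carrier V" if "e \<in> lmod_hom R ?S ?S" "j \<in> J" "x \<in> carrier V" for e j x
  proof -
    have "e (component V j x) \<in> carrier ?H"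
      using lmod_homD(1)[OF that(1)] yS[OF that(2,3)] SD(1) by auto
    then show ?thesis using lmod_homD(1)[OF _ \<nu>[OF that(2)]] by (auto simp: hom_module_simps)
  qed
  have "indecomposable_module R ?W"
  proof (rule indecomposable_moduleI[OF LW])
    show "carrier ?W \<noteq> {\<zero>\<^bsub>?W\<^esub>}"
    proof
      assume W0: "carrier ?W = {\<zero>\<^bsub>?W\<^esub>}"
      have "?\<theta> e x = \<zero>\<^bsub>V\<^esub>" if x: "x \<in> carrier V" for x
      proof (rule V.M.add.finprod_one_eqI)
        fix j assume j: "j \<in> J"
        have "e (component V j x) = \<zero>\<^bsub>?H\<^esub>" using e(2) yS[OF j x] W0 by auto
        then show "e (component V j x) (\<nu> j) = \<zero>\<^bsub>V\<^esub>" using \<nu>[OF j] by (simp add: hom_module_simps)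
      qed
      then have "?\<theta> e ` carrier V \<subseteq> {\<zero>\<^bsub>V\<^esub>}" by auto
      then have "carrier V \<subseteq> {\<zero>\<^bsub>V\<^esub>}" using e(3) by (simp add: bij_betw_def)
      then show False using indV unfolding indecomposable_module_def by auto
    qed
  next
    fix A B p q
    assume A: "submodule A R ?W" and B: "submodule B R ?W"
      and p: "p \<in> lmod_hom R ?W (?W\<lparr>carrier := A\<rparr>)" and q: "q \<in> lmod_hom R ?W (?W\<lparr>carrier := B\<rparr>)"
      and pq: "\<forall>x\<in>carrier ?W. p x \<oplus>\<^bsub>?W\<^esub> q x = x"
    have AS: "submodule A R ?S" "A \<subseteq> W" and BS: "submodule B R ?S" "B \<subseteq> W"
      using A B H.submodule_of_submodule[OF WH(1)] H.submodule_of_submodule[OF S] WH(2) by blast+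
    have pe: "(\<lambda>x. p (e x)) \<in> lmod_hom R ?S (?S\<lparr>carrier := A\<rparr>)"
      and qe: "(\<lambda>x. q (e x)) \<in> lmod_hom R ?S (?S\<lparr>carrier := B\<rparr>)"
      using lmod_hom_comp[OF eW p] lmod_hom_comp[OF eW q] by simp_all
    have peS: "(\<lambda>x. p (e x)) \<in> lmod_hom R ?S ?S" and qeS: "(\<lambda>x. q (e x)) \<in> lmod_hom R ?S ?S"
      by (rule lmod_hom_incl[OF pe submoduleD(1)[OF AS(1)]], rule lmod_hom_incl[OF qe submoduleD(1)[OF BS(1)]])
    have pq_val: "e (component V j x) (\<nu> j) = p (e (component V j x)) (\<nu> j) \<oplus>\<^bsub>V\<^esub> q (e (component V j x)) (\<nu> j)"
      if "j \<in> J" "x \<in> carrier V" for j x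
    proof -
      have "e (component V j x) \<in> W" using e(2) yS[OF that] by blast
      then have "p (e (component V j x)) \<oplus>\<^bsub>?H\<^esub> q (e (component V j x)) = e (component V j x)" using pq by simp
      then have "(p (e (component V j x)) \<oplus>\<^bsub>?H\<^esub> q (e (component V j x))) (\<nu> j) = e (component V j x) (\<nu> j)" by simp
      then show ?thesis using \<nu>[OF that(1)] by (simp add: hom_module_simps)
    qed
    \<comment> \<open>The trace is additive, so splitting the identity of \<open>W\<close> splits
      the bijective trace of \<open>e\<close>. Locality leaves one part bijective, and its values
      lie in \<open>A\<close> or in \<open>B\<close>, which by minimality is then
      \<open>W\<close>.\<close>
    have "?\<theta> e x = ?\<theta> (\<lambda>x. p (e x)) x \<oplus>\<^bsub>V\<^esub> ?\<theta> (\<lambda>x. q (e x)) x" if x: "x \<in> carrier V" for x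
    proof -
      have "?\<theta> e x = (\<Oplus>\<^bsub>V\<^esub>j\<in>J. p (e (component V j x)) (\<nu> j) \<oplus>\<^bsub>V\<^esub> q (e (component V j x)) (\<nu> j))"
        by (rule V.M.finsum_cong') (use pq_val[OF _ x] cl[OF peS _ x] cl[OF qeS _ x] in auto)
      also have "\<dots> = ?\<theta> (\<lambda>x. p (e x)) x \<oplus>\<^bsub>V\<^esub> ?\<theta> (\<lambda>x. q (e x)) x"
        by (rule V.M.finsum_addf) (use cl[OF peS _ x] cl[OF qeS _ x] in auto)
      finally show ?thesis .
    qed
    then have "bij_betw (\<lambda>x. ?\<theta> (\<lambda>x. p (e x)) x \<oplus>\<^bsub>V\<^esub> ?\<theta> (\<lambda>x. q (e x)) x) (carrier V) (carrier V)"
      by (rule iffD1[OF bij_betw_cong e(3)])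
    then have "?B (\<lambda>x. p (e x)) \<or> ?B (\<lambda>x. q (e x))"
      by (rule TA.local_endomorphisms[OF V fgV indV \<theta>[OF peS] \<theta>[OF qeS]])
    then have "Q A \<or> Q B"
    proof
      assume "?B (\<lambda>x. p (e x))"
      moreover have "(\<lambda>x. p (e x)) ` S \<subseteq> A" using lmod_homD(1)[OF pe] by auto
      ultimately show ?thesis using QI[OF AS(1) peS] by blast
    next
      assume "?B (\<lambda>x. q (e x))"
      moreover have "(\<lambda>x. q (e x)) ` S \<subseteq> B" using lmod_homD(1)[OF qe] by auto
      ultimately show ?thesis using QI[OF BS(1) qeS] by blast
    qed
    then show "A = carrier ?W \<or> B = carrier ?W" using W(2) AS(2) BS(2) by auto
  qed
  then show ?thesis
    using S yS WH(1) fgW eW e(3) by (intro exI[of _ S] exI[of _ W] exI[of _ e]) simp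
qed

text \<open>Stated for a Casimir system instead of a biseparable bimodule, so that it serves
  \<open>M\<close> and, with the rings exchanged, the dual of \<open>M\<close>.\<close>

theorem finite_representation_type_transfer:
  assumes R: "artin_algebra k R \<phi>" and T: "artin_algebra l T \<psi>" and fgN: "fin_gen_module T N"
    and frt: "finite_representation_type R"
  shows "finite_representation_type T"
proof -
  interpret TA: artin_algebra l T \<psi> by (rule T)
  obtain Us where Us: "finite Us" "Us \<subseteq> fg_indec_modules R"
    "\<And>V. V \<in> fg_indec_modules R \<Longrightarrow> \<exists>U\<in>Us. lmod_iso R V U"
    using finite_representation_typeD[OF frt] by blast
  \<comment> \<open>The type of \<open>Zs\<close> is spelled out because the summands are found
    among the submodules of \<open>tensor_image\<close>, whose carrier type mentions the type of the
    tests.\<close>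
  have "\<exists>Zs :: ('t, ('t, (nat \<Rightarrow> 't) set) module \<times> ((nat \<Rightarrow> 'r) set \<Rightarrow> 'n \<Rightarrow> (nat \<Rightarrow> 't) set) \<Rightarrow>
      (nat \<Rightarrow> 't) set) module set. finite Zs \<and> (\<forall>V\<in>fg_indec_modules T. lmod_summand T V (tensor_image T R N U) \<longrightarrow>
      (\<exists>Z\<in>Zs. lmod_iso T V Z))" (is "\<exists>Zs. ?F U Zs") if "U \<in> Us" for U
  proof -
    have U: "left_module R U" "fin_gen_module R U" using that Us(2) by (auto simp: fg_indec_modules_def)
    note ti = tensor_image[OF fgN U]
    show ?thesis
      by (rule TA.finite_indecomposable_summands[OF ti(1) TA.dcc_fin_gen[OF ti]])
  qed
  then obtain Zs where Zs: "\<And>U. U \<in> Us \<Longrightarrow> ?F U (Zs U)" by metis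
  show ?thesis
  proof (rule finite_representation_typeI)
    show "finite (\<Union>U\<in>Us. Zs U)" using Us(1) Zs by blast
    fix V assume "V \<in> fg_indec_modules T"
    then have V: "left_module T V" "fin_gen_module T V" "indecomposable_module T V"
      by (auto simp: fg_indec_modules_def)
    let ?H = "hom_module T N V"
    interpret H: left_module R ?H by (rule left_module_hom_module[OF V(1)])
    from indecomposable_intermediate[OF R T V]
    obtain S W e where S: "submodule S R ?H" and yS: "\<forall>j\<in>J. \<forall>x\<in>carrier V. component V j x \<in> S"
      and W: "submodule W R ?H" "fin_gen_module R (?H\<lparr>carrier := W\<rparr>)" "indecomposable_module R (?H\<lparr>carrier := W\<rparr>)"
      and e: "e \<in> lmod_hom R (?H\<lparr>carrier := S\<rparr>) (?H\<lparr>carrier := W\<rparr>)"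
        "bij_betw (\<lambda>x. \<Oplus>\<^bsub>V\<^esub>j\<in>J. e (component V j x) (\<nu> j)) (carrier V) (carrier V)"
      by (elim exE conjE) (rule that)
    note S = S yS[rule_format]
    let ?W = "?H\<lparr>carrier := W\<rparr>"
    have LW: "left_module R ?W" by (rule H.left_module_submodule[OF W(1)])
    \<comment> \<open>\<open>W\<close> consists of functions on \<open>N\<close>, whereas the
      hypothesis on \<open>R\<close> concerns modules carried by
      \<open>(nat \<Rightarrow> 'r) set\<close>, so a copy of \<open>W\<close> in that type is
      taken.\<close>
    obtain L :: "('r, (nat \<Rightarrow> 'r) set) module" where L: "left_module R L" "lmod_iso R ?W L"
      using fin_gen_module_universe[OF LW W(2)] by blast
    have "fin_gen_module R L"
    proof -
      obtain h where "h \<in> lmod_hom R ?W L" "bij_betw h (carrier ?W) (carrier L)"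
        using L(2) unfolding lmod_iso_def by blast
      then show ?thesis using fin_gen_module_image[OF LW L(1) _ _ W(2), of h] by (simp add: bij_betw_def)
    qed
    then have "L \<in> fg_indec_modules R"
      using L(1) indecomposable_module_iso[OF LW L W(3)] by (simp add: fg_indec_modules_def)
    then obtain U where U: "U \<in> Us" "lmod_iso R L U" using Us(3) by blast
    obtain h where h: "h \<in> lmod_hom R ?W U" "bij_betw h (carrier ?W) (carrier U)"
      using lmod_iso_trans[OF L(2) U(2)] unfolding lmod_iso_def by blast
    let ?g = "inv_into (carrier ?W) h"
    have g: "?g \<in> lmod_hom R U ?H"
      by (rule lmod_hom_incl[OF lmod_hom_inv[OF LW h] submoduleD(1)[OF W(1)]])
    have he: "(\<lambda>x. h (e x)) \<in> lmod_hom R (?H\<lparr>carrier := S\<rparr>) U" by (rule lmod_hom_comp[OF e(1) h(1)])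
    \<comment> \<open>On components, passing to \<open>U\<close> and back is \<open>e\<close>, so
      the trace stays the same and remains bijective.\<close>
    have ghe: "?g (h (e (component V j x))) = e (component V j x)" if "j \<in> J" "x \<in> carrier V" for j x
      by (rule bij_betw_inv_into_left[OF h(2)]) (rule lmod_homD(1)[OF e(1)], use S(2)[OF that] in simp)
    have LU: "left_module R U" using U(1) Us(2) by (auto simp: fg_indec_modules_def)
    interpret V: left_module T V by (rule V(1))
    have ghe_bij: "bij_betw (\<lambda>x. \<Oplus>\<^bsub>V\<^esub>j\<in>J. ?g (h (e (component V j x))) (\<nu> j)) (carrier V) (carrier V)"
    proof (rule iffD1[OF bij_betw_cong e(2)])
      fix x assume x: "x \<in> carrier V"
      show "(\<Oplus>\<^bsub>V\<^esub>j\<in>J. e (component V j x) (\<nu> j)) = (\<Oplus>\<^bsub>V\<^esub>j\<in>J. ?g (h (e (component V j x))) (\<nu> j))"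
      proof (rule V.M.finsum_cong'[OF refl])
        show "(\<lambda>j. ?g (h (e (component V j x))) (\<nu> j)) \<in> J \<rightarrow> carrier V"
        proof
          fix j assume j: "j \<in> J"
          have "h (e (component V j x)) \<in> carrier U"
            by (rule lmod_homD(1)[OF he]) (use S(2)[OF j x] in simp)
          then have "?g (h (e (component V j x))) \<in> lmod_hom T N V"
            using lmod_homD(1)[OF g] by (simp add: hom_module_simps)
          then show "?g (h (e (component V j x))) (\<nu> j) \<in> carrier V" by (rule lmod_homD(1)) (rule \<nu>[OF j])
        qed
      qed (use ghe[OF _ x] in simp)
    qed
    have "lmod_summand T V (tensor_image T R N U)"
      by (rule summand_tensor_image[OF V(1) LU S he g ghe_bij])
    then show "\<exists>Z\<in>\<Union>U\<in>Us. Zs U. lmod_iso T V Z"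
      using Zs[OF U(1)] \<open>V \<in> fg_indec_modules T\<close> U(1) by blast
  qed
qed

end

section \<open>Dual bases\<close>

lemma regular_bimodule_simps [simp]:
  "carrier (regular_bimodule T) = carrier T" "\<zero>\<^bsub>regular_bimodule T\<^esub> = \<zero>\<^bsub>T\<^esub>"
  "x \<oplus>\<^bsub>regular_bimodule T\<^esub> y = x \<oplus>\<^bsub>T\<^esub> y" "a \<odot>\<^bsub>regular_bimodule T\<^esub> x = a \<otimes>\<^bsub>T\<^esub> x"
  "x \<odot>\<^sub>r\<^bsub>regular_bimodule T\<^esub> a = x \<otimes>\<^bsub>T\<^esub> a"
  by (simp_all add: regular_bimodule_def)

text \<open>Projectivity splits the epimorphism from the free module on \<open>A\<close>; the
  coordinates of the splitting are the functionals \<open>\<pi> a\<close>.\<close>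

lemma dual_basis:
  assumes fg: "fin_gen_module R P" and proj: "projective_module R P"
  shows "\<exists>A \<pi>. finite A \<and> A \<subseteq> carrier P \<and> (\<forall>a\<in>A. \<pi> a \<in> lmod_hom R P (regular_bimodule R)) \<and>
    (\<forall>x\<in>carrier P. x = (\<Oplus>\<^bsub>P\<^esub>a\<in>A. \<pi> a x \<odot>\<^bsub>P\<^esub> a))"
proof -
  have P: "left_module R P" using proj by (simp add: projective_module_def)
  interpret P: left_module R P by (rule P)
  obtain A where A: "finite A" "A \<subseteq> carrier P" "\<And>S. submodule S R P \<Longrightarrow> A \<subseteq> S \<Longrightarrow> S = carrier P"
    using fg unfolding P.fin_gen_module_iff by blast
  let ?F = "free_lmod R A" and ?e = "lin_ext R P (\<lambda>x. x)"
  have F: "left_module R ?F" by (rule free_lmod[OF P.R.ring_axioms])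
  have e: "?e \<in> lmod_hom R ?F P" by (rule P.lin_ext_hom) (use A(2) in auto)
  obtain h where h: "h \<in> lmod_hom R P ?F" and eh: "\<forall>x\<in>carrier P. ?e (h x) = x"
    using projective_module_lift[OF proj F P e P.free_lmod_onto[OF A(2,3)] lmod_hom_id] by blast
  have hF: "h x \<in> carrier ?F" if "x \<in> carrier P" for x using lmod_homD(1)[OF h that] .
  have "(\<lambda>x. h x a) \<in> lmod_hom R P (regular_bimodule R)" for a
    using h hF by (auto simp: lmod_hom_def free_lmod_def image_subset_iff)
  moreover have "x = (\<Oplus>\<^bsub>P\<^esub>a\<in>A. h x a \<odot>\<^bsub>P\<^esub> a)" if x: "x \<in> carrier P" for x
  proof -
    have "x = ?e (h x)" using eh x by simp
    also have "\<dots> = (\<Oplus>\<^bsub>P\<^esub>a\<in>A. h x a \<odot>\<^bsub>P\<^esub> a)"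
      by (rule P.lin_ext_superset[OF A(1)]) (use hF[OF x] A(2) in \<open>auto simp: free_lmod_def\<close>)
    finally show ?thesis .
  qed
  ultimately show ?thesis using A(1,2) by (intro exI[of _ A] exI[of _ "\<lambda>a x. h x a"]) blast
qed

section \<open>Balanced maps and separability\<close>

text \<open>The sum inside \<open>evaluation\<close>, with a general \<open>\<beta>\<close> in place
  of x, f \<mapsto> f x.\<close>

definition additive_extension ::
  "('t, 'b) ring_scheme \<Rightarrow> ('n \<Rightarrow> 'f \<Rightarrow> 't) \<Rightarrow> ('n \<times> 'f \<Rightarrow>\<^sub>0 int) \<Rightarrow> 't"
  where "additive_extension T \<beta> c =
    (\<Oplus>\<^bsub>T\<^esub>p\<in>Poly_Mapping.keys c. [Poly_Mapping.lookup c p] \<cdot>\<^bsub>T\<^esub> \<beta> (fst p) (snd p))"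

text \<open>The universal property gives a homomorphism with the right values on generators;
  expanding a formal sum over its support identifies it with the explicit formula.\<close>

lemma (in abelian_group) additive_extension_hom:
  assumes \<beta>: "\<And>x y. (x, y) \<in> S \<Longrightarrow> \<beta> x y \<in> carrier G"
  shows "group_hom (free_Abelian_group S) (add_monoid G) (additive_extension G \<beta>)"
    and "(x, y) \<in> S \<Longrightarrow> additive_extension G \<beta> (frag_of (x, y)) = \<beta> x y"
proof -
  let ?F = "free_Abelian_group S"
  have \<beta>': "(\<lambda>p. \<beta> (fst p) (snd p)) ` S \<subseteq> carrier (add_monoid G)" using \<beta> by auto
  obtain h where h: "h \<in> hom ?F (add_monoid G)" and hp: "\<And>p. p \<in> S \<Longrightarrow> h (frag_of p) = \<beta> (fst p) (snd p)"
    using comm_group.free_Abelian_group_universal[OF a_comm_group \<beta>'] by blast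
  have gh: "group_hom ?F (add_monoid G) h"
    by (intro group_hom.intro group_hom_axioms.intro h group_free_Abelian_group a_group)
  have sum: "h (\<Sum>p\<in>I. frag_cmul (Poly_Mapping.lookup c p) (frag_of p)) =
      (\<Oplus>p\<in>I. [Poly_Mapping.lookup c p] \<cdot> \<beta> (fst p) (snd p))" if "finite I" "I \<subseteq> S" for I c
    using that
  proof (induction I)
    case empty
    show ?case using group_hom.hom_one[OF gh] by simp
  next
    case (insert p I)
    let ?s = "\<lambda>I. \<Sum>p\<in>I. frag_cmul (Poly_Mapping.lookup c p) (frag_of p)"
    have p: "p \<in> S" using insert.prems by simp
    have c1: "frag_cmul (Poly_Mapping.lookup c p) (frag_of p) \<in> carrier ?F"
      using p by (auto simp del: keys_frag_of dest!: subsetD[OF keys_cmul])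
    have c2: "?s I \<in> carrier ?F"
      by (rule sum_closed_free_Abelian_group) (use insert.prems in \<open>auto dest!: subsetD[OF keys_cmul]\<close>)
    have bc: "\<beta> (fst q) (snd q) \<in> carrier G" if "q \<in> S" for q using \<beta>[of "fst q" "snd q"] that by simp
    have "h (?s (insert p I)) = h (frag_cmul (Poly_Mapping.lookup c p) (frag_of p) \<otimes>\<^bsub>?F\<^esub> ?s I)"
      using insert.hyps by simp
    also have "\<dots> = h (frag_cmul (Poly_Mapping.lookup c p) (frag_of p)) \<oplus> h (?s I)"
      using hom_mult[OF h c1 c2] by simp
    also have "frag_cmul (Poly_Mapping.lookup c p) (frag_of p) = frag_of p [^]\<^bsub>?F\<^esub> Poly_Mapping.lookup c p"
      using p by simp
    also have "h \<dots> = [Poly_Mapping.lookup c p] \<cdot> \<beta> (fst p) (snd p)"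
      using group_hom.hom_int_pow[OF gh, of "frag_of p" "Poly_Mapping.lookup c p"] p hp
      by (simp add: add_pow_def)
    also have "h (?s I) = (\<Oplus>p\<in>I. [Poly_Mapping.lookup c p] \<cdot> \<beta> (fst p) (snd p))"
      using insert by simp
    finally show ?case
      using insert.hyps insert.prems bc by (subst finsum_insert) (auto intro!: add.int_pow_closed)
  qed
  have eq: "h c = additive_extension G \<beta> c" if "c \<in> carrier ?F" for c
    using sum[of "Poly_Mapping.keys c" c] that frag_expansion[of c]
    by (simp add: additive_extension_def frag_extend_def)
  have "additive_extension G \<beta> \<in> hom ?F (add_monoid G)"
  proof (rule homI)
    fix u v assume uv: "u \<in> carrier ?F" "v \<in> carrier ?F"
    show "additive_extension G \<beta> u \<in> carrier (add_monoid G)"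
      unfolding eq[OF uv(1), symmetric] by (rule hom_in_carrier[OF h uv(1)])
    have "u \<otimes>\<^bsub>?F\<^esub> v \<in> carrier ?F"
      by (rule monoid.m_closed[OF group.is_monoid[OF group_free_Abelian_group] uv])
    then show "additive_extension G \<beta> (u \<otimes>\<^bsub>?F\<^esub> v) =
        additive_extension G \<beta> u \<otimes>\<^bsub>add_monoid G\<^esub> additive_extension G \<beta> v"
      unfolding eq[OF uv(1), symmetric] eq[OF uv(2), symmetric]
      using eq[of "u \<otimes>\<^bsub>?F\<^esub> v"] hom_mult[OF h uv] by metis
  qed
  then show "group_hom ?F (add_monoid G) (additive_extension G \<beta>)"
    by (intro group_hom.intro group_hom_axioms.intro group_free_Abelian_group a_group)
  show "additive_extension G \<beta> (frag_of (x, y)) = \<beta> x y" if "(x, y) \<in> S"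
    using eq[of "frag_of (x, y)"] hp[OF that] that by simp
qed

definition balanced ::
  "('t, 'b) ring_scheme \<Rightarrow> ('r, 'c) ring_scheme \<Rightarrow> ('t, 'r, 'n, 'd) bimodule_scheme \<Rightarrow>
    ('r, 's, 'f, 'e) bimodule_scheme \<Rightarrow> ('n \<Rightarrow> 'f \<Rightarrow> 't) \<Rightarrow> bool"
  where "balanced T R N D \<beta> \<longleftrightarrow>
    (\<forall>n\<in>carrier N. \<forall>f\<in>carrier D. \<beta> n f \<in> carrier T) \<and>
    (\<forall>n\<in>carrier N. \<forall>n'\<in>carrier N. \<forall>f\<in>carrier D. \<beta> (n \<oplus>\<^bsub>N\<^esub> n') f = \<beta> n f \<oplus>\<^bsub>T\<^esub> \<beta> n' f) \<and>
    (\<forall>n\<in>carrier N. \<forall>f\<in>carrier D. \<forall>f'\<in>carrier D. \<beta> n (f \<oplus>\<^bsub>D\<^esub> f') = \<beta> n f \<oplus>\<^bsub>T\<^esub> \<beta> n f') \<and>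
    (\<forall>n\<in>carrier N. \<forall>r\<in>carrier R. \<forall>f\<in>carrier D. \<beta> (n \<odot>\<^sub>r\<^bsub>N\<^esub> r) f = \<beta> n (r \<odot>\<^bsub>D\<^esub> f))"

lemma balancedD:
  assumes "balanced T R N D \<beta>"
  shows "\<lbrakk>n \<in> carrier N; f \<in> carrier D\<rbrakk> \<Longrightarrow> \<beta> n f \<in> carrier T"
    and "\<lbrakk>n \<in> carrier N; n' \<in> carrier N; f \<in> carrier D\<rbrakk> \<Longrightarrow> \<beta> (n \<oplus>\<^bsub>N\<^esub> n') f = \<beta> n f \<oplus>\<^bsub>T\<^esub> \<beta> n' f"
    and "\<lbrakk>n \<in> carrier N; f \<in> carrier D; f' \<in> carrier D\<rbrakk> \<Longrightarrow> \<beta> n (f \<oplus>\<^bsub>D\<^esub> f') = \<beta> n f \<oplus>\<^bsub>T\<^esub> \<beta> n f'"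
    and "\<lbrakk>n \<in> carrier N; r \<in> carrier R; f \<in> carrier D\<rbrakk> \<Longrightarrow> \<beta> (n \<odot>\<^sub>r\<^bsub>N\<^esub> r) f = \<beta> n (r \<odot>\<^bsub>D\<^esub> f)"
  using assms unfolding balanced_def by blast+

text \<open>Equality in the tensor product is equality modulo \<open>tensor_relations\<close>; this
  makes the value of a balanced map independent of the representative of a coset.\<close>

lemma tensor_relations_kernel:
  assumes T: "ring T" and \<beta>: "balanced T R N D \<beta>"
    and N: "\<And>n n'. \<lbrakk>n \<in> carrier N; n' \<in> carrier N\<rbrakk> \<Longrightarrow> n \<oplus>\<^bsub>N\<^esub> n' \<in> carrier N"
      "\<And>n r. \<lbrakk>n \<in> carrier N; r \<in> carrier R\<rbrakk> \<Longrightarrow> n \<odot>\<^sub>r\<^bsub>N\<^esub> r \<in> carrier N"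
    and D: "\<And>f f'. \<lbrakk>f \<in> carrier D; f' \<in> carrier D\<rbrakk> \<Longrightarrow> f \<oplus>\<^bsub>D\<^esub> f' \<in> carrier D"
      "\<And>f r. \<lbrakk>f \<in> carrier D; r \<in> carrier R\<rbrakk> \<Longrightarrow> r \<odot>\<^bsub>D\<^esub> f \<in> carrier D"
  shows "tensor_relations R N D \<subseteq> kernel (tensor_free N D) (add_monoid T) (additive_extension T \<beta>)"
proof -
  interpret T: ring T by fact
  let ?S = "carrier N \<times> carrier D" and ?h = "additive_extension T \<beta>"
  let ?F = "free_Abelian_group ?S"
  note bD = balancedD[OF \<beta>]
  have bc: "\<beta> x y \<in> carrier T" if "(x, y) \<in> ?S" for x y using bD(1) that by auto
  note gh = T.additive_extension_hom(1)[where S = ?S and \<beta> = \<beta>, OF bc]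
  note val = T.additive_extension_hom(2)[where S = ?S and \<beta> = \<beta>, OF bc]
  interpret h: group_hom ?F "add_monoid T" ?h by (rule gh)
  have diff: "?h (u - v) = ?h u \<ominus>\<^bsub>T\<^esub> ?h v" if "u \<in> carrier ?F" "v \<in> carrier ?F" for u v
  proof -
    have "?h (u \<otimes>\<^bsub>?F\<^esub> inv\<^bsub>?F\<^esub> v) = ?h u \<ominus>\<^bsub>T\<^esub> ?h v"
      using that h.hom_mult[of u "inv\<^bsub>?F\<^esub> v"] h.hom_inv[of v] h.G.inv_closed[of v]
      by (simp add: a_minus_def a_inv_def)
    then show ?thesis using that by simp
  qed
  have cl: "u - v \<in> carrier ?F" if "u \<in> carrier ?F" "v \<in> carrier ?F" for u v
    using that keys_diff[of u v] by auto
  have fc: "frag_of p \<in> carrier ?F" if "p \<in> ?S" for p using that by simp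
  have ker: "x \<in> kernel ?F (add_monoid T) ?h \<longleftrightarrow> x \<in> carrier ?F \<and> ?h x = \<zero>\<^bsub>T\<^esub>" for x
    by (simp add: kernel_def)
  have z: "a \<oplus>\<^bsub>T\<^esub> b \<ominus>\<^bsub>T\<^esub> a \<ominus>\<^bsub>T\<^esub> b = \<zero>\<^bsub>T\<^esub>" if "a \<in> carrier T" "b \<in> carrier T" for a b
  proof -
    have "a \<oplus>\<^bsub>T\<^esub> b \<ominus>\<^bsub>T\<^esub> a = b"
      using that by (simp add: a_minus_def T.a_assoc T.a_comm[of b] T.r_neg2 T.r_neg1)
    then show ?thesis using that by simp
  qed
  show ?thesis
    unfolding tensor_relations_def
  proof (rule group.generate_subgroup_incl[OF group_free_Abelian_group _ h.subgroup_kernel], intro Un_least subsetI)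
    fix c assume "c \<in> {frag_of (x \<oplus>\<^bsub>N\<^esub> x', y) - frag_of (x, y) - frag_of (x', y) | x x' y.
        x \<in> carrier N \<and> x' \<in> carrier N \<and> y \<in> carrier D}"
    then obtain x x' y where c: "c = frag_of (x \<oplus>\<^bsub>N\<^esub> x', y) - frag_of (x, y) - frag_of (x', y)"
      "x \<in> carrier N" "x' \<in> carrier N" "y \<in> carrier D" by blast
    have m: "frag_of (x \<oplus>\<^bsub>N\<^esub> x', y) \<in> carrier ?F" "frag_of (x, y) \<in> carrier ?F" "frag_of (x', y) \<in> carrier ?F"
      by (rule fc, use c N in simp)+
    show "c \<in> kernel ?F (add_monoid T) ?h"
      unfolding ker c(1) diff[OF cl[OF m(1,2)] m(3)] diff[OF m(1,2)]
      using cl[OF cl[OF m(1,2)] m(3)] c(2-4) N bD val z by simp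
  next
    fix c assume "c \<in> {frag_of (x, y \<oplus>\<^bsub>D\<^esub> y') - frag_of (x, y) - frag_of (x, y') | x y y'.
        x \<in> carrier N \<and> y \<in> carrier D \<and> y' \<in> carrier D}"
    then obtain x y y' where c: "c = frag_of (x, y \<oplus>\<^bsub>D\<^esub> y') - frag_of (x, y) - frag_of (x, y')"
      "x \<in> carrier N" "y \<in> carrier D" "y' \<in> carrier D" by blast
    have m: "frag_of (x, y \<oplus>\<^bsub>D\<^esub> y') \<in> carrier ?F" "frag_of (x, y) \<in> carrier ?F" "frag_of (x, y') \<in> carrier ?F"
      by (rule fc, use c D in simp)+
    show "c \<in> kernel ?F (add_monoid T) ?h"
      unfolding ker c(1) diff[OF cl[OF m(1,2)] m(3)] diff[OF m(1,2)]
      using cl[OF cl[OF m(1,2)] m(3)] c(2-4) D bD val z by simp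
  next
    fix c assume "c \<in> {frag_of (x \<odot>\<^sub>r\<^bsub>N\<^esub> r, y) - frag_of (x, r \<odot>\<^bsub>D\<^esub> y) | x r y.
        x \<in> carrier N \<and> r \<in> carrier R \<and> y \<in> carrier D}"
    then obtain x r y where c: "c = frag_of (x \<odot>\<^sub>r\<^bsub>N\<^esub> r, y) - frag_of (x, r \<odot>\<^bsub>D\<^esub> y)"
      "x \<in> carrier N" "r \<in> carrier R" "y \<in> carrier D" by blast
    have m: "frag_of (x \<odot>\<^sub>r\<^bsub>N\<^esub> r, y) \<in> carrier ?F" "frag_of (x, r \<odot>\<^bsub>D\<^esub> y) \<in> carrier ?F"
      by (rule fc, use c N D in simp)+
    show "c \<in> kernel ?F (add_monoid T) ?h"
      unfolding ker c(1) diff[OF m] using cl[OF m] c(2-4) N D bD val by simp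
  qed
qed

text \<open>Meant for the two scalar actions on the tensor product, which are defined by such
  substitutions of generators on representatives.\<close>

lemma additive_extension_frag_extend:
  assumes T: "ring T" and \<beta>: "\<And>x y. (x, y) \<in> S' \<Longrightarrow> \<beta> x y \<in> carrier T"
    and g: "\<And>x y. (x, y) \<in> S \<Longrightarrow> (g x, h y) \<in> S'" and c: "Poly_Mapping.keys c \<subseteq> S"
  shows "Poly_Mapping.keys (frag_extend (\<lambda>(x, y). frag_of (g x, h y)) c) \<subseteq> S'"
    and "additive_extension T \<beta> (frag_extend (\<lambda>(x, y). frag_of (g x, h y)) c) =
      additive_extension T (\<lambda>x y. \<beta> (g x) (h y)) c"
proof -
  interpret T: ring T by fact
  let ?e = "frag_extend (\<lambda>(x, y). frag_of (g x, h y))"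
  have \<beta>': "(x, y) \<in> S \<Longrightarrow> \<beta> (g x) (h y) \<in> carrier T" for x y using \<beta> g by blast
  interpret a: group_hom "free_Abelian_group S'" "add_monoid T" "additive_extension T \<beta>"
    by (rule T.additive_extension_hom(1)[OF \<beta>])
  interpret b: group_hom "free_Abelian_group S" "add_monoid T" "additive_extension T (\<lambda>x y. \<beta> (g x) (h y))"
    by (rule T.additive_extension_hom(1)[OF \<beta>'])
  have sub: "Poly_Mapping.keys (?e c) \<subseteq> S'" if "Poly_Mapping.keys c \<subseteq> S" for c
    using keys_frag_extend[of "\<lambda>(x, y). frag_of (g x, h y)" c] that g by fastforce
  show "Poly_Mapping.keys (?e c) \<subseteq> S'" by (rule sub[OF c])
  show "additive_extension T \<beta> (?e c) = additive_extension T (\<lambda>x y. \<beta> (g x) (h y)) c"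
  proof (rule free_Abelian_group_induct[OF c])
    show "additive_extension T \<beta> (?e 0) = additive_extension T (\<lambda>x y. \<beta> (g x) (h y)) 0"
      using a.hom_one b.hom_one by simp
  next
    fix u v assume uv: "Poly_Mapping.keys u \<subseteq> S" "Poly_Mapping.keys v \<subseteq> S"
      and IH: "additive_extension T \<beta> (?e u) = additive_extension T (\<lambda>x y. \<beta> (g x) (h y)) u"
        "additive_extension T \<beta> (?e v) = additive_extension T (\<lambda>x y. \<beta> (g x) (h y)) v"
    have "additive_extension T \<beta> (?e u \<otimes>\<^bsub>free_Abelian_group S'\<^esub> inv\<^bsub>free_Abelian_group S'\<^esub> ?e v) =
        additive_extension T (\<lambda>x y. \<beta> (g x) (h y)) (u \<otimes>\<^bsub>free_Abelian_group S\<^esub> inv\<^bsub>free_Abelian_group S\<^esub> v)"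
      using IH uv[folded carrier_free_Abelian_group_iff]
        sub[OF uv(1), folded carrier_free_Abelian_group_iff] sub[OF uv(2), folded carrier_free_Abelian_group_iff]
      by (simp only: a.hom_mult a.hom_inv b.hom_mult b.hom_inv a.G.inv_closed b.G.inv_closed)
    then show "additive_extension T \<beta> (?e (u - v)) = additive_extension T (\<lambda>x y. \<beta> (g x) (h y)) (u - v)"
      using uv sub[OF uv(1)] sub[OF uv(2)] by (simp add: frag_extend_diff)
  next
    fix p assume "p \<in> S"
    then show "additive_extension T \<beta> (?e (frag_of p)) = additive_extension T (\<lambda>x y. \<beta> (g x) (h y)) (frag_of p)"
      using T.additive_extension_hom(2)[where S = S' and \<beta> = \<beta>]
        T.additive_extension_hom(2)[where S = S and \<beta> = "\<lambda>x y. \<beta> (g x) (h y)"] \<beta> \<beta>' g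
      by (cases p) simp
  qed
qed

lemma additive_int_pow:
  assumes M: "abelian_group M" and N: "abelian_group N"
    and h: "\<And>x. x \<in> carrier M \<Longrightarrow> h x \<in> carrier N"
      "\<And>x y. \<lbrakk>x \<in> carrier M; y \<in> carrier M\<rbrakk> \<Longrightarrow> h (x \<oplus>\<^bsub>M\<^esub> y) = h x \<oplus>\<^bsub>N\<^esub> h y"
    and x: "x \<in> carrier M"
  shows "h (add_pow M k x) = add_pow N (k::int) (h x)"
proof -
  have "h \<in> hom (add_monoid M) (add_monoid N)" using h by (auto simp: hom_def)
  then have "group_hom (add_monoid M) (add_monoid N) h"
    by (intro group_hom.intro group_hom_axioms.intro abelian_group.a_group M N)
  from group_hom.hom_int_pow[OF this, of x k] x show ?thesis by (simp add: add_pow_def)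
qed

section \<open>Casimir elements of separable bimodules\<close>

lemma left_dual_simps:
  "f \<in> carrier (left_dual T R M) \<longleftrightarrow>
    f \<in> lmod_hom T M (regular_bimodule T) \<and> f \<in> extensional (carrier M)"
  "f \<oplus>\<^bsub>left_dual T R M\<^esub> g = (\<lambda>x\<in>carrier M. f x \<oplus>\<^bsub>T\<^esub> g x)"
  "r \<odot>\<^bsub>left_dual T R M\<^esub> f = (\<lambda>x\<in>carrier M. f (x \<odot>\<^sub>r\<^bsub>M\<^esub> r))"
  "f \<odot>\<^sub>r\<^bsub>left_dual T R M\<^esub> t = (\<lambda>x\<in>carrier M. f x \<otimes>\<^bsub>T\<^esub> t)"
  by (auto simp: left_dual_def lmod_hom_def PiE_def)

context bimodule
begin

lemma left_dual_hom:
  assumes "f \<in> carrier (left_dual T R M)"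
  shows "x \<in> carrier M \<Longrightarrow> f x \<in> carrier T"
    and "\<lbrakk>x \<in> carrier M; y \<in> carrier M\<rbrakk> \<Longrightarrow> f (x \<oplus>\<^bsub>M\<^esub> y) = f x \<oplus> f y"
    and "\<lbrakk>t \<in> carrier T; x \<in> carrier M\<rbrakk> \<Longrightarrow> f (t \<odot>\<^bsub>M\<^esub> x) = t \<otimes> f x"
  using assms lmod_homD[of f T M "regular_bimodule T"] by (simp_all add: left_dual_simps)

lemma left_dualI:
  assumes "f \<in> lmod_hom T M (regular_bimodule T)"
  shows "(\<lambda>x\<in>carrier M. f x) \<in> carrier (left_dual T R M)"
  using assms by (simp add: left_dual_simps lmod_hom_def Pi_def)

lemma left_dual_closed:
  assumes f: "f \<in> carrier (left_dual T R M)"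
  shows "g \<in> carrier (left_dual T R M) \<Longrightarrow> f \<oplus>\<^bsub>left_dual T R M\<^esub> g \<in> carrier (left_dual T R M)"
    and "r \<in> carrier R \<Longrightarrow> r \<odot>\<^bsub>left_dual T R M\<^esub> f \<in> carrier (left_dual T R M)"
    and "t \<in> carrier T \<Longrightarrow> f \<odot>\<^sub>r\<^bsub>left_dual T R M\<^esub> t \<in> carrier (left_dual T R M)"
  unfolding left_dual_simps(2-4)
  by (rule left_dualI, rule lmod_homI;
      use left_dual_hom[OF f] left_dual_hom[of g] in
        \<open>simp add: R.r_distr R.l_distr R.m_assoc R.a_ac rsmult_distr smult_rsmult\<close>)+

text \<open>The terms come from a representative of \<open>s \<one>\<close>. As \<open>s\<close> is
  a bimodule homomorphism, t s(1) = s(t) = s(1) t. This equality of cosets is recorded through its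
  effect on all balanced maps, the form in which it is used later.\<close>

lemma separable_casimir:
  assumes sep: "separable_bimodule T R M"
  shows "\<exists>(I :: ('m \<times> ('m \<Rightarrow> 't)) set) n f. finite I \<and>
    (\<forall>i\<in>I. n i \<in> carrier M \<and> f i \<in> carrier (left_dual T R M)) \<and>
    (\<Oplus>i\<in>I. f i (n i)) = \<one> \<and>
    (\<forall>\<beta>. balanced T R M (left_dual T R M) \<beta> \<longrightarrow> (\<forall>t\<in>carrier T.
      (\<Oplus>i\<in>I. \<beta> (t \<odot>\<^bsub>M\<^esub> n i) (f i)) =
      (\<Oplus>i\<in>I. \<beta> (n i) (f i \<odot>\<^sub>r\<^bsub>left_dual T R M\<^esub> t))))"
proof -
  let ?D = "left_dual T R M"
  let ?S = "carrier M \<times> carrier ?D"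
  let ?F = "free_Abelian_group ?S" and ?K = "tensor_relations R M ?D"
  let ?P = "tensor_product R M ?D" and ?ext = "additive_extension T"
  have P: "carrier ?P = rcosets\<^bsub>?F\<^esub> ?K"
    "t \<odot>\<^bsub>?P\<^esub> Z = ?K <#>\<^bsub>?F\<^esub> (frag_extend (\<lambda>(x, y). frag_of (t \<odot>\<^bsub>M\<^esub> x, y)) ` Z)"
    "Z \<odot>\<^sub>r\<^bsub>?P\<^esub> t = ?K <#>\<^bsub>?F\<^esub> (frag_extend (\<lambda>(x, y). frag_of (x, y \<odot>\<^sub>r\<^bsub>?D\<^esub> t)) ` Z)" for t Z
    by (simp_all add: tensor_product_def Let_def FactGroup_def)
  obtain s where s: "s \<in> bimod_hom T T (regular_bimodule T) ?P" and ev: "\<forall>t\<in>carrier T. evaluation T (s t) = t"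
    using sep unfolding separable_bimodule_def by blast
  have sD: "s t \<in> carrier ?P" "t \<odot>\<^bsub>?P\<^esub> s \<one> = s t" "s \<one> \<odot>\<^sub>r\<^bsub>?P\<^esub> t = s t"
    if t: "t \<in> carrier T" for t
  proof -
    show "s t \<in> carrier ?P" using s t by (auto simp: bimod_hom_def)
    have "s (t \<odot>\<^bsub>regular_bimodule T\<^esub> \<one>) = t \<odot>\<^bsub>?P\<^esub> s \<one>"
      "s (\<one> \<odot>\<^sub>r\<^bsub>regular_bimodule T\<^esub> t) = s \<one> \<odot>\<^sub>r\<^bsub>?P\<^esub> t"
      using s t R.one_closed unfolding bimod_hom_def regular_bimodule_simps(1) by blast+
    then show "t \<odot>\<^bsub>?P\<^esub> s \<one> = s t" "s \<one> \<odot>\<^sub>r\<^bsub>?P\<^esub> t = s t" using t by simp_all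
  qed
  obtain c where c: "c \<in> carrier ?F" and Z: "s \<one> = ?K #>\<^bsub>?F\<^esub> c"
    using sD(1)[OF R.one_closed] unfolding P RCOSETS_def by blast
  have K0: "0 \<in> ?K" unfolding tensor_relations_def using generate.one[of ?F] by simp
  have cZ: "c \<in> s \<one>" unfolding Z r_coset_def using K0 by force
  have ext_hom: "group_hom ?F (add_monoid T) (?ext \<beta>)" if "balanced T R M ?D \<beta>" for \<beta>
    by (rule R.additive_extension_hom(1)) (use balancedD(1)[OF that] in auto)
  have ext_add: "?ext \<beta> (u + v) = ?ext \<beta> u \<oplus> ?ext \<beta> v" "?ext \<beta> u \<in> carrier T"
    if "balanced T R M ?D \<beta>" "u \<in> carrier ?F" "v \<in> carrier ?F" for \<beta> u v
    using group_hom.hom_mult[OF ext_hom[OF that(1)] that(2,3)] group_hom.hom_closed[OF ext_hom[OF that(1)] that(2)]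
    by simp_all
  have ext_K: "u \<in> carrier ?F" "?ext \<beta> u = \<zero>" if "balanced T R M ?D \<beta>" "u \<in> ?K" for \<beta> u
    using subsetD[OF tensor_relations_kernel[OF R.ring_axioms that(1)] that(2)] left_dual_closed
    by (auto simp: kernel_def)
  have ext_Z: "z \<in> carrier ?F" "?ext \<beta> z = ?ext \<beta> c" if \<beta>: "balanced T R M ?D \<beta>" and z: "z \<in> s \<one>" for \<beta> z
  proof -
    obtain u where u: "u \<in> ?K" "z = u \<otimes>\<^bsub>?F\<^esub> c" using z unfolding Z r_coset_def by blast
    show "z \<in> carrier ?F"
      unfolding u(2) by (rule monoid.m_closed[OF group.is_monoid[OF group_free_Abelian_group] ext_K(1)[OF \<beta> u(1)] c])
    show "?ext \<beta> z = ?ext \<beta> c"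
      using u ext_add[OF \<beta> ext_K(1)[OF \<beta> u(1)] c] ext_add(2)[OF \<beta> c c] ext_K(2)[OF \<beta> u(1)] by simp
  qed
  have bal_ev: "balanced T R M ?D (\<lambda>x f. f x)"
    unfolding balanced_def using left_dual_hom by (auto simp: left_dual_simps(2,3))
  have "?ext (\<lambda>x f. f x) ` s \<one> = (\<lambda>_. ?ext (\<lambda>x f. f x) c) ` s \<one>"
    by (rule image_cong[OF refl ext_Z(2)[OF bal_ev]])
  also have "\<dots> = {?ext (\<lambda>x f. f x) c}" using cZ by blast
  finally have ev1: "?ext (\<lambda>x f. f x) c = \<one>"
    using bspec[OF ev R.one_closed] unfolding evaluation_def additive_extension_def by simp
  have central: "?ext (\<lambda>x f. \<beta> (t \<odot>\<^bsub>M\<^esub> x) f) c = ?ext (\<lambda>x f. \<beta> x (f \<odot>\<^sub>r\<^bsub>?D\<^esub> t)) c"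
    if \<beta>: "balanced T R M ?D \<beta>" and t: "t \<in> carrier T" for \<beta> t
  proof -
    let ?l = "frag_extend (\<lambda>(x, y). frag_of (t \<odot>\<^bsub>M\<^esub> x, y))"
      and ?r = "frag_extend (\<lambda>(x, y). frag_of (x, y \<odot>\<^sub>r\<^bsub>?D\<^esub> t))"
    have bc: "\<beta> x y \<in> carrier T" if "(x, y) \<in> ?S" for x y using balancedD(1)[OF \<beta>] that by auto
    have l: "?l u \<in> carrier ?F" "?ext \<beta> (?l u) = ?ext (\<lambda>x f. \<beta> (t \<odot>\<^bsub>M\<^esub> x) f) u" if "u \<in> carrier ?F" for u
      using additive_extension_frag_extend[where S = ?S and S' = ?S and g = "\<lambda>x. t \<odot>\<^bsub>M\<^esub> x" and h = "\<lambda>y. y" and \<beta> = \<beta>,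
          OF R.ring_axioms bc, of u] that t by auto
    have r: "?r u \<in> carrier ?F" "?ext \<beta> (?r u) = ?ext (\<lambda>x f. \<beta> x (f \<odot>\<^sub>r\<^bsub>?D\<^esub> t)) u" if "u \<in> carrier ?F" for u
      using additive_extension_frag_extend[where S = ?S and S' = ?S and g = "\<lambda>x. x" and h = "\<lambda>y. y \<odot>\<^sub>r\<^bsub>?D\<^esub> t" and \<beta> = \<beta>,
          OF R.ring_axioms bc, of u] that left_dual_closed(3)[OF _ t] by auto
    have bal_t: "balanced T R M ?D (\<lambda>x f. \<beta> x (f \<odot>\<^sub>r\<^bsub>?D\<^esub> t))"
    proof -
      have "(f \<oplus>\<^bsub>?D\<^esub> g) \<odot>\<^sub>r\<^bsub>?D\<^esub> t = f \<odot>\<^sub>r\<^bsub>?D\<^esub> t \<oplus>\<^bsub>?D\<^esub> g \<odot>\<^sub>r\<^bsub>?D\<^esub> t"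
        if "f \<in> carrier ?D" "g \<in> carrier ?D" for f g
        unfolding left_dual_simps(2,4)
        by (rule restrict_ext) (use left_dual_hom(1)[OF that(1)] left_dual_hom(1)[OF that(2)] t in \<open>simp add: R.l_distr\<close>)
      moreover have "(r \<odot>\<^bsub>?D\<^esub> f) \<odot>\<^sub>r\<^bsub>?D\<^esub> t = r \<odot>\<^bsub>?D\<^esub> (f \<odot>\<^sub>r\<^bsub>?D\<^esub> t)" if "r \<in> carrier R" for r f
        unfolding left_dual_simps(3,4) by (rule restrict_ext) (use that in simp)
      ultimately show ?thesis
        using balancedD[OF \<beta>] left_dual_closed t unfolding balanced_def by simp
    qed
    \<comment> \<open>Both actions on \<open>s \<one>\<close> give the coset \<open>s t\<close>, but
      its description by the right action involves another representative \<open>z\<close> of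
      \<open>s \<one>\<close> and a relation \<open>u\<close>.\<close>
    have "?l c \<in> s t"
      unfolding sD(2)[OF t, symmetric] P(2) set_mult_def using K0 cZ by force
    then obtain u z where uz: "u \<in> ?K" "z \<in> s \<one>" "?l c = u + ?r z"
      unfolding sD(3)[OF t, symmetric] P(3) set_mult_def by auto
    have z: "z \<in> carrier ?F" by (rule ext_Z(1)[OF \<beta> uz(2)])
    have "?ext \<beta> (?l c) = ?ext \<beta> u \<oplus> ?ext \<beta> (?r z)"
      unfolding uz(3) by (rule ext_add(1)[OF \<beta> ext_K(1)[OF \<beta> uz(1)] r(1)[OF z]])
    also have "\<dots> = ?ext \<beta> (?r z)"
      using ext_K(2)[OF \<beta> uz(1)] ext_add(2)[OF \<beta> r(1)[OF z] r(1)[OF z]] by simp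
    also have "\<dots> = ?ext (\<lambda>x f. \<beta> x (f \<odot>\<^sub>r\<^bsub>?D\<^esub> t)) c"
      unfolding r(2)[OF z] by (rule ext_Z(2)[OF bal_t uz(2)])
    finally show ?thesis unfolding l(2)[OF c] .
  qed
  \<comment> \<open>The integer coefficient of a generator is moved into its first entry, which
    leaves a plain sum over the support of \<open>c\<close>.\<close>
  let ?I = "Poly_Mapping.keys c" and ?n = "\<lambda>p. add_pow M (Poly_Mapping.lookup c p) (fst p)"
  have I: "fst p \<in> carrier M" "snd p \<in> carrier ?D" if "p \<in> ?I" for p
    using c that by (cases p; auto simp: subset_iff)+
  have nc: "?n p \<in> carrier M" if "p \<in> ?I" for p
    using I[OF that] M.add.int_pow_closed by (simp add: add_pow_def)
  have weight: "?ext \<gamma> c = (\<Oplus>p\<in>?I. \<gamma> (?n p) (snd p))"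
    if cl: "\<And>x f. x \<in> carrier M \<Longrightarrow> f \<in> carrier ?D \<Longrightarrow> \<gamma> x f \<in> carrier T"
      and add: "\<And>x x' f. x \<in> carrier M \<Longrightarrow> x' \<in> carrier M \<Longrightarrow> f \<in> carrier ?D \<Longrightarrow> \<gamma> (x \<oplus>\<^bsub>M\<^esub> x') f = \<gamma> x f \<oplus> \<gamma> x' f"
    for \<gamma>
    unfolding additive_extension_def
  proof (rule R.finsum_cong'[OF refl])
    show "(\<lambda>p. \<gamma> (?n p) (snd p)) \<in> ?I \<rightarrow> carrier T" using nc I cl by auto
    show "add_pow T (Poly_Mapping.lookup c p) (\<gamma> (fst p) (snd p)) = \<gamma> (?n p) (snd p)" if "p \<in> ?I" for p
      using additive_int_pow[OF M.abelian_group_axioms R.abelian_group_axioms, of "\<lambda>x. \<gamma> x (snd p)" "fst p" "Poly_Mapping.lookup c p"]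
        I[OF that] cl add by simp
  qed
  have "(\<Oplus>p\<in>?I. snd p (?n p)) = \<one>"
    using weight[of "\<lambda>x f. f x"] ev1 left_dual_hom by simp
  moreover have "(\<Oplus>p\<in>?I. \<beta> (t \<odot>\<^bsub>M\<^esub> ?n p) (snd p)) = (\<Oplus>p\<in>?I. \<beta> (?n p) (snd p \<odot>\<^sub>r\<^bsub>?D\<^esub> t))"
    if \<beta>: "balanced T R M ?D \<beta>" and t: "t \<in> carrier T" for \<beta> t
  proof -
    have "?ext (\<lambda>x f. \<beta> (t \<odot>\<^bsub>M\<^esub> x) f) c = (\<Oplus>p\<in>?I. \<beta> (t \<odot>\<^bsub>M\<^esub> ?n p) (snd p))"
      by (rule weight) (use balancedD[OF \<beta>] t in \<open>simp_all add: smult_r_distr\<close>)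
    moreover have "?ext (\<lambda>x f. \<beta> x (f \<odot>\<^sub>r\<^bsub>?D\<^esub> t)) c = (\<Oplus>p\<in>?I. \<beta> (?n p) (snd p \<odot>\<^sub>r\<^bsub>?D\<^esub> t))"
      by (rule weight) (use balancedD[OF \<beta>] left_dual_closed(3)[OF _ t] in simp_all)
    ultimately show ?thesis using central[OF \<beta> t] by simp
  qed
  ultimately show ?thesis
    using nc I by (intro exI[of _ ?I] exI[of _ ?n] exI[of _ snd]) simp
qed

end

text \<open>Between groups preservation of zero is automatic, in contrast to
  \<open>additive_finsum\<close>.\<close>

lemma additive_map_finsum:
  assumes M: "abelian_group M" and N: "abelian_group N"
    and h: "\<And>x. x \<in> carrier M \<Longrightarrow> h x \<in> carrier N"
      "\<And>x y. \<lbrakk>x \<in> carrier M; y \<in> carrier M\<rbrakk> \<Longrightarrow> h (x \<oplus>\<^bsub>M\<^esub> y) = h x \<oplus>\<^bsub>N\<^esub> h y"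
    and I: "finite I" "f \<in> I \<rightarrow> carrier M"
  shows "h (\<Oplus>\<^bsub>M\<^esub>i\<in>I. f i) = (\<Oplus>\<^bsub>N\<^esub>i\<in>I. h (f i))"
proof -
  have "h \<in> hom (add_monoid M) (add_monoid N)" using h by (auto simp: hom_def)
  then have "group_hom (add_monoid M) (add_monoid N) h"
    by (intro group_hom.intro group_hom_axioms.intro abelian_group.a_group M N)
  from group_hom.hom_one[OF this] have "h \<zero>\<^bsub>M\<^esub> = \<zero>\<^bsub>N\<^esub>" by simp
  from additive_finsum[OF abelian_group.axioms(1)[OF M] abelian_group.axioms(1)[OF N] h(1) this h(2) I]
  show ?thesis .
qed

section \<open>Casimir systems for M and for its dual\<close>

lemma right_dual_simps:
  "g \<in> carrier (right_dual T R M) \<longleftrightarrow>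
    g \<in> lmod_hom (op_ring R) (right_part M) (regular_bimodule (op_ring R)) \<and> g \<in> extensional (carrier M)"
  "f \<oplus>\<^bsub>right_dual T R M\<^esub> g = (\<lambda>x\<in>carrier M. f x \<oplus>\<^bsub>R\<^esub> g x)"
  "r \<odot>\<^bsub>right_dual T R M\<^esub> f = (\<lambda>x\<in>carrier M. r \<otimes>\<^bsub>R\<^esub> f x)"
  "f \<odot>\<^sub>r\<^bsub>right_dual T R M\<^esub> t = (\<lambda>x\<in>carrier M. f (t \<odot>\<^bsub>M\<^esub> x))"
  by (auto simp: right_dual_def lmod_hom_def PiE_def)

context bimodule
begin

lemma right_dual_hom:
  assumes "g \<in> lmod_hom (op_ring R) (right_part M) (regular_bimodule (op_ring R))"
  shows "x \<in> carrier M \<Longrightarrow> g x \<in> carrier R"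
    and "\<lbrakk>x \<in> carrier M; y \<in> carrier M\<rbrakk> \<Longrightarrow> g (x \<oplus>\<^bsub>M\<^esub> y) = g x \<oplus>\<^bsub>R\<^esub> g y"
    and "\<lbrakk>r \<in> carrier R; x \<in> carrier M\<rbrakk> \<Longrightarrow> g (x \<odot>\<^sub>r\<^bsub>M\<^esub> r) = g x \<otimes>\<^bsub>R\<^esub> r"
  using lmod_homD[OF assms] by simp_all

text \<open>Expanding n_i as the sum of a \<pi>_a(n_i) and moving \<pi>_a(n_i) across the tensor
  rewrites the Casimir element with first entries in \<open>A\<close>. The matrix of
  \<open>t\<close> on \<open>A\<close>, with entries \<pi>_i(t j), then describes the action on both
  factors.\<close>

lemma casimir_system_of_separable:
  assumes sep: "separable_bimodule T R M" and A: "finite A" "A \<subseteq> carrier M"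
    and \<pi>: "\<And>a. a \<in> A \<Longrightarrow> \<pi> a \<in> lmod_hom (op_ring R) (right_part M) (regular_bimodule (op_ring R))"
    and basis: "\<And>x. x \<in> carrier M \<Longrightarrow> x = (\<Oplus>\<^bsub>M\<^esub>a\<in>A. a \<odot>\<^sub>r\<^bsub>M\<^esub> \<pi> a x)"
  shows "\<exists>f. casimir_system T R M A (\<lambda>a. a) f (\<lambda>t i j. \<pi> i (t \<odot>\<^bsub>M\<^esub> j))"
proof -
  let ?D = "left_dual T R M"
  obtain I :: "('m \<times> ('m \<Rightarrow> 't)) set" and n g where I: "finite I"
    and ng: "\<forall>i\<in>I. n i \<in> carrier M \<and> g i \<in> carrier ?D"
    and one: "(\<Oplus>i\<in>I. g i (n i)) = \<one>"
    and central: "\<forall>\<beta>. balanced T R M ?D \<beta> \<longrightarrow> (\<forall>t\<in>carrier T.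
      (\<Oplus>i\<in>I. \<beta> (t \<odot>\<^bsub>M\<^esub> n i) (g i)) = (\<Oplus>i\<in>I. \<beta> (n i) (g i \<odot>\<^sub>r\<^bsub>?D\<^esub> t)))"
    using separable_casimir[OF sep] by (elim exE conjE) (rule that)
  have n: "n i \<in> carrier M" and gD: "g i \<in> carrier ?D" if "i \<in> I" for i using ng that by blast+
  note g = left_dual_hom[OF gD] and \<pi>' = right_dual_hom[OF \<pi>]
  have AM: "a \<in> A \<Longrightarrow> a \<in> carrier M" for a using A(2) by blast
  have basis': "(\<lambda>a. a \<odot>\<^sub>r\<^bsub>M\<^esub> \<pi> a x) \<in> A \<rightarrow> carrier M" if "x \<in> carrier M" for x
    using AM \<pi>'(1) that by auto
  have expand: "(\<Oplus>a\<in>A. h (a \<odot>\<^sub>r\<^bsub>M\<^esub> \<pi> a x)) = h x"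
    if "x \<in> carrier M" "\<And>x. x \<in> carrier M \<Longrightarrow> h x \<in> carrier T"
      "\<And>x y. \<lbrakk>x \<in> carrier M; y \<in> carrier M\<rbrakk> \<Longrightarrow> h (x \<oplus>\<^bsub>M\<^esub> y) = h x \<oplus> h y" for h x
    using additive_map_finsum[OF M.abelian_group_axioms R.abelian_group_axioms that(2,3) A(1) basis'[OF that(1)]]
      basis[OF that(1)] by simp
  \<comment> \<open>This is f_a = sum of \<pi>_a(n_i) g_i, where \<open>R\<close> acts on the left
    dual through its right action on \<open>M\<close>.\<close>
  define f where "f a m = (\<Oplus>i\<in>I. g i (m \<odot>\<^sub>r\<^bsub>M\<^esub> \<pi> a (n i)))" for a m
  have gc: "g i (m \<odot>\<^sub>r\<^bsub>M\<^esub> \<pi> a x) \<in> carrier T" if "i \<in> I" "a \<in> A" "m \<in> carrier M" "x \<in> carrier M" for i a m x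
    using g(1)[OF that(1)] \<pi>'(1)[OF that(2)] that(3,4) by auto
  have "casimir_system T R M A (\<lambda>a. a) f (\<lambda>t i j. \<pi> i (t \<odot>\<^bsub>M\<^esub> j))"
  proof (intro casimir_system.intro bimodule_axioms casimir_system_axioms.intro)
    show "finite A" by (rule A(1))
    show "a \<in> carrier M" if "a \<in> A" for a using AM that .
    show "\<pi> i (t \<odot>\<^bsub>M\<^esub> j) \<in> carrier R" if "t \<in> carrier T" "i \<in> A" "j \<in> A" for t i j
      using \<pi>'(1) AM that by simp
    show "t \<odot>\<^bsub>M\<^esub> l = (\<Oplus>\<^bsub>M\<^esub>j\<in>A. j \<odot>\<^sub>r\<^bsub>M\<^esub> \<pi> j (t \<odot>\<^bsub>M\<^esub> l))" if "t \<in> carrier T" "l \<in> A" for t l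
      by (rule basis) (use AM that in simp)
    show "f a \<in> lmod_hom T M (regular_bimodule T)" if a: "a \<in> A" for a
    proof (rule lmod_homI, unfold regular_bimodule_simps)
      show "f a x \<in> carrier T" if "x \<in> carrier M" for x
        unfolding f_def by (rule R.finsum_closed) (use gc[OF _ a that n] in auto)
    next
      fix x y assume xy: "x \<in> carrier M" "y \<in> carrier M"
      have "f a (x \<oplus>\<^bsub>M\<^esub> y) = (\<Oplus>i\<in>I. g i (x \<odot>\<^sub>r\<^bsub>M\<^esub> \<pi> a (n i)) \<oplus> g i (y \<odot>\<^sub>r\<^bsub>M\<^esub> \<pi> a (n i)))"
        unfolding f_def
        by (rule R.finsum_cong') (use gc[OF _ a xy(1) n] gc[OF _ a xy(2) n] g(2) \<pi>'(1)[OF a n] xy in \<open>auto simp: rsmult_distr\<close>)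
      also have "\<dots> = f a x \<oplus> f a y"
        unfolding f_def by (rule R.finsum_addf) (use gc[OF _ a xy(1) n] gc[OF _ a xy(2) n] in auto)
      finally show "f a (x \<oplus>\<^bsub>M\<^esub> y) = f a x \<oplus> f a y" .
    next
      fix t x assume tx: "t \<in> carrier T" "x \<in> carrier M"
      have "t \<otimes> f a x = (\<Oplus>i\<in>I. t \<otimes> g i (x \<odot>\<^sub>r\<^bsub>M\<^esub> \<pi> a (n i)))"
        unfolding f_def by (rule R.finsum_rdistr[OF I tx(1)]) (use gc[OF _ a tx(2) n] in auto)
      also have "\<dots> = f a (t \<odot>\<^bsub>M\<^esub> x)"
        unfolding f_def
        by (rule R.finsum_cong') (use gc[OF _ a smult_closed[OF tx] n] g(3) \<pi>'(1)[OF a n] tx in \<open>auto simp: smult_rsmult\<close>)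
      finally show "f a (t \<odot>\<^bsub>M\<^esub> x) = t \<otimes> f a x" by simp
    qed
    have "(\<Oplus>a\<in>A. f a a) = (\<Oplus>i\<in>I. \<Oplus>a\<in>A. g i (a \<odot>\<^sub>r\<^bsub>M\<^esub> \<pi> a (n i)))"
      unfolding f_def by (rule R.finsum_swap[OF A(1) I]) (use gc AM n in auto)
    also have "\<dots> = (\<Oplus>i\<in>I. g i (n i))"
      by (rule R.finsum_cong') (use g n expand in auto)
    finally show "(\<Oplus>a\<in>A. f a a) = \<one>" using one by simp
    show "f j m \<otimes> t = (\<Oplus>l\<in>A. f l (m \<odot>\<^sub>r\<^bsub>M\<^esub> \<pi> j (t \<odot>\<^bsub>M\<^esub> l)))"
      if t: "t \<in> carrier T" and j: "j \<in> A" and m: "m \<in> carrier M" for t j m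
    proof -
      \<comment> \<open>Applies \<pi>_j to the first factor, lets the result act on the second and
        evaluates at \<open>m\<close>. Centrality tested with this map is the relation for f_j
        t.\<close>
      let ?\<beta> = "\<lambda>x h. h (m \<odot>\<^sub>r\<^bsub>M\<^esub> \<pi> j x)"
      have bal: "balanced T R M ?D ?\<beta>"
        unfolding balanced_def using left_dual_hom \<pi>'[OF j] m
        by (simp add: left_dual_simps(2,3) rsmult_distr rsmult_assoc)
      have "f j m \<otimes> t = (\<Oplus>i\<in>I. g i (m \<odot>\<^sub>r\<^bsub>M\<^esub> \<pi> j (n i)) \<otimes> t)"
        unfolding f_def by (rule R.finsum_ldistr[OF I t]) (use gc[OF _ j m n] in auto)
      also have "\<dots> = (\<Oplus>i\<in>I. ?\<beta> (n i) (g i \<odot>\<^sub>r\<^bsub>?D\<^esub> t))"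
        by (rule R.finsum_cong') (use gc[OF _ j m n] t \<pi>'(1)[OF j n] m in \<open>auto simp: left_dual_simps(4)\<close>)
      also have "\<dots> = (\<Oplus>i\<in>I. ?\<beta> (t \<odot>\<^bsub>M\<^esub> n i) (g i))"
        by (rule central[rule_format, OF bal t, symmetric])
      \<comment> \<open>The \<open>n i\<close> are expanded in the basis once more, now inside
        \<pi>_j(t n_i), which brings out the matrix entries \<pi>_j(t l).\<close>
      also have "\<dots> = (\<Oplus>i\<in>I. \<Oplus>l\<in>A. g i (m \<odot>\<^sub>r\<^bsub>M\<^esub> \<pi> j (t \<odot>\<^bsub>M\<^esub> (l \<odot>\<^sub>r\<^bsub>M\<^esub> \<pi> l (n i)))))"
      proof (rule R.finsum_cong'[OF refl])
        fix i assume i: "i \<in> I"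
        show "?\<beta> (t \<odot>\<^bsub>M\<^esub> n i) (g i) = (\<Oplus>l\<in>A. g i (m \<odot>\<^sub>r\<^bsub>M\<^esub> \<pi> j (t \<odot>\<^bsub>M\<^esub> (l \<odot>\<^sub>r\<^bsub>M\<^esub> \<pi> l (n i)))))"
          by (rule expand[of "n i" "\<lambda>x. g i (m \<odot>\<^sub>r\<^bsub>M\<^esub> \<pi> j (t \<odot>\<^bsub>M\<^esub> x))", symmetric])
            (use g[OF i] \<pi>'[OF j] n[OF i] m t in \<open>auto simp: smult_r_distr rsmult_distr\<close>)
      qed (use gc AM n \<pi>'(1) t m j in \<open>auto intro!: R.finsum_closed\<close>)
      also have "\<dots> = (\<Oplus>i\<in>I. \<Oplus>l\<in>A. g i ((m \<odot>\<^sub>r\<^bsub>M\<^esub> \<pi> j (t \<odot>\<^bsub>M\<^esub> l)) \<odot>\<^sub>r\<^bsub>M\<^esub> \<pi> l (n i)))"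
      proof (rule R.finsum_cong'[OF refl])
        fix i assume i: "i \<in> I"
        show "(\<Oplus>l\<in>A. g i (m \<odot>\<^sub>r\<^bsub>M\<^esub> \<pi> j (t \<odot>\<^bsub>M\<^esub> (l \<odot>\<^sub>r\<^bsub>M\<^esub> \<pi> l (n i))))) =
            (\<Oplus>l\<in>A. g i ((m \<odot>\<^sub>r\<^bsub>M\<^esub> \<pi> j (t \<odot>\<^bsub>M\<^esub> l)) \<odot>\<^sub>r\<^bsub>M\<^esub> \<pi> l (n i)))"
        proof (rule R.finsum_cong'[OF refl])
          fix l assume l: "l \<in> A"
          have "\<pi> j (t \<odot>\<^bsub>M\<^esub> (l \<odot>\<^sub>r\<^bsub>M\<^esub> \<pi> l (n i))) = \<pi> j (t \<odot>\<^bsub>M\<^esub> l) \<otimes>\<^bsub>R\<^esub> \<pi> l (n i)"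
            using \<pi>'(3)[OF j \<pi>'(1)[OF l n[OF i]], of "t \<odot>\<^bsub>M\<^esub> l"] smult_rsmult[OF t AM[OF l] \<pi>'(1)[OF l n[OF i]]] AM[OF l] t
            by simp
          then show "g i (m \<odot>\<^sub>r\<^bsub>M\<^esub> \<pi> j (t \<odot>\<^bsub>M\<^esub> (l \<odot>\<^sub>r\<^bsub>M\<^esub> \<pi> l (n i)))) =
              g i ((m \<odot>\<^sub>r\<^bsub>M\<^esub> \<pi> j (t \<odot>\<^bsub>M\<^esub> l)) \<odot>\<^sub>r\<^bsub>M\<^esub> \<pi> l (n i))"
            using rsmult_assoc[OF m \<pi>'(1)[OF j, of "t \<odot>\<^bsub>M\<^esub> l"] \<pi>'(1)[OF l n[OF i]]] AM[OF l] t by simp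
        qed (use g(1)[OF i] AM n[OF i] \<pi>'(1) t m j in auto)
      qed (use g(1) AM n \<pi>'(1) t m j in \<open>auto intro!: R.finsum_closed\<close>)
      also have "\<dots> = (\<Oplus>l\<in>A. f l (m \<odot>\<^sub>r\<^bsub>M\<^esub> \<pi> j (t \<odot>\<^bsub>M\<^esub> l)))"
        unfolding f_def by (rule R.finsum_swap[OF I A(1)]) (use g(1) AM n \<pi>'(1) t m j in auto)
      finally show ?thesis .
    qed
  qed
  then show ?thesis by blast
qed

text \<open>The coordinate functions \<open>\<pi> a\<close> generate the dual: by linearity g(x) is
  the sum of g(a) \<pi>_a(x).\<close>

lemma right_dual_expand:
  assumes A: "finite A" "A \<subseteq> carrier M" and D: "left_module R (right_dual T R M)"
    and \<pi>: "\<And>a. a \<in> A \<Longrightarrow> \<pi> a \<in> lmod_hom (op_ring R) (right_part M) (regular_bimodule (op_ring R))"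
    and basis: "\<And>x. x \<in> carrier M \<Longrightarrow> x = (\<Oplus>\<^bsub>M\<^esub>a\<in>A. a \<odot>\<^sub>r\<^bsub>M\<^esub> \<pi> a x)"
  shows "a \<in> A \<Longrightarrow> (\<lambda>x\<in>carrier M. \<pi> a x) \<in> carrier (right_dual T R M)"
    and "g \<in> carrier (right_dual T R M) \<Longrightarrow> g = (\<Oplus>\<^bsub>right_dual T R M\<^esub>a\<in>A.
      g a \<odot>\<^bsub>right_dual T R M\<^esub> (\<lambda>x\<in>carrier M. \<pi> a x))"
proof -
  let ?D = "right_dual T R M"
  interpret D: left_module R ?D by (rule D)
  note \<pi>' = right_dual_hom[OF \<pi>]
  have AM: "a \<in> A \<Longrightarrow> a \<in> carrier M" for a using A(2) by blast
  show \<pi>D: "(\<lambda>x\<in>carrier M. \<pi> a x) \<in> carrier ?D" if "a \<in> A" for a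
    using \<pi>[OF that] by (simp add: right_dual_simps lmod_hom_def Pi_def)
  assume gD: "g \<in> carrier ?D"
  note g = right_dual_hom[OF gD[unfolded right_dual_simps(1), THEN conjunct1]]
  have cl: "(\<lambda>a. g a \<odot>\<^bsub>?D\<^esub> (\<lambda>x\<in>carrier M. \<pi> a x)) \<in> A \<rightarrow> carrier ?D"
    using \<pi>D g(1) AM by auto
  show "g = (\<Oplus>\<^bsub>?D\<^esub>a\<in>A. g a \<odot>\<^bsub>?D\<^esub> (\<lambda>x\<in>carrier M. \<pi> a x))"
  proof (rule extensionalityI[where A = "carrier M"])
    show "g \<in> extensional (carrier M)" using gD by (simp add: right_dual_simps(1))
    show "(\<Oplus>\<^bsub>?D\<^esub>a\<in>A. g a \<odot>\<^bsub>?D\<^esub> (\<lambda>x\<in>carrier M. \<pi> a x)) \<in> extensional (carrier M)"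
      using D.M.finsum_closed[OF cl] by (simp add: right_dual_simps(1))
    fix x assume x: "x \<in> carrier M"
    have "g x = (\<Oplus>\<^bsub>R\<^esub>a\<in>A. g (a \<odot>\<^sub>r\<^bsub>M\<^esub> \<pi> a x))"
      using additive_map_finsum[OF M.abelian_group_axioms right_ring.abelian_group_axioms g(1,2) A(1),
          of "\<lambda>a. a \<odot>\<^sub>r\<^bsub>M\<^esub> \<pi> a x"] basis[OF x] AM \<pi>'(1)[OF _ x] by auto
    also have "\<dots> = (\<Oplus>\<^bsub>R\<^esub>a\<in>A. (g a \<odot>\<^bsub>?D\<^esub> (\<lambda>x\<in>carrier M. \<pi> a x)) x)"
      by (rule right_ring.finsum_cong') (use g AM \<pi>'(1)[OF _ x] x in \<open>auto simp: right_dual_simps(3)\<close>)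
    also have "\<dots> = (\<Oplus>\<^bsub>?D\<^esub>a\<in>A. g a \<odot>\<^bsub>?D\<^esub> (\<lambda>x\<in>carrier M. \<pi> a x)) x"
      by (rule additive_map_finsum[where h = "\<lambda>h. h x", OF D.M.abelian_group_axioms right_ring.abelian_group_axioms _ _ A(1) cl, symmetric])
        (use x right_dual_hom(1)[of _ x] in \<open>auto simp: right_dual_simps(1,2)\<close>)
    finally show "g x = (\<Oplus>\<^bsub>?D\<^esub>a\<in>A. g a \<odot>\<^bsub>?D\<^esub> (\<lambda>x\<in>carrier M. \<pi> a x)) x" .
  qed
qed

lemma fin_gen_right_dual:
  assumes A: "finite A" "A \<subseteq> carrier M" and D: "left_module R (right_dual T R M)"
    and \<pi>: "\<And>a. a \<in> A \<Longrightarrow> \<pi> a \<in> lmod_hom (op_ring R) (right_part M) (regular_bimodule (op_ring R))"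
    and basis: "\<And>x. x \<in> carrier M \<Longrightarrow> x = (\<Oplus>\<^bsub>M\<^esub>a\<in>A. a \<odot>\<^sub>r\<^bsub>M\<^esub> \<pi> a x)"
  shows "fin_gen_module R (right_dual T R M)"
proof -
  let ?D = "right_dual T R M" and ?p = "\<lambda>a. \<lambda>x\<in>carrier M. \<pi> a x"
  interpret D: left_module R ?D by (rule D)
  have exp1: "?p a \<in> carrier ?D" if "a \<in> A" for a
    by (rule right_dual_expand(1)[OF A D \<pi> basis that])
  have exp2: "u = (\<Oplus>\<^bsub>?D\<^esub>a\<in>A. u a \<odot>\<^bsub>?D\<^esub> ?p a)" if "u \<in> carrier ?D" for u
    by (rule right_dual_expand(2)[OF A D \<pi> basis that])
  show ?thesis
    unfolding D.fin_gen_module_iff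
  proof (intro exI[of _ "?p ` A"] conjI allI impI)
    show "finite (?p ` A)" using A(1) by simp
    show "?p ` A \<subseteq> carrier ?D" using exp1 by auto
    fix S assume S: "submodule S R ?D \<and> ?p ` A \<subseteq> S"
    then have S': "submodule S R ?D" "?p ` A \<subseteq> S" by blast+
    have "g \<in> S" if g: "g \<in> carrier ?D" for g
    proof -
      have "g a \<in> carrier R" if "a \<in> A" for a
        using right_dual_hom(1)[OF g[unfolded right_dual_simps(1), THEN conjunct1]] that A(2) by blast
      then have "(\<Oplus>\<^bsub>?D\<^esub>a\<in>A. g a \<odot>\<^bsub>?D\<^esub> ?p a) \<in> S"
        by (intro D.submodule_finsum[OF S'(1) A(1)]) (use S'(2) submoduleD(4)[OF S'(1)] in auto)
      then show ?thesis using exp2[OF g] by simp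
    qed
    then show "S = carrier ?D" using submoduleD(1)[OF S'(1)] by blast
  qed
qed

text \<open>The dual of \<open>M\<close> is not known to be finitely generated over \<open>T\<close>
  on the right, so the basis expansion takes place in the second tensor factor. That factor, the
  left dual of the dual, is \<open>M\<close> by reflexivity, where the basis \<open>B\<close> over
  \<open>T\<close> is available; the functionals of the system are the evaluations at
  \<open>b\<close>.\<close>

lemma dual_casimir_system_of_separable:
  assumes sep: "separable_bimodule R T (right_dual T R M)" and A: "finite A" "A \<subseteq> carrier M"
    and \<pi>: "\<And>a. a \<in> A \<Longrightarrow> \<pi> a \<in> lmod_hom (op_ring R) (right_part M) (regular_bimodule (op_ring R))"
    and basis: "\<And>x. x \<in> carrier M \<Longrightarrow> x = (\<Oplus>\<^bsub>M\<^esub>a\<in>A. a \<odot>\<^sub>r\<^bsub>M\<^esub> \<pi> a x)"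
    and B: "finite B" "B \<subseteq> carrier M" and \<chi>: "\<And>b. b \<in> B \<Longrightarrow> \<chi> b \<in> lmod_hom T M (regular_bimodule T)"
    and basis_left: "\<And>x. x \<in> carrier M \<Longrightarrow> x = (\<Oplus>\<^bsub>M\<^esub>b\<in>B. \<chi> b x \<odot>\<^bsub>M\<^esub> b)"
  shows "\<exists>\<gamma>. casimir_system R T (right_dual T R M) B \<gamma> (\<lambda>b g. g b) (\<lambda>r i j. \<chi> j (i \<odot>\<^sub>r\<^bsub>M\<^esub> r))"
proof -
  let ?D = "right_dual T R M"
  let ?L = "left_dual R T ?D"
  have bD: "bimodule R T ?D" using sep by (simp add: separable_bimodule_def)
  interpret D: bimodule R T ?D by (rule bD)
  obtain I :: "(('m \<Rightarrow> 'r) \<times> (('m \<Rightarrow> 'r) \<Rightarrow> 'r)) set" and g h where I: "finite I"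
    and gh: "\<forall>i\<in>I. g i \<in> carrier ?D \<and> h i \<in> carrier ?L"
    and one: "(\<Oplus>\<^bsub>R\<^esub>i\<in>I. h i (g i)) = \<one>\<^bsub>R\<^esub>"
    and central: "\<forall>\<beta>. balanced R T ?D ?L \<beta> \<longrightarrow> (\<forall>r\<in>carrier R.
      (\<Oplus>\<^bsub>R\<^esub>i\<in>I. \<beta> (r \<odot>\<^bsub>?D\<^esub> g i) (h i)) = (\<Oplus>\<^bsub>R\<^esub>i\<in>I. \<beta> (g i) (h i \<odot>\<^sub>r\<^bsub>?L\<^esub> r)))"
    using D.separable_casimir[OF sep] by (elim exE conjE) (rule that)
  have gD: "g i \<in> carrier ?D" and hL: "h i \<in> carrier ?L" if "i \<in> I" for i using gh that by blast+
  have Dhom: "u \<in> carrier ?D \<Longrightarrow> u \<in> lmod_hom (op_ring R) (right_part M) (regular_bimodule (op_ring R))" for u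
    by (simp add: right_dual_simps(1))
  note Dh = right_dual_hom[OF Dhom] and \<pi>' = right_dual_hom[OF \<pi>]
  have \<chi>': "x \<in> carrier M \<Longrightarrow> \<chi> b x \<in> carrier T"
    "\<lbrakk>x \<in> carrier M; y \<in> carrier M\<rbrakk> \<Longrightarrow> \<chi> b (x \<oplus>\<^bsub>M\<^esub> y) = \<chi> b x \<oplus> \<chi> b y"
    "\<lbrakk>t \<in> carrier T; x \<in> carrier M\<rbrakk> \<Longrightarrow> \<chi> b (t \<odot>\<^bsub>M\<^esub> x) = t \<otimes> \<chi> b x" if "b \<in> B" for b x y t
    using lmod_homD[OF \<chi>[OF that]] by simp_all
  have AM: "a \<in> A \<Longrightarrow> a \<in> carrier M" and BM: "b \<in> B \<Longrightarrow> b \<in> carrier M" for a b using A(2) B(2) by blast+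
  let ?p = "\<lambda>a. \<lambda>x\<in>carrier M. \<pi> a x"
  have exp1: "?p a \<in> carrier ?D" if "a \<in> A" for a
    by (rule right_dual_expand(1)[OF A D.left_module_axioms \<pi> basis that])
  have exp2: "u = (\<Oplus>\<^bsub>?D\<^esub>a\<in>A. u a \<odot>\<^bsub>?D\<^esub> ?p a)" if "u \<in> carrier ?D" for u
    by (rule right_dual_expand(2)[OF A D.left_module_axioms \<pi> basis that])
  \<comment> \<open>The dual separates the points of \<open>M\<close>, as the coordinates do; this
    makes \<open>\<mu>\<close> below unique and hence compatible with all operations.\<close>
  have separated: "m = m'" if m: "m \<in> carrier M" "m' \<in> carrier M" and eq: "\<And>u. u \<in> carrier ?D \<Longrightarrow> u m = u m'" for m m'
  proof -
    have "\<pi> a m = \<pi> a m'" if "a \<in> A" for a using eq[OF exp1[OF that]] m by simp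
    then have "(\<Oplus>\<^bsub>M\<^esub>a\<in>A. a \<odot>\<^sub>r\<^bsub>M\<^esub> \<pi> a m) = (\<Oplus>\<^bsub>M\<^esub>a\<in>A. a \<odot>\<^sub>r\<^bsub>M\<^esub> \<pi> a m')"
      by (intro M.finsum_cong') (use AM \<pi>'(1) m in auto)
    then show ?thesis using basis[OF m(1)] basis[OF m(2)] by simp
  qed
  \<comment> \<open>Reflexivity: a functional \<open>w\<close> on the dual is evaluation at the
    element with coefficients \<open>w (?p a)\<close>.\<close>
  have "\<exists>m\<in>carrier M. \<forall>u\<in>carrier ?D. u m = w u" if w: "w \<in> carrier ?L" for w
  proof (intro bexI ballI)
    have wp: "w (?p a) \<in> carrier R" if "a \<in> A" for a by (rule D.left_dual_hom(1)[OF w exp1[OF that]])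
    have cl: "(\<lambda>a. a \<odot>\<^sub>r\<^bsub>M\<^esub> w (?p a)) \<in> A \<rightarrow> carrier M" using AM wp by auto
    show "(\<Oplus>\<^bsub>M\<^esub>a\<in>A. a \<odot>\<^sub>r\<^bsub>M\<^esub> w (?p a)) \<in> carrier M" by (rule M.finsum_closed[OF cl])
    fix u assume u: "u \<in> carrier ?D"
    have "u (\<Oplus>\<^bsub>M\<^esub>a\<in>A. a \<odot>\<^sub>r\<^bsub>M\<^esub> w (?p a)) = (\<Oplus>\<^bsub>R\<^esub>a\<in>A. u (a \<odot>\<^sub>r\<^bsub>M\<^esub> w (?p a)))"
      by (rule additive_map_finsum[OF M.abelian_group_axioms right_ring.abelian_group_axioms Dh(1,2)[OF u] A(1) cl])
    also have "\<dots> = (\<Oplus>\<^bsub>R\<^esub>a\<in>A. w (u a \<odot>\<^bsub>?D\<^esub> ?p a))"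
      by (rule right_ring.finsum_cong')
        (use Dh(1,3)[OF u] D.left_dual_hom(3)[OF w _ exp1] AM wp in auto)
    also have "\<dots> = w (\<Oplus>\<^bsub>?D\<^esub>a\<in>A. u a \<odot>\<^bsub>?D\<^esub> ?p a)"
      by (rule additive_map_finsum[where h = w, OF D.M.abelian_group_axioms right_ring.abelian_group_axioms _ _ A(1), symmetric])
        (use D.left_dual_hom(1,2)[OF w] exp1 Dh(1)[OF u] AM in auto)
    finally show "u (\<Oplus>\<^bsub>M\<^esub>a\<in>A. a \<odot>\<^sub>r\<^bsub>M\<^esub> w (?p a)) = w u" using exp2[OF u] by simp
  qed
  then obtain \<mu> where \<mu>: "\<And>w. w \<in> carrier ?L \<Longrightarrow> \<mu> w \<in> carrier M"
    and eval: "\<And>w u. w \<in> carrier ?L \<Longrightarrow> u \<in> carrier ?D \<Longrightarrow> u (\<mu> w) = w u" by metis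
  have \<mu>_add: "\<mu> (v \<oplus>\<^bsub>?L\<^esub> w) = \<mu> v \<oplus>\<^bsub>M\<^esub> \<mu> w" if v: "v \<in> carrier ?L" and w: "w \<in> carrier ?L" for v w
  proof (rule separated)
    fix u assume u: "u \<in> carrier ?D"
    have "u (\<mu> (v \<oplus>\<^bsub>?L\<^esub> w)) = v u \<oplus>\<^bsub>R\<^esub> w u"
      unfolding eval[OF D.left_dual_closed(1)[OF v w] u] using u by (simp add: left_dual_simps(2))
    also have "\<dots> = u (\<mu> v \<oplus>\<^bsub>M\<^esub> \<mu> w)"
      using Dh(2)[OF u \<mu>[OF v] \<mu>[OF w]] eval[OF v u] eval[OF w u] by simp
    finally show "u (\<mu> (v \<oplus>\<^bsub>?L\<^esub> w)) = u (\<mu> v \<oplus>\<^bsub>M\<^esub> \<mu> w)" .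
  qed (use \<mu> D.left_dual_closed(1) v w in auto)
  have \<mu>_smult: "\<mu> (t \<odot>\<^bsub>?L\<^esub> w) = t \<odot>\<^bsub>M\<^esub> \<mu> w" if t: "t \<in> carrier T" and w: "w \<in> carrier ?L" for t w
  proof (rule separated)
    fix u assume u: "u \<in> carrier ?D"
    have "u (\<mu> (t \<odot>\<^bsub>?L\<^esub> w)) = w (u \<odot>\<^sub>r\<^bsub>?D\<^esub> t)"
      unfolding eval[OF D.left_dual_closed(2)[OF w t] u] using u by (simp add: left_dual_simps(3))
    also have "\<dots> = (u \<odot>\<^sub>r\<^bsub>?D\<^esub> t) (\<mu> w)"
      by (rule eval[symmetric]) (use w u t in auto)
    also have "\<dots> = u (t \<odot>\<^bsub>M\<^esub> \<mu> w)" using \<mu>[OF w] by (simp add: right_dual_simps(4))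
    finally show "u (\<mu> (t \<odot>\<^bsub>?L\<^esub> w)) = u (t \<odot>\<^bsub>M\<^esub> \<mu> w)" .
  qed (use \<mu> D.left_dual_closed(2) t w in auto)
  have \<mu>_rsmult: "\<mu> (w \<odot>\<^sub>r\<^bsub>?L\<^esub> r) = \<mu> w \<odot>\<^sub>r\<^bsub>M\<^esub> r" if r: "r \<in> carrier R" and w: "w \<in> carrier ?L" for r w
  proof (rule separated)
    fix u assume u: "u \<in> carrier ?D"
    have "u (\<mu> (w \<odot>\<^sub>r\<^bsub>?L\<^esub> r)) = w u \<otimes>\<^bsub>R\<^esub> r"
      unfolding eval[OF D.left_dual_closed(3)[OF w r] u] using u by (simp add: left_dual_simps(4))
    also have "\<dots> = u (\<mu> w \<odot>\<^sub>r\<^bsub>M\<^esub> r)"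
      using Dh(3)[OF u r \<mu>[OF w]] eval[OF w u] by simp
    finally show "u (\<mu> (w \<odot>\<^sub>r\<^bsub>?L\<^esub> r)) = u (\<mu> w \<odot>\<^sub>r\<^bsub>M\<^esub> r)" .
  qed (use \<mu> D.left_dual_closed(3) r w in auto)
  \<comment> \<open>Expanding \<open>\<mu> (h i)\<close> in \<open>B\<close> and moving the
    coefficients across the tensor leaves, in front of each \<open>b\<close>, the sum of the g_i
    \<chi>_b(\<mu>(h_i)), with \<open>T\<close> acting on the dual from the right.\<close>
  define \<gamma> where "\<gamma> b = (\<lambda>x\<in>carrier M. \<Oplus>\<^bsub>R\<^esub>i\<in>I. g i (\<chi> b (\<mu> (h i)) \<odot>\<^bsub>M\<^esub> x))" for b
  have gc: "g i (\<chi> b y \<odot>\<^bsub>M\<^esub> x) \<in> carrier R" if "i \<in> I" "b \<in> B" "x \<in> carrier M" "y \<in> carrier M" for i b x y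
    using Dh(1)[OF gD[OF that(1)]] \<chi>'(1)[OF that(2)] that(3,4) by auto
  have \<mu>h: "\<mu> (h i) \<in> carrier M" if "i \<in> I" for i using \<mu>[OF hL[OF that]] .
  have expand: "(\<Oplus>\<^bsub>R\<^esub>b\<in>B. k (\<chi> b x \<odot>\<^bsub>M\<^esub> b)) = k x"
    if "x \<in> carrier M" "\<And>x. x \<in> carrier M \<Longrightarrow> k x \<in> carrier R"
      "\<And>x y. \<lbrakk>x \<in> carrier M; y \<in> carrier M\<rbrakk> \<Longrightarrow> k (x \<oplus>\<^bsub>M\<^esub> y) = k x \<oplus>\<^bsub>R\<^esub> k y" for k x
  proof -
    have "(\<lambda>b. \<chi> b x \<odot>\<^bsub>M\<^esub> b) \<in> B \<rightarrow> carrier M" using \<chi>'(1) BM that(1) by auto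
    from additive_map_finsum[OF M.abelian_group_axioms right_ring.abelian_group_axioms that(2,3) B(1) this]
    show ?thesis using basis_left[OF that(1)] by simp
  qed
  have "casimir_system R T ?D B \<gamma> (\<lambda>b g. g b) (\<lambda>r i j. \<chi> j (i \<odot>\<^sub>r\<^bsub>M\<^esub> r))"
  proof (intro casimir_system.intro bD casimir_system_axioms.intro)
    show "finite B" by (rule B(1))
    show \<gamma>D: "\<gamma> b \<in> carrier ?D" if b: "b \<in> B" for b
    proof -
      have cl: "(\<lambda>i. g i (\<chi> b (\<mu> (h i)) \<odot>\<^bsub>M\<^esub> x)) \<in> I \<rightarrow> carrier R" if "x \<in> carrier M" for x
        using gc[OF _ b that \<mu>h] by auto
      have "(\<lambda>x. \<Oplus>\<^bsub>R\<^esub>i\<in>I. g i (\<chi> b (\<mu> (h i)) \<odot>\<^bsub>M\<^esub> x))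
          \<in> lmod_hom (op_ring R) (right_part M) (regular_bimodule (op_ring R))"
      proof (rule lmod_homI, unfold regular_bimodule_simps right_part_simps op_ring_simps)
        show "(\<Oplus>\<^bsub>R\<^esub>i\<in>I. g i (\<chi> b (\<mu> (h i)) \<odot>\<^bsub>M\<^esub> x)) \<in> carrier R" if "x \<in> carrier M" for x
          by (rule right_ring.finsum_closed[OF cl[OF that]])
      next
        fix x y assume xy: "x \<in> carrier M" "y \<in> carrier M"
        have "(\<Oplus>\<^bsub>R\<^esub>i\<in>I. g i (\<chi> b (\<mu> (h i)) \<odot>\<^bsub>M\<^esub> (x \<oplus>\<^bsub>M\<^esub> y))) =
            (\<Oplus>\<^bsub>R\<^esub>i\<in>I. g i (\<chi> b (\<mu> (h i)) \<odot>\<^bsub>M\<^esub> x) \<oplus>\<^bsub>R\<^esub> g i (\<chi> b (\<mu> (h i)) \<odot>\<^bsub>M\<^esub> y))"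
          by (rule right_ring.finsum_cong')
            (use cl[OF xy(1)] cl[OF xy(2)] Dh(2)[OF gD] \<chi>'(1)[OF b \<mu>h] xy in \<open>auto simp: smult_r_distr\<close>)
        also have "\<dots> = (\<Oplus>\<^bsub>R\<^esub>i\<in>I. g i (\<chi> b (\<mu> (h i)) \<odot>\<^bsub>M\<^esub> x)) \<oplus>\<^bsub>R\<^esub> (\<Oplus>\<^bsub>R\<^esub>i\<in>I. g i (\<chi> b (\<mu> (h i)) \<odot>\<^bsub>M\<^esub> y))"
          by (rule right_ring.finsum_addf[OF cl[OF xy(1)] cl[OF xy(2)]])
        finally show "(\<Oplus>\<^bsub>R\<^esub>i\<in>I. g i (\<chi> b (\<mu> (h i)) \<odot>\<^bsub>M\<^esub> (x \<oplus>\<^bsub>M\<^esub> y))) =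
          (\<Oplus>\<^bsub>R\<^esub>i\<in>I. g i (\<chi> b (\<mu> (h i)) \<odot>\<^bsub>M\<^esub> x)) \<oplus>\<^bsub>R\<^esub> (\<Oplus>\<^bsub>R\<^esub>i\<in>I. g i (\<chi> b (\<mu> (h i)) \<odot>\<^bsub>M\<^esub> y))" .
      next
        fix r x assume rx: "r \<in> carrier R" "x \<in> carrier M"
        have "(\<Oplus>\<^bsub>R\<^esub>i\<in>I. g i (\<chi> b (\<mu> (h i)) \<odot>\<^bsub>M\<^esub> x)) \<otimes>\<^bsub>R\<^esub> r =
            (\<Oplus>\<^bsub>R\<^esub>i\<in>I. g i (\<chi> b (\<mu> (h i)) \<odot>\<^bsub>M\<^esub> x) \<otimes>\<^bsub>R\<^esub> r)"
          by (rule right_ring.finsum_ldistr[OF I rx(1) cl[OF rx(2)]])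
        also have "\<dots> = (\<Oplus>\<^bsub>R\<^esub>i\<in>I. g i (\<chi> b (\<mu> (h i)) \<odot>\<^bsub>M\<^esub> (x \<odot>\<^sub>r\<^bsub>M\<^esub> r)))"
          by (rule right_ring.finsum_cong')
            (use cl[OF rsmult_closed[OF rx(2,1)]] Dh(3)[OF gD] \<chi>'(1)[OF b \<mu>h] rx in \<open>auto simp: smult_rsmult[symmetric]\<close>)
        finally show "(\<Oplus>\<^bsub>R\<^esub>i\<in>I. g i (\<chi> b (\<mu> (h i)) \<odot>\<^bsub>M\<^esub> (x \<odot>\<^sub>r\<^bsub>M\<^esub> r))) =
          (\<Oplus>\<^bsub>R\<^esub>i\<in>I. g i (\<chi> b (\<mu> (h i)) \<odot>\<^bsub>M\<^esub> x)) \<otimes>\<^bsub>R\<^esub> r" by simp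
      qed
      then show ?thesis by (simp add: \<gamma>_def right_dual_simps(1) lmod_hom_def Pi_def)
    qed
    show "(\<lambda>g. g b) \<in> lmod_hom R ?D (regular_bimodule R)" if "b \<in> B" for b
      by (rule lmod_homI) (use Dh(1) BM[OF that] in \<open>simp_all add: right_dual_simps(2,3)\<close>)
    show "\<chi> j (i \<odot>\<^sub>r\<^bsub>M\<^esub> r) \<in> carrier T" if "r \<in> carrier R" "i \<in> B" "j \<in> B" for r i j
      using \<chi>'(1) BM that by simp
    have "(\<Oplus>\<^bsub>R\<^esub>b\<in>B. \<gamma> b b) = (\<Oplus>\<^bsub>R\<^esub>b\<in>B. \<Oplus>\<^bsub>R\<^esub>i\<in>I. g i (\<chi> b (\<mu> (h i)) \<odot>\<^bsub>M\<^esub> b))"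
      by (rule right_ring.finsum_cong') (use gc \<mu>h BM in \<open>auto simp: \<gamma>_def intro!: right_ring.finsum_closed\<close>)
    also have "\<dots> = (\<Oplus>\<^bsub>R\<^esub>i\<in>I. \<Oplus>\<^bsub>R\<^esub>b\<in>B. g i (\<chi> b (\<mu> (h i)) \<odot>\<^bsub>M\<^esub> b))"
      by (rule right_ring.finsum_swap[OF B(1) I]) (use gc \<mu>h BM in auto)
    also have "\<dots> = (\<Oplus>\<^bsub>R\<^esub>i\<in>I. h i (g i))"
    proof (rule right_ring.finsum_cong'[OF refl])
      show "(\<lambda>i. h i (g i)) \<in> I \<rightarrow> carrier R" using D.left_dual_hom(1)[OF hL gD] by auto
      show "(\<Oplus>\<^bsub>R\<^esub>b\<in>B. g i (\<chi> b (\<mu> (h i)) \<odot>\<^bsub>M\<^esub> b)) = h i (g i)" if i: "i \<in> I" for i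
        using expand[OF \<mu>h[OF i] Dh(1,2)[OF gD[OF i]]] eval[OF hL[OF i] gD[OF i]] by simp
    qed
    finally show "(\<Oplus>\<^bsub>R\<^esub>b\<in>B. \<gamma> b b) = \<one>\<^bsub>R\<^esub>" using one by simp
    show "r \<odot>\<^bsub>?D\<^esub> \<gamma> l = (\<Oplus>\<^bsub>?D\<^esub>j\<in>B. \<gamma> j \<odot>\<^sub>r\<^bsub>?D\<^esub> \<chi> l (j \<odot>\<^sub>r\<^bsub>M\<^esub> r))" if r: "r \<in> carrier R" and l: "l \<in> B" for r l
    proof (rule extensionalityI[where A = "carrier M"])
      have cl: "(\<lambda>j. \<gamma> j \<odot>\<^sub>r\<^bsub>?D\<^esub> \<chi> l (j \<odot>\<^sub>r\<^bsub>M\<^esub> r)) \<in> B \<rightarrow> carrier ?D"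
        using \<gamma>D \<chi>'(1)[OF l] BM r by auto
      show "r \<odot>\<^bsub>?D\<^esub> \<gamma> l \<in> extensional (carrier M)" by (simp add: right_dual_simps(3))
      show "(\<Oplus>\<^bsub>?D\<^esub>j\<in>B. \<gamma> j \<odot>\<^sub>r\<^bsub>?D\<^esub> \<chi> l (j \<odot>\<^sub>r\<^bsub>M\<^esub> r)) \<in> extensional (carrier M)"
        using D.M.finsum_closed[OF cl] by (simp add: right_dual_simps(1))
      fix x assume x: "x \<in> carrier M"
      \<comment> \<open>The coefficient \<chi>_l of the second entry acts on the first, and the
        result is evaluated at \<open>x\<close>. Centrality tested with this map computes the action
        of \<open>r\<close> on \<gamma>_l.\<close>
      let ?\<beta> = "\<lambda>u w. u (\<chi> l (\<mu> w) \<odot>\<^bsub>M\<^esub> x)"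
      have bal: "balanced R T ?D ?L ?\<beta>"
        unfolding balanced_def using Dh \<chi>'[OF l] \<mu> x
        by (simp add: right_dual_simps(2,4) \<mu>_add \<mu>_smult smult_l_distr smult_assoc1)
      have "(r \<odot>\<^bsub>?D\<^esub> \<gamma> l) x = (\<Oplus>\<^bsub>R\<^esub>i\<in>I. r \<otimes>\<^bsub>R\<^esub> g i (\<chi> l (\<mu> (h i)) \<odot>\<^bsub>M\<^esub> x))"
        using x right_ring.finsum_rdistr[OF I r, of "\<lambda>i. g i (\<chi> l (\<mu> (h i)) \<odot>\<^bsub>M\<^esub> x)"] gc[OF _ l x \<mu>h]
        by (simp add: right_dual_simps(3) \<gamma>_def Pi_def)
      also have "\<dots> = (\<Oplus>\<^bsub>R\<^esub>i\<in>I. ?\<beta> (r \<odot>\<^bsub>?D\<^esub> g i) (h i))"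
        by (rule right_ring.finsum_cong') (use gc[OF _ l x \<mu>h] r x \<chi>'(1)[OF l \<mu>h] in \<open>auto simp: right_dual_simps(3)\<close>)
      also have "\<dots> = (\<Oplus>\<^bsub>R\<^esub>i\<in>I. ?\<beta> (g i) (h i \<odot>\<^sub>r\<^bsub>?L\<^esub> r))"
        by (rule central[rule_format, OF bal r])
      also have "\<dots> = (\<Oplus>\<^bsub>R\<^esub>i\<in>I. \<Oplus>\<^bsub>R\<^esub>j\<in>B. g i (\<chi> j (\<mu> (h i)) \<odot>\<^bsub>M\<^esub> (\<chi> l (j \<odot>\<^sub>r\<^bsub>M\<^esub> r) \<odot>\<^bsub>M\<^esub> x)))"
      proof (rule right_ring.finsum_cong'[OF refl])
        show "(\<lambda>i. \<Oplus>\<^bsub>R\<^esub>j\<in>B. g i (\<chi> j (\<mu> (h i)) \<odot>\<^bsub>M\<^esub> (\<chi> l (j \<odot>\<^sub>r\<^bsub>M\<^esub> r) \<odot>\<^bsub>M\<^esub> x))) \<in> I \<rightarrow> carrier R"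
          using gc[OF _ _ _ \<mu>h] \<chi>'(1)[OF l] BM r x by (auto intro!: right_ring.finsum_closed)
        fix i assume i: "i \<in> I"
        \<comment> \<open>Under \<open>\<mu>\<close> the right action of \<open>r\<close> on
          \<open>h i\<close> becomes the one on \<open>M\<close>, so expansion in \<open>B\<close>
          produces the entries \<chi>_l(j r).\<close>
        have "?\<beta> (g i) (h i \<odot>\<^sub>r\<^bsub>?L\<^esub> r) = g i (\<chi> l (\<mu> (h i) \<odot>\<^sub>r\<^bsub>M\<^esub> r) \<odot>\<^bsub>M\<^esub> x)"
          using \<mu>_rsmult[OF r hL[OF i]] by simp
        also have "\<dots> = (\<Oplus>\<^bsub>R\<^esub>j\<in>B. g i (\<chi> l ((\<chi> j (\<mu> (h i)) \<odot>\<^bsub>M\<^esub> j) \<odot>\<^sub>r\<^bsub>M\<^esub> r) \<odot>\<^bsub>M\<^esub> x))"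
          by (rule expand[of "\<mu> (h i)" "\<lambda>y. g i (\<chi> l (y \<odot>\<^sub>r\<^bsub>M\<^esub> r) \<odot>\<^bsub>M\<^esub> x)", symmetric, OF \<mu>h[OF i]])
            (use Dh(1,2)[OF gD[OF i]] \<chi>'[OF l] r x in \<open>auto simp: rsmult_distr smult_l_distr\<close>)
        also have "\<dots> = (\<Oplus>\<^bsub>R\<^esub>j\<in>B. g i (\<chi> j (\<mu> (h i)) \<odot>\<^bsub>M\<^esub> (\<chi> l (j \<odot>\<^sub>r\<^bsub>M\<^esub> r) \<odot>\<^bsub>M\<^esub> x)))"
          by (rule right_ring.finsum_cong')
            (use Dh(1)[OF gD[OF i]] \<chi>'(1)[OF _ \<mu>h[OF i]] \<chi>'(1,3)[OF l] BM r x in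
              \<open>auto simp: smult_rsmult smult_assoc1\<close>)
        finally show "?\<beta> (g i) (h i \<odot>\<^sub>r\<^bsub>?L\<^esub> r) =
            (\<Oplus>\<^bsub>R\<^esub>j\<in>B. g i (\<chi> j (\<mu> (h i)) \<odot>\<^bsub>M\<^esub> (\<chi> l (j \<odot>\<^sub>r\<^bsub>M\<^esub> r) \<odot>\<^bsub>M\<^esub> x)))" .
      qed
      also have "\<dots> = (\<Oplus>\<^bsub>R\<^esub>j\<in>B. \<Oplus>\<^bsub>R\<^esub>i\<in>I. g i (\<chi> j (\<mu> (h i)) \<odot>\<^bsub>M\<^esub> (\<chi> l (j \<odot>\<^sub>r\<^bsub>M\<^esub> r) \<odot>\<^bsub>M\<^esub> x)))"
        by (rule right_ring.finsum_swap[OF I B(1)]) (use gc[OF _ _ _ \<mu>h] \<chi>'(1)[OF l] BM r x in auto)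
      also have "\<dots> = (\<Oplus>\<^bsub>R\<^esub>j\<in>B. (\<gamma> j \<odot>\<^sub>r\<^bsub>?D\<^esub> \<chi> l (j \<odot>\<^sub>r\<^bsub>M\<^esub> r)) x)"
        by (rule right_ring.finsum_cong')
          (use x \<chi>'(1)[OF l] BM r Dh(1)[OF subsetD[OF _ funcset_mem[OF cl]]] Dh(1)[OF funcset_mem[OF cl] x] in
            \<open>auto simp: right_dual_simps(4) \<gamma>_def\<close>)
      also have "\<dots> = (\<Oplus>\<^bsub>?D\<^esub>j\<in>B. \<gamma> j \<odot>\<^sub>r\<^bsub>?D\<^esub> \<chi> l (j \<odot>\<^sub>r\<^bsub>M\<^esub> r)) x"
        by (rule additive_map_finsum[where h = "\<lambda>u. u x", OF D.M.abelian_group_axioms right_ring.abelian_group_axioms _ _ B(1) cl, symmetric])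
          (use x Dh(1) in \<open>auto simp: right_dual_simps(2)\<close>)
      finally show "(r \<odot>\<^bsub>?D\<^esub> \<gamma> l) x = (\<Oplus>\<^bsub>?D\<^esub>j\<in>B. \<gamma> j \<odot>\<^sub>r\<^bsub>?D\<^esub> \<chi> l (j \<odot>\<^sub>r\<^bsub>M\<^esub> r)) x" .
    qed
    show "u j \<otimes>\<^bsub>R\<^esub> r = (\<Oplus>\<^bsub>R\<^esub>l\<in>B. (u \<odot>\<^sub>r\<^bsub>?D\<^esub> \<chi> l (j \<odot>\<^sub>r\<^bsub>M\<^esub> r)) l)"
      if r: "r \<in> carrier R" and j: "j \<in> B" and u: "u \<in> carrier ?D" for r j u
    proof -
      have jr: "j \<odot>\<^sub>r\<^bsub>M\<^esub> r \<in> carrier M" using BM[OF j] r by simp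
      have "(\<Oplus>\<^bsub>R\<^esub>l\<in>B. (u \<odot>\<^sub>r\<^bsub>?D\<^esub> \<chi> l (j \<odot>\<^sub>r\<^bsub>M\<^esub> r)) l) = (\<Oplus>\<^bsub>R\<^esub>l\<in>B. u (\<chi> l (j \<odot>\<^sub>r\<^bsub>M\<^esub> r) \<odot>\<^bsub>M\<^esub> l))"
        by (rule right_ring.finsum_cong') (use BM \<chi>'(1)[OF _ jr] Dh(1)[OF u] in \<open>auto simp: right_dual_simps(4)\<close>)
      also have "\<dots> = u (j \<odot>\<^sub>r\<^bsub>M\<^esub> r)" by (rule expand[OF jr Dh(1,2)[OF u]])
      also have "\<dots> = u j \<otimes>\<^bsub>R\<^esub> r" by (rule Dh(3)[OF u r BM[OF j]])
      finally show ?thesis by simp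
    qed
  qed
  then show ?thesis by blast
qed

end

theorem proposition4p6:
  fixes k :: "('k, 'a) ring_scheme" and R :: "('r, 'b) ring_scheme" and \<phi> :: "'k \<Rightarrow> 'r"
    and l :: "('l, 'c) ring_scheme" and T :: "('t, 'd) ring_scheme" and \<psi> :: "'l \<Rightarrow> 't"
    and M :: "('t, 'r, 'm, 'e) bimodule_scheme"
  assumes "artin_algebra k R \<phi>"
    and "artin_algebra l T \<psi>"
    and "biseparable_bimodule T R M"
  shows "finite_representation_type R \<longleftrightarrow> finite_representation_type T"
proof -
  have sep: "separable_bimodule T R M" and sep_dual: "separable_bimodule R T (right_dual T R M)"
    and left: "fin_gen_module T M" "projective_module T M"
    and right: "fin_gen_module (op_ring R) (right_part M)" "projective_module (op_ring R) (right_part M)"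
    using assms(3) by (auto simp: biseparable_bimodule_def)
  interpret bimodule T R M using sep by (simp add: separable_bimodule_def)
  interpret D: bimodule R T "right_dual T R M" using sep_dual by (simp add: separable_bimodule_def)
  \<comment> \<open>A dual basis of \<open>M\<close> as a right module, that is, over
    \<open>op_ring R\<close>. It serves both directions: for expansions in \<open>M\<close>, and for
    reflexivity and finite generation of the dual.\<close>
  from dual_basis[OF right] obtain A \<pi> where A: "finite A" "A \<subseteq> carrier M"
    and \<pi>: "\<And>a. a \<in> A \<Longrightarrow> \<pi> a \<in> lmod_hom (op_ring R) (right_part M) (regular_bimodule (op_ring R))"
    and basis: "\<And>x. x \<in> carrier M \<Longrightarrow> x = (\<Oplus>\<^bsub>M\<^esub>a\<in>A. a \<odot>\<^sub>r\<^bsub>M\<^esub> \<pi> a x)"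
    unfolding right_part_simps finsum_right_part by blast
  from dual_basis[OF left] obtain B \<chi> where B: "finite B" "B \<subseteq> carrier M"
    and \<chi>: "\<And>b. b \<in> B \<Longrightarrow> \<chi> b \<in> lmod_hom T M (regular_bimodule T)"
    and basis_left: "\<And>x. x \<in> carrier M \<Longrightarrow> x = (\<Oplus>\<^bsub>M\<^esub>b\<in>B. \<chi> b x \<odot>\<^bsub>M\<^esub> b)"
    by blast
  obtain f where "casimir_system T R M A (\<lambda>a. a) f (\<lambda>t i j. \<pi> i (t \<odot>\<^bsub>M\<^esub> j))"
    using casimir_system_of_separable[OF sep A \<pi> basis] by blast
  then have "finite_representation_type R \<Longrightarrow> finite_representation_type T"
    by (rule casimir_system.finite_representation_type_transfer[OF _ assms(1,2) left(1)])
  moreover obtain \<gamma> where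
    "casimir_system R T (right_dual T R M) B \<gamma> (\<lambda>b g. g b) (\<lambda>r i j. \<chi> j (i \<odot>\<^sub>r\<^bsub>M\<^esub> r))"
    using dual_casimir_system_of_separable[OF sep_dual A \<pi> basis B \<chi> basis_left] by blast
  then have "finite_representation_type T \<Longrightarrow> finite_representation_type R"
    by (rule casimir_system.finite_representation_type_transfer[OF _ assms(2,1)
          fin_gen_right_dual[OF A D.left_module_axioms \<pi> basis]])
  ultimately show ?thesis by blast
qed

end
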